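(* Let $\lambda\in C^1(\mathbb{R};(0,+\infty))$, let $\overline{\rho}\in\mathbb{R}$ be a constant, let $k\in\mathbb{R}$, and set $d:=\overline{\rho}\,\lambda'(\overline{\rho})/\lambda(\overline{\rho})$. Consider the linear closed-loop system $$ \begin{cases} \tilde\rho_t(t,x)+\lambda(\overline{\rho})\,\tilde\rho_x(t,x)=0, & t\in(0,+\infty),\ x\in(0,1),\\ \tilde\rho(0,x)=\tilde\rho_0(x), & x\in(0,1),\\ \tilde u(t)=k\,\tilde y(t)+(k-1)\,d\,\lambda(\overline{\rho})\,\tilde W(t), & t\in(0,+\infty), \end{cases} $$ where $\tilde W(t):=\int_0^1\tilde\rho(t,x)\,dx$, $\tilde u(t):=\tilde\rho(t,0)\lambda(\overline{\rho})$ and $\tilde y(t):=\tilde\rho(t,1)\lambda(\overline{\rho})$. Then $0\in L^2(0,1)$ is exponentially stable in $L^2(0,1)$ for this system if and only if $d>-1$ and $|k|<1$. That is: the conditions $d>-1$ and $|k|<1$ hold if and only if there exist constants $C=C(\overline{\rho},k)>0$ and $\alpha=\alpha(\overline{\rho},k)>0$ such that, for every $\tilde\rho_0\in L^2(0,1)$, the weak solution $\tilde\rho\in C^0([0,+\infty);L^2(0,1))$ of the system satisfies $$\|\tilde\rho(t,\cdot)\|_{L^2(0,1)}\le C e^{-\alpha t}\|\tilde\rho_0\|_{L^2(0,1)},\qquad \forall t\in[0,+\infty).$$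
   Context: The function $\lambda$ is fixed throughout; the constants $C,\alpha$ may depend on it. A weak solution of the linear system is a function $\tilde\rho\in C^0([0,+\infty);L^2(0,1))$ for which there is a function $\tilde y\in L^2_{loc}([0,+\infty))$ (the outflux, representing $\tilde\rho(t,1)\lambda(\overline{\rho})$) such that, for every $\tau>0$ and every $\varphi\in C^1([0,\tau]\times[0,1])$ with $\varphi(\tau,x)=0$ for all $x\in[0,1]$, $$-\int_0^\tau\!\!\int_0^1\tilde\rho\,(\varphi_t+\lambda(\overline{\rho})\varphi_x)\,dx\,dt-\int_0^1\tilde\rho_0(x)\varphi(0,x)\,dx+\int_0^\tau\Big(\tilde y(t)\varphi(t,1)-\big[k\tilde y(t)+(k-1)d\,\lambda(\overline{\rho})\tilde W(t)\big]\varphi(t,0)\Big)dt=0,$$ where $\tilde W(t)=\int_0^1\tilde\rho(t,x)\,dx$. *)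

theory Defs
  imports "HOL-Analysis.Analysis"
begin

text \<open>Elements of the L2 spaces are represented by Lebesgue measurable functions; only their values
  on \<open>S\<close> matter.\<close>

definition L2_space :: "real set \<Rightarrow> (real \<Rightarrow> real) set" where
  "L2_space S = {f. f \<in> borel_measurable (lebesgue_on S) \<and> integrable (lebesgue_on S) (\<lambda>x. (f x)\<^sup>2)}"

definition L2_norm :: "real set \<Rightarrow> (real \<Rightarrow> real) \<Rightarrow> real" where
  "L2_norm S f = sqrt (LINT x|lebesgue_on S. (f x)\<^sup>2)"

definition L2_loc :: "(real \<Rightarrow> real) set" where
  "L2_loc = {y. \<forall>T>0. y \<in> L2_space {0..T}}"

definition C0_L2 :: "(real \<Rightarrow> real \<Rightarrow> real) set" where
  "C0_L2 = {\<rho>. (\<forall>t\<ge>0. \<rho> t \<in> L2_space {0<..<1}) \<and>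
     (\<forall>t\<ge>0. ((\<lambda>s. L2_norm {0<..<1} (\<lambda>x. \<rho> s x - \<rho> t x)) \<longlongrightarrow> 0) (at t within {0..}))}"

text \<open>Membership of \<open>\<phi>\<close> in \<open>C\<^sup>1([0,\<tau>] \<times> [0,1])\<close>, with partial derivatives \<open>\<phi>t\<close> and \<open>\<phi>x\<close>
  (one-sided on the boundary); for \<open>\<tau> > 0\<close> both are uniquely determined on the rectangle.\<close>

definition C1_rect ::
  "real \<Rightarrow> (real \<Rightarrow> real \<Rightarrow> real) \<Rightarrow> (real \<Rightarrow> real \<Rightarrow> real) \<Rightarrow> (real \<Rightarrow> real \<Rightarrow> real) \<Rightarrow> bool" where
  "C1_rect \<tau> \<phi> \<phi>t \<phi>x \<longleftrightarrow>
     continuous_on ({0..\<tau>} \<times> {0..1}) (\<lambda>(t, x). \<phi> t x) \<and>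
     continuous_on ({0..\<tau>} \<times> {0..1}) (\<lambda>(t, x). \<phi>t t x) \<and>
     continuous_on ({0..\<tau>} \<times> {0..1}) (\<lambda>(t, x). \<phi>x t x) \<and>
     (\<forall>t\<in>{0..\<tau>}. \<forall>x\<in>{0..1}.
        ((\<lambda>s. \<phi> s x) has_real_derivative \<phi>t t x) (at t within {0..\<tau>}) \<and>
        ((\<lambda>z. \<phi> t z) has_real_derivative \<phi>x t x) (at x within {0..1}))"

text \<open>Weak solutions of \<open>\<rho>\<^sub>t + c \<rho>\<^sub>x = 0\<close> on \<open>(0,\<infinity>) \<times> (0,1)\<close> with initial datum \<open>\<rho>0\<close> and feedback
  \<open>c \<rho>(t,0) = k y(t) + (k - 1) d c W(t)\<close>, where the outflux \<open>y\<close> represents \<open>c \<rho>(t,1)\<close> and \<open>W(t)\<close> is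
  the total mass. The space-time integral is iterated: the representatives \<open>\<rho> t\<close> are chosen for
  each \<open>t\<close> separately, so \<open>\<rho>\<close> need not be jointly measurable, whereas the inner integral is
  continuous in \<open>t\<close>.\<close>

definition total_mass :: "(real \<Rightarrow> real \<Rightarrow> real) \<Rightarrow> real \<Rightarrow> real" where
  "total_mass \<rho> t = (LINT x|lebesgue_on {0<..<1}. \<rho> t x)"

definition weak_solution ::
  "real \<Rightarrow> real \<Rightarrow> real \<Rightarrow> (real \<Rightarrow> real) \<Rightarrow> (real \<Rightarrow> real \<Rightarrow> real) \<Rightarrow> bool" where
  "weak_solution c k d \<rho>0 \<rho> \<longleftrightarrow> \<rho> \<in> C0_L2 \<and>
     (\<exists>y \<in> L2_loc. \<forall>\<tau>>0. \<forall>\<phi> \<phi>t \<phi>x. C1_rect \<tau> \<phi> \<phi>t \<phi>x \<and> (\<forall>x\<in>{0..1}. \<phi> \<tau> x = 0) \<longrightarrow>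
        - (LINT t|lebesgue_on {0..\<tau>}. LINT x|lebesgue_on {0<..<1}. \<rho> t x * (\<phi>t t x + c * \<phi>x t x))
        - (LINT x|lebesgue_on {0<..<1}. \<rho>0 x * \<phi> 0 x)
        + (LINT t|lebesgue_on {0..\<tau>}.
             y t * \<phi> t 1 - (k * y t + (k - 1) * d * c * total_mass \<rho> t) * \<phi> t 0) = 0)"

text \<open>``The weak solution with datum \<open>\<rho>0\<close> satisfies the estimate'' is rendered as: a weak solution
  exists, and every weak solution satisfies it. As the system is linear, the estimate with zero
  datum makes weak solutions unique up to equality almost everywhere in \<open>x\<close>.\<close>

definition exponentially_stable :: "real \<Rightarrow> real \<Rightarrow> real \<Rightarrow> bool" where
  "exponentially_stable c k d \<longleftrightarrow>
     (\<exists>C>0. \<exists>\<alpha>>0. \<forall>\<rho>0 \<in> L2_space {0<..<1}.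
        (\<exists>\<rho>. weak_solution c k d \<rho>0 \<rho>) \<and>
        (\<forall>\<rho>. weak_solution c k d \<rho>0 \<rho> \<longrightarrow>
           (\<forall>t\<ge>0. L2_norm {0<..<1} (\<rho> t) \<le> C * exp (- \<alpha> * t) * L2_norm {0<..<1} \<rho>0)))"

end

theory Submission
  imports Defs
begin

text \<open>Write \<open>c > 0\<close> for the constant speed and \<open>W\<close> for the total mass.  Everything rests on one energy
\<open>E(t) = \<parallel>\<rho>(t)\<parallel>\<^sup>2 + d W(t)\<^sup>2\<close>, where the norm is that of \<open>L\<^sup>2(0,1)\<close>.  With \<open>q(t) = y(t) / c + d W(t)\<close>,
which is \<open>\<rho>(t,1) + d W(t)\<close>, the outgoing trace is \<open>q - d W\<close>, the feedback makes the incoming trace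
\<open>k q - d W\<close>, and the mass obeys \<open>W' = - c (1 - k) q\<close>.  Therefore
\<open>(\<parallel>\<rho>\<parallel>\<^sup>2)' = c (k q - d W)\<^sup>2 - c (q - d W)\<^sup>2 = - c (1 - k\<^sup>2) q\<^sup>2 + 2 c (1 - k) d q W\<close>,
and the mixed term is exactly cancelled by \<open>(d W\<^sup>2)'\<close>: the energy satisfies
\<open>E' = - c (1 - k\<^sup>2) q\<^sup>2\<close> (\<open>energy_identity\<close>).

\<^bold>\<open>Sufficiency.\<close>  For \<open>d > -1\<close> the bound \<open>W\<^sup>2 \<le> \<parallel>\<rho>\<parallel>\<^sup>2\<close> makes \<open>E\<close> equivalent to the squared norm.  In one
crossing time \<open>1 / c\<close> the whole profile leaves through \<open>x = 1\<close>, so \<open>\<rho>(t\<^sub>0)\<close> can be read off from \<open>q\<close> on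
\<open>[t\<^sub>0, t\<^sub>0 + 1/c]\<close>, with \<open>E(t\<^sub>0) \<le> K \<integral> q\<^sup>2\<close> (\<open>observability\<close>).  Hence \<open>E\<close> drops by a fixed factor during each
crossing time when \<open>\<bar>k\<bar> < 1\<close> (\<open>exponential_decay\<close>).

\<^bold>\<open>Necessity.\<close>  Under exponential stability \<open>E(t)\<close> tends to \<open>0\<close> along every solution.  If \<open>\<bar>k\<bar> \<ge> 1\<close> then \<open>E\<close> is
nondecreasing, which is absurd for a datum with zero mass and positive norm.  If \<open>\<bar>k\<bar> < 1\<close> then \<open>E\<close> is
nonincreasing, and the datum \<open>1\<close>, of energy \<open>1 + d\<close>, forces \<open>d \<ge> -1\<close>.  For \<open>d = -1\<close> the
energy is nonnegative and starts at \<open>0\<close>, so \<open>q = 0\<close> almost everywhere, the mass stays equal to \<open>1\<close>, and again there is no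
decay (\<open>decay_constraints\<close>).

\<^bold>\<open>Regularity.\<close>  The energy balance has to be shown for an arbitrary weak solution.  Test functions
\<open>f(x - c t) g(t)\<close> remove the transport term, and the du Bois-Reymond argument in \<open>t\<close> turns the weak
formulation into integrated moment equations (\<open>moment_identity\<close>).  Letting \<open>f\<close> vary gives an identity
almost everywhere in the variable \<open>\<xi> = x - c t\<close>, in which the two summands on either side have
disjoint supports (\<open>AE_trajectory_identity\<close>); squaring it yields the balance of the norm.

\<^bold>\<open>Existence.\<close>  A solution is \<open>\<rho>(t,x) = G(c t - x)\<close> for a trace \<open>G\<close> on \<open>[-1, \<infinity>)\<close> that satisfies the delay equation
\<open>G(z) = k G(z - 1) + (k - 1) d \<integral> G\<close> over \<open>[z - 1, z]\<close>, which is solved one unit interval at a time by linear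
integral equations (\<open>delay_equation_solution\<close>).  Its weak formulation is Fubini's theorem along the
characteristics, and its continuity in time is the continuity of translations in \<open>L\<^sup>2\<close>.\<close>

section \<open>Products of indefinite Lebesgue integrals\<close>

lemma indicator_square: "(indicator A x * v)\<^sup>2 = indicator A x * v\<^sup>2" for v :: real
  by (simp add: indicator_def)

lemma integrable_lebesgue_on_Icc_iff:
  fixes f :: "real \<Rightarrow> real"
  shows "integrable (lebesgue_on {a..b}) f \<longleftrightarrow> integrable lebesgue (\<lambda>x. indicator {a..b} x * f x)"
  by (simp add: integrable_restrict_space)

lemma integral_lebesgue_on_Icc:
  fixes f :: "real \<Rightarrow> real"
  shows "(LINT x|lebesgue_on {a..b}. f x) = (LINT x|lebesgue. indicator {a..b} x * f x)"
  by (simp add: integral_restrict_space)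

lemma integrable_continuous_mult:
  fixes f h :: "real \<Rightarrow> real"
  assumes "continuous_on {a..b} h" "integrable (lebesgue_on {a..b}) f"
  shows "integrable (lebesgue_on {a..b}) (\<lambda>x. h x * f x)"
proof (rule absolutely_integrable_imp_integrable[OF absolutely_integrable_bounded_measurable_product_real])
  show "h \<in> borel_measurable (lebesgue_on {a..b})"
    by (rule continuous_imp_measurable_on_sets_lebesgue[OF assms(1)]) simp
  show "bounded (h ` {a..b})"
    using assms(1) compact_continuous_image compact_imp_bounded by blast
  show "set_integrable lebesgue {a..b} f"
    using assms(2) by (simp add: set_integrable_def integrable_restrict_space)
qed auto

lemma integrable_continuous_lebesgue_on:
  fixes h :: "real \<Rightarrow> real"
  assumes "continuous_on {a..b} h"
  shows "integrable (lebesgue_on {a..b}) h"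
  using continuous_imp_integrable_real[OF assms] .

lemma pair_sigma_finite_lebesgue: "pair_sigma_finite (lebesgue :: real measure) (lebesgue :: real measure)"
proof -
  have "sigma_finite_measure (lebesgue :: real measure)"
  proof
    obtain A :: "real set set" where A: "countable A" "A \<subseteq> sets lborel" "\<Union>A = space lborel"
      "\<forall>a\<in>A. emeasure lborel a \<noteq> \<infinity>"
      using lborel.sigma_finite_countable by blast
    moreover have "emeasure lebesgue a \<noteq> \<infinity>" if "a \<in> A" for a
      using A that emeasure_completion[of a lborel] by auto
    ultimately show "\<exists>A. countable A \<and> A \<subseteq> sets (lebesgue :: real measure) \<and> \<Union>A = space lebesgue
        \<and> (\<forall>a\<in>A. emeasure lebesgue a \<noteq> \<infinity>)"
      by (intro exI[of _ A]) auto
  qed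
  then show ?thesis by (simp add: pair_sigma_finite_def)
qed

text \<open>Fubini's theorem for \<open>F(s) G(r)\<close> on the plane cut along the diagonal: the half \<open>r \<le> s\<close> is integrated first in
\<open>r\<close>, the half \<open>s \<le> r\<close> first in \<open>s\<close>, and the diagonal itself is negligible.\<close>

lemma integral_product_split:
  fixes F G :: "real \<Rightarrow> real"
  assumes F[measurable]: "integrable lebesgue F" and G[measurable]: "integrable lebesgue G"
  shows "(LINT s|lebesgue. F s) * (LINT r|lebesgue. G r)
     = (LINT s|lebesgue. F s * (LINT r|lebesgue. indicator {..s} r * G r))
     + (LINT r|lebesgue. G r * (LINT s|lebesgue. indicator {..r} s * F s))"
proof -
  interpret pair_sigma_finite "lebesgue :: real measure" "lebesgue :: real measure"
    by (rule pair_sigma_finite_lebesgue)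
  have [measurable]: "(\<lambda>x::real. x) \<in> lebesgue \<rightarrow>\<^sub>M borel"
    by (simp add: measurable_completion)
  let ?H = "\<lambda>s r. F s * (indicator {..s} r * G r)"
  have FG: "integrable (lebesgue \<Otimes>\<^sub>M lebesgue) (\<lambda>(s, r). F s * G r)"
    by (rule Fubini_integrable) (use F G in \<open>auto simp: abs_mult\<close>)
  have eq: "indicator {..s} r = (if r \<le> s then 1 else (0::real))" for s r :: real
    by simp
  have Hm: "(\<lambda>(s, r). ?H s r) \<in> borel_measurable (lebesgue \<Otimes>\<^sub>M lebesgue)"
    unfolding eq by measurable
  have H: "integrable (lebesgue \<Otimes>\<^sub>M lebesgue) (\<lambda>(s, r). ?H s r)"
    by (rule Bochner_Integration.integrable_bound[OF FG Hm]) (auto simp: indicator_def)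
  have R: "(LINT s|lebesgue. indicator {..r} s * F s)
      = (LINT s|lebesgue. F s) - (LINT s|lebesgue. indicator {r..} s * F s)" for r
  proof -
    have "AE s in lebesgue. indicator {..r} s * F s = F s - indicator {r..} s * F s"
      by (rule AE_I'[of "{r}"]) (auto simp: indicator_def)
    then have "(LINT s|lebesgue. indicator {..r} s * F s) = (LINT s|lebesgue. F s - indicator {r..} s * F s)"
      by (intro integral_cong_AE) auto
    also have "\<dots> = (LINT s|lebesgue. F s) - (LINT s|lebesgue. indicator {r..} s * F s)"
      using integrable_mult_indicator[OF _ F, of "{r..}"]
      by (intro Bochner_Integration.integral_diff F) auto
    finally show ?thesis .
  qed
  have I1: "(LINT s|lebesgue. F s * (LINT r|lebesgue. indicator {..s} r * G r))
    = (LINT r|lebesgue. G r * (LINT s|lebesgue. indicator {r..} s * F s))"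
  proof -
    have "(LINT s|lebesgue. F s * (LINT r|lebesgue. indicator {..s} r * G r))
        = (LINT s|lebesgue. LINT r|lebesgue. ?H s r)" by simp
    also have "\<dots> = (LINT r|lebesgue. LINT s|lebesgue. ?H s r)"
      using Fubini_integral[of ?H] H by simp
    also have "\<dots> = (LINT r|lebesgue. LINT s|lebesgue. G r * (indicator {r..} s * F s))"
      by (intro Bochner_Integration.integral_cong) (auto simp: indicator_def)
    finally show ?thesis by simp
  qed
  have int: "integrable lebesgue (\<lambda>r. G r * (LINT s|lebesgue. indicator {r..} s * F s))"
  proof -
    have "integrable lebesgue (\<lambda>r. LINT s|lebesgue. ?H s r)"
      using integrable_snd[OF H] by simp
    also have "(\<lambda>r. LINT s|lebesgue. ?H s r) = (\<lambda>r. G r * (LINT s|lebesgue. indicator {r..} s * F s))"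
    proof
      fix r
      have "(LINT s|lebesgue. ?H s r) = (LINT s|lebesgue. G r * (indicator {r..} s * F s))"
        by (intro Bochner_Integration.integral_cong) (auto simp: indicator_def)
      then show "(LINT s|lebesgue. ?H s r) = G r * (LINT s|lebesgue. indicator {r..} s * F s)"
        by simp
    qed
    finally show ?thesis .
  qed
  show ?thesis
    unfolding R I1 right_diff_distrib
    using int G by (subst Bochner_Integration.integral_diff) auto
qed

lemma continuous_on_indefinite:
  fixes f :: "real \<Rightarrow> real"
  assumes "integrable (lebesgue_on {a..b}) f"
  shows "continuous_on {a..b} (\<lambda>s. U0 + (LINT r|lebesgue_on {a..s}. f r))"
  by (intro continuous_intros indefinite_integral_continuous_real assms)

text \<open>Integration by parts for absolutely continuous functions, with densities that are merely integrable.  This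
generality is what the mass \<open>W\<close> needs, as its derivative is only square integrable.\<close>

lemma product_rule_indefinite_integrals:
  fixes f g :: "real \<Rightarrow> real"
  assumes ab: "a \<le> b" and f: "integrable (lebesgue_on {a..b}) f" and g: "integrable (lebesgue_on {a..b}) g"
    and U: "\<And>s. s \<in> {a..b} \<Longrightarrow> U s = U0 + (LINT r|lebesgue_on {a..s}. f r)"
    and V: "\<And>s. s \<in> {a..b} \<Longrightarrow> V s = V0 + (LINT r|lebesgue_on {a..s}. g r)"
  shows "U b * V b - U0 * V0 = (LINT s|lebesgue_on {a..b}. f s * V s + U s * g s)"
proof -
  let ?F = "\<lambda>s. indicator {a..b} s * f s" and ?G = "\<lambda>s. indicator {a..b} s * g s"
  define u where "u s = (LINT r|lebesgue_on {a..s}. f r)" for s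
  define v where "v s = (LINT r|lebesgue_on {a..s}. g r)" for s
  have F: "integrable lebesgue ?F" and G: "integrable lebesgue ?G"
    using f g by (simp_all add: integrable_lebesgue_on_Icc_iff)
  have cut: "indicator {..s} r * (indicator {a..b} r * w) = indicator {a..s} r * w"
    if "s \<in> {a..b}" for s r w :: real
    using that by (auto simp: indicator_def)
  have *: "u b * v b = (LINT s|lebesgue_on {a..b}. f s * v s) + (LINT s|lebesgue_on {a..b}. g s * u s)"
  proof -
    have cutF: "(LINT r|lebesgue. indicator {..s} r * ?F r) = u s"
      and cutG: "(LINT r|lebesgue. indicator {..s} r * ?G r) = v s" if "s \<in> {a..b}" for s
      unfolding u_def v_def integral_lebesgue_on_Icc cut[OF that] by simp_all
    have "(LINT s|lebesgue. ?F s * (LINT r|lebesgue. indicator {..s} r * ?G r))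
        = (LINT s|lebesgue. indicator {a..b} s * (f s * v s))"
      by (intro Bochner_Integration.integral_cong refl) (auto simp: cutG split: split_indicator)
    moreover have "(LINT s|lebesgue. ?G s * (LINT r|lebesgue. indicator {..s} r * ?F r))
        = (LINT s|lebesgue. indicator {a..b} s * (g s * u s))"
      by (intro Bochner_Integration.integral_cong refl) (auto simp: cutF split: split_indicator)
    ultimately show ?thesis
      using integral_product_split[OF F G] by (simp add: u_def v_def integral_lebesgue_on_Icc)
  qed
  have cu: "continuous_on {a..b} u" and cv: "continuous_on {a..b} v"
    unfolding u_def v_def using f g indefinite_integral_continuous_real by blast+
  have i1: "integrable (lebesgue_on {a..b}) (\<lambda>s. f s * v s)"
    and i2: "integrable (lebesgue_on {a..b}) (\<lambda>s. g s * u s)"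
    using integrable_continuous_mult[OF cv f] integrable_continuous_mult[OF cu g] by (simp_all add: mult.commute)
  have "(LINT s|lebesgue_on {a..b}. f s * V s + U s * g s)
      = (LINT s|lebesgue_on {a..b}. (V0 * f s + f s * v s) + (U0 * g s + g s * u s))"
    by (intro Bochner_Integration.integral_cong) (auto simp: U V u_def v_def algebra_simps)
  also have "\<dots> = (V0 * u b + (LINT s|lebesgue_on {a..b}. f s * v s)) + (U0 * v b + (LINT s|lebesgue_on {a..b}. g s * u s))"
    using f g i1 i2 by (simp add: u_def v_def)
  also have "\<dots> = U b * V b - U0 * V0"
    using * ab by (simp add: U V u_def[symmetric] v_def[symmetric] algebra_simps)
  finally show ?thesis by simp
qed

text \<open>The Cauchy-Schwarz inequality against the constant \<open>1\<close>: with \<open>L\<close> the total measure and \<open>m\<close> the integral of \<open>f\<close>,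
expand the integral of \<open>(L f - m)\<^sup>2\<close>, which is nonnegative.\<close>

lemma integral_power2_le:
  fixes f :: "'a \<Rightarrow> real"
  assumes "finite_measure M" and f: "f \<in> borel_measurable M" and f2: "integrable M (\<lambda>x. (f x)\<^sup>2)"
  shows "integrable M f" and "(LINT x|M. f x)\<^sup>2 \<le> measure M (space M) * (LINT x|M. (f x)\<^sup>2)"
proof -
  interpret finite_measure M by fact
  show i: "integrable M f"
  proof (rule Bochner_Integration.integrable_bound[OF _ f])
    show "integrable M (\<lambda>x. 1 + (f x)\<^sup>2)" using f2 by simp
    have "\<bar>z\<bar> \<le> 1 + z\<^sup>2" for z :: real
      using sum_squares_bound[of "\<bar>z\<bar>" 1] by (simp add: power2_eq_square)
    then show "AE x in M. norm (f x) \<le> norm (1 + (f x)\<^sup>2)"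
      by (auto simp: add_nonneg_nonneg abs_of_nonneg)
  qed
  define m where "m = (LINT x|M. f x)"
  define L where "L = measure M (space M)"
  have "0 \<le> (LINT x|M. (L * f x - m)\<^sup>2)" by simp
  also have "(LINT x|M. (L * f x - m)\<^sup>2) = (LINT x|M. L\<^sup>2 * (f x)\<^sup>2 - 2 * L * m * f x + m\<^sup>2)"
    by (intro Bochner_Integration.integral_cong) (auto simp: power2_eq_square algebra_simps)
  also have "\<dots> = L\<^sup>2 * (LINT x|M. (f x)\<^sup>2) - 2 * L * m * m + m\<^sup>2 * L"
    using i f2 by (simp add: m_def[symmetric] L_def mult.commute)
  finally have *: "0 \<le> L * (L * (LINT x|M. (f x)\<^sup>2) - m\<^sup>2)"
    by (simp add: power2_eq_square algebra_simps)
  show "m\<^sup>2 \<le> L * (LINT x|M. (f x)\<^sup>2)" 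
  proof (cases "L = 0")
    case True
    then have "emeasure M (space M) = 0" by (simp add: L_def emeasure_eq_measure)
    then have "AE x in M. f x = 0" by (auto intro!: AE_I[of _ _ "space M"])
    then have "m = 0" unfolding m_def by (intro integral_eq_zero_AE) auto
    then show ?thesis using True by simp
  next
    case False
    then have "L > 0" by (simp add: L_def less_le)
    with * show ?thesis by (simp add: zero_le_mult_iff)
  qed
qed

section \<open>Functions determined by their moments\<close>

text \<open>If \<open>H\<close> denotes the right-hand side, integration by parts turns the hypothesis into \<open>\<integral> (h - H) g' = 0\<close> for all
\<open>C\<^sup>1\<close> functions \<open>g\<close> that vanish at \<open>\<tau>\<close>.  The primitive of \<open>h - H\<close> that vanishes at \<open>\<tau>\<close> is such a \<open>g\<close>, and it
gives \<open>\<integral> (h - H)\<^sup>2 = 0\<close> for the continuous function \<open>h - H\<close>.\<close>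

lemma du_Bois_Reymond_initial_value:
  fixes h w :: "real \<Rightarrow> real"
  assumes tau: "\<tau> > 0" and h: "continuous_on {0..\<tau>} h" and w: "integrable (lebesgue_on {0..\<tau>}) w"
    and weak: "\<And>g g'. (\<And>t. t \<in> {0..\<tau>} \<Longrightarrow> (g has_real_derivative g' t) (at t within {0..\<tau>}))
       \<Longrightarrow> continuous_on {0..\<tau>} g' \<Longrightarrow> g \<tau> = 0
       \<Longrightarrow> (LINT t|lebesgue_on {0..\<tau>}. h t * g' t) + h0 * g 0 + (LINT t|lebesgue_on {0..\<tau>}. w t * g t) = 0"
    and t: "t \<in> {0..\<tau>}"
  shows "h t = h0 + (LINT s|lebesgue_on {0..t}. w s)"
proof -
  define H where "H s = h0 + (LINT r|lebesgue_on {0..s}. w r)" for s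
  define D where "D s = h s - H s" for s
  have cH: "continuous_on {0..\<tau>} H"
    unfolding H_def by (rule continuous_on_indefinite[OF w])
  have cD: "continuous_on {0..\<tau>} D"
    unfolding D_def by (intro continuous_intros h cH)
  define g where "g s = integral {0..s} D - integral {0..\<tau>} D" for s
  have g': "(g has_real_derivative D s) (at s within {0..\<tau>})" if "s \<in> {0..\<tau>}" for s
    unfolding g_def
    by (auto intro!: derivative_eq_intros integral_has_real_derivative[OF cD that])
  have iD: "integrable (lebesgue_on {0..\<tau>}) D"
    by (rule integrable_continuous_lebesgue_on[OF cD])
  have gL: "g s = g 0 + (LINT r|lebesgue_on {0..s}. D r)" if "s \<in> {0..\<tau>}" for s
  proof -
    have "integrable (lebesgue_on {0..s}) D"
      by (rule integrable_subinterval[OF iD]) (use that in auto)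
    then show ?thesis by (simp add: g_def lebesgue_integral_eq_integral)
  qed
  have cg: "continuous_on {0..\<tau>} g"
    using DERIV_continuous_on g' by blast
  have "H \<tau> * g \<tau> - h0 * g 0 = (LINT s|lebesgue_on {0..\<tau>}. w s * g s + H s * D s)"
    by (rule product_rule_indefinite_integrals[OF less_imp_le[OF tau] w iD H_def gL])
  moreover have "(LINT t|lebesgue_on {0..\<tau>}. h t * D t) + h0 * g 0 + (LINT t|lebesgue_on {0..\<tau>}. w t * g t) = 0"
    by (rule weak[OF g' cD]) (auto simp: g_def)
  moreover have iwg: "integrable (lebesgue_on {0..\<tau>}) (\<lambda>s. w s * g s)"
    using integrable_continuous_mult[OF cg w] by (simp add: mult.commute)
  moreover have iHD: "integrable (lebesgue_on {0..\<tau>}) (\<lambda>s. H s * D s)"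
    and ihD: "integrable (lebesgue_on {0..\<tau>}) (\<lambda>s. h s * D s)"
    using integrable_continuous_mult[OF cH iD] integrable_continuous_mult[OF h iD] by auto
  ultimately have "(LINT s|lebesgue_on {0..\<tau>}. h s * D s) - (LINT s|lebesgue_on {0..\<tau>}. H s * D s) = 0"
    by (simp add: g_def)
  then have "(LINT s|lebesgue_on {0..\<tau>}. h s * D s - H s * D s) = 0"
    using iHD ihD by simp
  then have "(LINT s|lebesgue_on {0..\<tau>}. (D s)\<^sup>2) = 0"
    by (simp add: D_def power2_eq_square algebra_simps)
  moreover have cD2: "continuous_on {0..\<tau>} (\<lambda>s. (D s)\<^sup>2)"
    by (intro continuous_intros cD)
  ultimately have "integral {0..\<tau>} (\<lambda>s. (D s)\<^sup>2) = 0"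
    by (simp add: lebesgue_integral_eq_integral integrable_continuous_lebesgue_on)
  then have "(D t)\<^sup>2 = 0"
    using integral_eq_0_iff[OF cD2 tau] t by auto
  then show ?thesis by (simp add: D_def H_def)
qed

lemma arctan_scaled_tendsto_sgn:
  "(\<lambda>n. arctan (real n * y)) \<longlonglongrightarrow> pi / 2 * sgn y"
proof -
  consider "y > 0" | "y = 0" | "y < 0" by linarith
  then show ?thesis
  proof cases
    case 1
    have "filterlim (\<lambda>n. real n * y) at_top sequentially"
      by (rule filterlim_at_top_mult_tendsto_pos[OF tendsto_const 1 filterlim_real_sequentially])
    from filterlim_compose[OF tendsto_arctan_at_top this] 1 show ?thesis by simp
  next
    case 3
    have "filterlim (\<lambda>n. real n * y) at_bot sequentially"
      using filterlim_tendsto_neg_mult_at_bot[OF tendsto_const 3 filterlim_real_sequentially] by (simp add: mult.commute)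
    from filterlim_compose[OF tendsto_arctan_at_bot this] 3 show ?thesis by simp
  qed simp
qed

text \<open>The positive and the negative part of \<open>F\<close> are densities of two finite measures that agree on all half-lines,
hence coincide.  The argument takes place on Borel sets, so \<open>F\<close> is first replaced by a Borel function.\<close>

lemma AE_zero_if_Ioi_integrals_zero:
  fixes F :: "real \<Rightarrow> real"
  assumes F: "integrable lebesgue F"
    and zero: "\<And>a. (LINT x|lebesgue. indicator {a<..} x * F x) = 0"
  shows "AE x in lebesgue. F x = 0"
proof -
  obtain G where G[measurable]: "G \<in> borel_measurable lborel" and FG: "AE x in lborel. F x = G x"
    using completion_ex_borel_measurable_real[of F lborel] F by auto
  have FG': "AE x in lebesgue. F x = G x"
    using FG by (rule AE_completion)
  have Gm: "G \<in> borel_measurable lebesgue"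
    using G measurable_completion by blast
  have "integrable lebesgue G"
    by (rule integrable_cong_AE_imp[OF F Gm]) (use FG' in auto)
  then have Gi: "integrable lborel G"
    using integrable_completion[OF G] by simp
  have Gz: "(LINT x|lborel. indicator {a<..} x * G x) = 0" for a
  proof -
    have "(LINT x|lborel. indicator {a<..} x * G x) = (LINT x|lebesgue. indicator {a<..} x * G x)"
      by (rule integral_completion[symmetric]) simp
    also have "\<dots> = (LINT x|lebesgue. indicator {a<..} x * F x)"
      by (rule integral_cong_AE) (use FG' Gm F in \<open>auto intro!: borel_measurable_times borel_measurable_indicator\<close>)
    finally show ?thesis using zero by simp
  qed
  define P where "P = (\<lambda>x. max (G x) 0)"
  define N where "N = (\<lambda>x. max (- G x) 0)"
  have PN[measurable]: "P \<in> borel_measurable borel" "N \<in> borel_measurable borel"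
    using G unfolding P_def N_def by simp_all
  have iPN: "integrable lborel P" "integrable lborel N"
    unfolding P_def N_def by (intro integrable_max Gi Bochner_Integration.integrable_minus integrable_zero)+
  have ind: "integrable lborel (\<lambda>x. indicator {a<..} x * P x)" "integrable lborel (\<lambda>x. indicator {a<..} x * N x)" for a
    using integrable_mult_indicator[of "{a<..}" lborel, OF _ iPN(1)] integrable_mult_indicator[of "{a<..}" lborel, OF _ iPN(2)]
    by simp_all
  have em: "emeasure (density lborel (\<lambda>x. ennreal (P x))) {a<..} = ennreal (LINT x|lborel. indicator {a<..} x * P x)"
    "emeasure (density lborel (\<lambda>x. ennreal (N x))) {a<..} = ennreal (LINT x|lborel. indicator {a<..} x * N x)" for a
  proof -
    have e: "ennreal u * indicator {a<..} x = ennreal (indicator {a<..} x * u)" for u x :: real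
      by (auto simp: indicator_def)
    have "(\<integral>\<^sup>+x. ennreal (indicator {a<..} x * P x) \<partial>lborel) = ennreal (LINT x|lborel. indicator {a<..} x * P x)"
      by (rule nn_integral_eq_integral[OF ind(1)]) (simp add: P_def)
    then show "emeasure (density lborel (\<lambda>x. ennreal (P x))) {a<..} = ennreal (LINT x|lborel. indicator {a<..} x * P x)"
      by (simp add: emeasure_density e)
    have "(\<integral>\<^sup>+x. ennreal (indicator {a<..} x * N x) \<partial>lborel) = ennreal (LINT x|lborel. indicator {a<..} x * N x)"
      by (rule nn_integral_eq_integral[OF ind(2)]) (simp add: N_def)
    then show "emeasure (density lborel (\<lambda>x. ennreal (N x))) {a<..} = ennreal (LINT x|lborel. indicator {a<..} x * N x)"
      by (simp add: emeasure_density e)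
  qed
  have eqPN: "(LINT x|lborel. indicator {a<..} x * P x) = (LINT x|lborel. indicator {a<..} x * N x)" for a
  proof -
    have "(LINT x|lborel. indicator {a<..} x * P x) - (LINT x|lborel. indicator {a<..} x * N x)
       = (LINT x|lborel. indicator {a<..} x * P x - indicator {a<..} x * N x)"
      using ind by simp
    also have "\<dots> = (LINT x|lborel. indicator {a<..} x * G x)"
      by (intro Bochner_Integration.integral_cong) (auto simp: P_def N_def indicator_def)
    finally show ?thesis using Gz by simp
  qed
  have "density lborel (\<lambda>x. ennreal (P x)) = density lborel (\<lambda>x. ennreal (N x))"
    by (rule measure_eqI_lessThan) (simp_all add: em eqPN)
  then have "AE x in lborel. ennreal (P x) = ennreal (N x)"
    by (intro sigma_finite_measure.density_unique[OF lborel.sigma_finite_measure_axioms]) auto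
  then have "AE x in lborel. G x = 0"
    by eventually_elim (auto simp: P_def N_def max_def split: if_splits)
  with FG have "AE x in lborel. F x = 0" by eventually_elim simp
  then show ?thesis by (rule AE_completion)
qed

text \<open>The functions \<open>arctan (n (x - a))\<close> are bounded uniformly in \<open>n\<close> and converge to a multiple of the sign of
\<open>x - a\<close>, so dominated convergence and the constant function \<open>1\<close> give the integrals of \<open>F\<close> over all half-lines.\<close>

lemma AE_zero_if_orthogonal_to_bounded_C1:
  fixes F :: "real \<Rightarrow> real"
  assumes F: "integrable lebesgue F"
    and orth: "\<And>f f' B. (\<And>x. (f has_real_derivative f' x) (at x)) \<Longrightarrow> continuous_on UNIV f'
       \<Longrightarrow> (\<And>x. \<bar>f x\<bar> \<le> B) \<Longrightarrow> (LINT x|lebesgue. F x * f x) = 0"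
  shows "AE x in lebesgue. F x = 0"
proof (rule AE_zero_if_Ioi_integrals_zero[OF F])
  fix a :: real
  have [measurable]: "(\<lambda>x::real. x) \<in> lebesgue \<rightarrow>\<^sub>M borel"
    by (simp add: measurable_completion)
  have [measurable]: "F \<in> borel_measurable lebesgue" using F by auto
  have z: "(LINT x|lebesgue. F x * arctan (real n * (x - a))) = 0" for n
  proof (rule orth[where f' = "\<lambda>x. real n / (1 + (real n * (x - a))\<^sup>2)" and B = "pi/2"])
    show "((\<lambda>x. arctan (real n * (x - a))) has_real_derivative real n / (1 + (real n * (x - a))\<^sup>2)) (at x)" for x
      by (auto intro!: derivative_eq_intros simp: divide_inverse)
    show "continuous_on UNIV (\<lambda>x. real n / (1 + (real n * (x - a))\<^sup>2))"
      by (intro continuous_intros) (simp add: add_nonneg_eq_0_iff)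
    show "\<bar>arctan (real n * (x - a))\<bar> \<le> pi / 2" for x
      using arctan_bounded[of "real n * (x - a)"] by linarith
  qed
  have m2: "(\<lambda>x. F x * arctan (real n * (x - a))) \<in> borel_measurable lebesgue" for n
    by measurable
  have "(\<lambda>n. LINT x|lebesgue. F x * arctan (real n * (x - a))) \<longlonglongrightarrow> (LINT x|lebesgue. F x * (pi / 2 * sgn (x - a)))"
  proof (rule integral_dominated_convergence[where w = "\<lambda>x. pi / 2 * \<bar>F x\<bar>"])
    show "(\<lambda>x. F x * (pi / 2 * sgn (x - a))) \<in> borel_measurable lebesgue" by measurable
    show "integrable lebesgue (\<lambda>x. pi / 2 * \<bar>F x\<bar>)" using F by auto
    show "AE x in lebesgue. (\<lambda>n. F x * arctan (real n * (x - a))) \<longlonglongrightarrow> F x * (pi / 2 * sgn (x - a))"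
      by (intro AE_I2 tendsto_mult tendsto_const arctan_scaled_tendsto_sgn)
    show "AE x in lebesgue. norm (F x * arctan (real n * (x - a))) \<le> pi / 2 * \<bar>F x\<bar>" for n
    proof (rule AE_I2)
      fix x
      have "\<bar>arctan (real n * (x - a))\<bar> \<le> pi / 2"
        using arctan_bounded[of "real n * (x - a)"] by linarith
      from mult_right_mono[OF this, of "\<bar>F x\<bar>"]
      show "norm (F x * arctan (real n * (x - a))) \<le> pi / 2 * \<bar>F x\<bar>"
        by (simp add: abs_mult mult.commute)
    qed
  qed (rule m2)
  then have s0: "(LINT x|lebesgue. F x * (pi / 2 * sgn (x - a))) = 0"
    unfolding z using LIMSEQ_unique tendsto_const by blast
  have one: "(LINT x|lebesgue. F x * 1) = 0"
    by (rule orth[where f' = "\<lambda>_. 0" and B = 1]) auto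
  have isg: "integrable lebesgue (\<lambda>x. F x * (pi / 2 * sgn (x - a)))"
    by (rule Bochner_Integration.integrable_bound[of _ "\<lambda>x. pi / 2 * F x"])
       (use F in \<open>auto simp: abs_mult sgn_if\<close>)
  have "(LINT x|lebesgue. indicator {a<..} x * F x) = (LINT x|lebesgue. (1/2) * F x + (1 / pi) * (F x * (pi / 2 * sgn (x - a))))"
  proof (rule integral_cong_AE)
    show "AE x in lebesgue. indicator {a<..} x * F x = (1/2) * F x + (1 / pi) * (F x * (pi / 2 * sgn (x - a)))"
      by (rule AE_I'[of "{a}"]) (auto simp: indicator_def sgn_if split: if_splits)
  qed measurable
  also have "\<dots> = (1/2) * (LINT x|lebesgue. F x * 1) + (1 / pi) * (LINT x|lebesgue. F x * (pi / 2 * sgn (x - a)))"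
    using F isg by (subst Bochner_Integration.integral_add) (simp_all only: integrable_mult_right integral_mult_right_zero mult_1_right)
  also have "\<dots> = 0"
    unfolding one s0 by simp
  finally show "(LINT x|lebesgue. indicator {a<..} x * F x) = 0" .
qed

section \<open>Square integrable functions\<close>

lemma L2_spaceD:
  assumes "f \<in> L2_space S"
  shows "f \<in> borel_measurable (lebesgue_on S)" "integrable (lebesgue_on S) (\<lambda>x. (f x)\<^sup>2)"
  using assms by (simp_all add: L2_space_def)

lemma L2_space_subinterval:
  assumes "f \<in> L2_space {a..b}" "{c..d} \<subseteq> {a..b}"
  shows "f \<in> L2_space {c..d}"
  unfolding L2_space_def mem_Collect_eq
  using measurable_restrict_mono[OF L2_spaceD(1)[OF assms(1)] assms(2)]
    integrable_subinterval[OF L2_spaceD(2)[OF assms(1)] assms(2)] by (rule conjI)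

lemma L2_space_integrable:
  assumes "f \<in> L2_space S" "S \<in> lmeasurable"
  shows "integrable (lebesgue_on S) f"
  by (rule integral_power2_le(1)[OF finite_measure_lebesgue_on L2_spaceD]) (fact assms)+

lemma L2_space_square_integral_le:
  assumes "f \<in> L2_space S" "S \<in> lmeasurable"
  shows "(LINT x|lebesgue_on S. f x)\<^sup>2 \<le> measure lebesgue S * (LINT x|lebesgue_on S. (f x)\<^sup>2)"
proof -
  have "measure (lebesgue_on S) (space (lebesgue_on S)) = measure lebesgue S"
    using assms(2) by (subst measure_restrict_space) (auto dest: fmeasurableD)
  then show ?thesis
    using integral_power2_le(2)[OF finite_measure_lebesgue_on[OF assms(2)] L2_spaceD[OF assms(1)]] by simp
qed

lemma continuous_imp_L2: "continuous_on {a..b} h \<Longrightarrow> h \<in> L2_space {a..b}" for h :: "real \<Rightarrow> real"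
  unfolding L2_space_def
  by (auto intro!: continuous_imp_measurable_on_sets_lebesgue integrable_continuous_lebesgue_on continuous_intros)

lemma L2_space_linear:
  assumes "f \<in> L2_space S" "g \<in> L2_space S"
  shows "(\<lambda>x. a * f x + b * g x) \<in> L2_space S"
proof -
  have m: "f \<in> borel_measurable (lebesgue_on S)" "g \<in> borel_measurable (lebesgue_on S)"
    using assms by (auto simp: L2_space_def)
  have "integrable (lebesgue_on S) (\<lambda>x. (a * f x + b * g x)\<^sup>2)"
  proof (rule Bochner_Integration.integrable_bound)
    show "integrable (lebesgue_on S) (\<lambda>x. 2 * a\<^sup>2 * (f x)\<^sup>2 + 2 * b\<^sup>2 * (g x)\<^sup>2)"
      using assms by (auto simp: L2_space_def)
    show "(\<lambda>x. (a * f x + b * g x)\<^sup>2) \<in> borel_measurable (lebesgue_on S)"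
      using m by measurable
    have "(a * v + b * w)\<^sup>2 \<le> 2 * a\<^sup>2 * v\<^sup>2 + 2 * b\<^sup>2 * w\<^sup>2" for v w
      using sum_squares_bound[of "a * v" "b * w"] by (simp add: power2_eq_square algebra_simps)
    then show "AE x in lebesgue_on S. norm ((a * f x + b * g x)\<^sup>2) \<le> norm (2 * a\<^sup>2 * (f x)\<^sup>2 + 2 * b\<^sup>2 * (g x)\<^sup>2)"
      by simp
  qed
  then show ?thesis using m by (simp add: L2_space_def)
qed

lemma L2_space_diff:
  assumes "f \<in> L2_space S" "g \<in> L2_space S"
  shows "(\<lambda>x. f x - g x) \<in> L2_space S"
  using L2_space_linear[OF assms, of 1 "-1"] by simp

lemma L2_space_bounded_mult:
  assumes f: "f \<in> L2_space S" and h: "h \<in> borel_measurable (lebesgue_on S)" and B: "\<And>x. \<bar>h x\<bar> \<le> B"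
  shows "(\<lambda>x. f x * h x) \<in> L2_space S"
    and "(LINT x|lebesgue_on S. (f x * h x)\<^sup>2) \<le> B\<^sup>2 * (LINT x|lebesgue_on S. (f x)\<^sup>2)"
proof -
  have m: "(\<lambda>x. f x * h x) \<in> borel_measurable (lebesgue_on S)"
    and f2: "integrable (lebesgue_on S) (\<lambda>x. B\<^sup>2 * (f x)\<^sup>2)"
    using f h by (auto simp: L2_space_def)
  have le: "(f x * h x)\<^sup>2 \<le> B\<^sup>2 * (f x)\<^sup>2" for x
    using mult_left_mono[OF power_mono[OF B[of x] abs_ge_zero, of 2] zero_le_power2[of "f x"]]
    by (simp add: power_mult_distrib mult.commute)
  have i: "integrable (lebesgue_on S) (\<lambda>x. (f x * h x)\<^sup>2)"
    by (rule Bochner_Integration.integrable_bound[OF f2]) (use m le in auto)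
  show "(\<lambda>x. f x * h x) \<in> L2_space S"
    using m i by (simp add: L2_space_def)
  show "(LINT x|lebesgue_on S. (f x * h x)\<^sup>2) \<le> B\<^sup>2 * (LINT x|lebesgue_on S. (f x)\<^sup>2)"
    using integral_mono[OF i f2 le] by simp
qed

lemma lmeasurable_Ioo [simp]: "{a<..<b::real} \<in> lmeasurable"
  using lmeasurable_box[of a b] by (simp add: box_real)

lemma lmeasurable_Icc [simp]: "{a..b::real} \<in> lmeasurable"
  using lmeasurable_cbox[of a b] by (simp add: box_real)

text \<open>Strong continuity of \<open>t \<mapsto> \<rho>(t)\<close> in \<open>L\<^sup>2\<close> controls the change of the profile, dominated convergence that of the
weight.  Boundedness of \<open>f\<close> is what makes both estimates uniform.\<close>

lemma continuous_on_moving_moment: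
  assumes rho: "\<rho> \<in> C0_L2" and f: "continuous_on UNIV f" and B: "\<And>x. \<bar>f x\<bar> \<le> B"
  shows "continuous_on {0..} (\<lambda>t. LINT x|lebesgue_on {0<..<1}. \<rho> t x * f (x - c * t))"
proof (unfold continuous_on_sequentially, safe)
  let ?M = "lebesgue_on {0<..<1::real}"
  fix s :: "nat \<Rightarrow> real" and t :: real
  assume t: "0 \<le> t" and s: "\<forall>n. s n \<in> {0..}" and st: "s \<longlonglongrightarrow> t"
  have rs: "\<rho> (s n) \<in> L2_space {0<..<1}" and rt: "\<rho> t \<in> L2_space {0<..<1}" for n
    using rho s t by (auto simp: C0_L2_def)
  have fm: "(\<lambda>x. f (x - a)) \<in> borel_measurable ?M" for a
    by (rule continuous_imp_measurable_on_sets_lebesgue)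
       (auto intro!: continuous_on_compose2[OF f] continuous_intros)
  have "continuous (at t within {0..}) (\<lambda>s. L2_norm {0<..<1} (\<lambda>x. \<rho> s x - \<rho> t x))"
    using rho t by (auto simp: C0_L2_def continuous_within L2_norm_def)
  then have n0: "(\<lambda>n. L2_norm {0<..<1} (\<lambda>x. \<rho> (s n) x - \<rho> t x)) \<longlonglongrightarrow> 0"
    using s st unfolding continuous_within_sequentially by (auto simp: o_def L2_norm_def)
  have I1: "(\<lambda>n. LINT x|?M. (\<rho> (s n) x - \<rho> t x) * f (x - c * s n)) \<longlonglongrightarrow> 0"
  proof (rule Lim_null_comparison[OF always_eventually])
    show "\<forall>n. norm (LINT x|?M. (\<rho> (s n) x - \<rho> t x) * f (x - c * s n))
        \<le> \<bar>B\<bar> * L2_norm {0<..<1} (\<lambda>x. \<rho> (s n) x - \<rho> t x)"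
    proof
      fix n
      note d = L2_space_diff[OF rs rt, of n]
      have "(LINT x|?M. (\<rho> (s n) x - \<rho> t x) * f (x - c * s n))\<^sup>2
          \<le> (LINT x|?M. ((\<rho> (s n) x - \<rho> t x) * f (x - c * s n))\<^sup>2)"
        using L2_space_square_integral_le[OF L2_space_bounded_mult(1)[OF d fm B]] by simp
      also have "\<dots> \<le> B\<^sup>2 * (LINT x|?M. (\<rho> (s n) x - \<rho> t x)\<^sup>2)"
        by (rule L2_space_bounded_mult(2)[OF d fm B])
      finally have "sqrt ((LINT x|?M. (\<rho> (s n) x - \<rho> t x) * f (x - c * s n))\<^sup>2)
         \<le> sqrt (B\<^sup>2 * (LINT x|?M. (\<rho> (s n) x - \<rho> t x)\<^sup>2))"
        by (rule real_sqrt_le_mono)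
      then show "norm (LINT x|?M. (\<rho> (s n) x - \<rho> t x) * f (x - c * s n))
        \<le> \<bar>B\<bar> * L2_norm {0<..<1} (\<lambda>x. \<rho> (s n) x - \<rho> t x)"
        by (simp add: L2_norm_def real_sqrt_mult)
    qed
    show "(\<lambda>n. \<bar>B\<bar> * L2_norm {0<..<1} (\<lambda>x. \<rho> (s n) x - \<rho> t x)) \<longlonglongrightarrow> 0"
      using tendsto_mult_right_zero[OF n0] by simp
  qed
  have B0: "0 \<le> B" using B[of 0] by linarith
  have I2: "(\<lambda>n. LINT x|?M. \<rho> t x * f (x - c * s n)) \<longlonglongrightarrow> (LINT x|?M. \<rho> t x * f (x - c * t))"
  proof (rule integral_dominated_convergence[where w = "\<lambda>x. B * \<bar>\<rho> t x\<bar>"])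
    show "(\<lambda>x. \<rho> t x * f (x - c * t)) \<in> borel_measurable ?M"
      "(\<lambda>x. \<rho> t x * f (x - c * s n)) \<in> borel_measurable ?M" for n
      using rt fm by (auto simp: L2_space_def)
    show "integrable ?M (\<lambda>x. B * \<bar>\<rho> t x\<bar>)"
      using L2_space_integrable[OF rt] by simp
    have "isCont f y" for y using f by (simp add: continuous_on_eq_continuous_at)
    then show "AE x in ?M. (\<lambda>n. \<rho> t x * f (x - c * s n)) \<longlonglongrightarrow> \<rho> t x * f (x - c * t)"
      by (intro AE_I2 tendsto_mult tendsto_const isCont_tendsto_compose[of _ f] tendsto_diff st)
    show "AE x in ?M. norm (\<rho> t x * f (x - c * s n)) \<le> B * \<bar>\<rho> t x\<bar>" for n
      using mult_right_mono[OF B abs_ge_zero] by (auto simp: abs_mult mult.commute)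
  qed
  have i: "integrable ?M (\<lambda>x. (\<rho> (s n) x - \<rho> t x) * f (x - c * s n))"
    "integrable ?M (\<lambda>x. \<rho> t x * f (x - c * s n))" for n
    using L2_space_integrable[OF L2_space_bounded_mult(1)[OF L2_space_diff[OF rs rt] fm B]]
      L2_space_integrable[OF L2_space_bounded_mult(1)[OF rt fm B]] by auto
  have "(LINT x|?M. (\<rho> (s n) x - \<rho> t x) * f (x - c * s n)) + (LINT x|?M. \<rho> t x * f (x - c * s n))
      = (LINT x|?M. \<rho> (s n) x * f (x - c * s n))" for n
    by (subst Bochner_Integration.integral_add[OF i, symmetric]) (simp add: algebra_simps)
  with tendsto_add[OF I1 I2]
  show "((\<lambda>t. LINT x|?M. \<rho> t x * f (x - c * t)) \<circ> s) \<longlonglongrightarrow> (LINT x|?M. \<rho> t x * f (x - c * t))"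
    by (simp add: o_def)
qed

text \<open>The map \<open>\<xi> \<mapsto> (a - \<xi>) / c\<close> is the time at which the characteristic \<open>x - c t = \<xi>\<close> passes through \<open>x = a\<close>.\<close>

lemma
  fixes p :: "real \<Rightarrow> real"
  assumes c: "c > 0"
  shows integrable_along_characteristics:
      "integrable lebesgue (\<lambda>\<xi>. indicator {t0..t1} ((a - \<xi>) / c) * p ((a - \<xi>) / c)) \<longleftrightarrow> integrable (lebesgue_on {t0..t1}) p"
    and integral_along_characteristics:
      "(LINT \<xi>|lebesgue. indicator {t0..t1} ((a - \<xi>) / c) * p ((a - \<xi>) / c)) = c * (LINT s|lebesgue_on {t0..t1}. p s)"
proof -
  have e: "a / c + (- 1 / c) * \<xi> = (a - \<xi>) / c" for \<xi>
    using c by (simp add: field_simps)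
  show "integrable lebesgue (\<lambda>\<xi>. indicator {t0..t1} ((a - \<xi>) / c) * p ((a - \<xi>) / c)) \<longleftrightarrow> integrable (lebesgue_on {t0..t1}) p"
    using lebesgue_integrable_real_affine_iff[of "-1 / c" "\<lambda>s. indicator {t0..t1} s * p s" "a / c"] c
    by (simp only: e integrable_lebesgue_on_Icc_iff) simp
  show "(LINT \<xi>|lebesgue. indicator {t0..t1} ((a - \<xi>) / c) * p ((a - \<xi>) / c)) = c * (LINT s|lebesgue_on {t0..t1}. p s)"
    using lebesgue_integral_real_affine[of "-1 / c" "\<lambda>s. indicator {t0..t1} s * p s" "a / c"] c
    by (simp only: e integral_lebesgue_on_Icc) simp
qed

lemma
  fixes g :: "real \<Rightarrow> real"
  shows integrable_moving_frame:
      "integrable lebesgue (\<lambda>\<xi>. indicator {0<..<1} (\<xi> + a) * g (\<xi> + a)) \<longleftrightarrow> integrable (lebesgue_on {0<..<1}) g"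
    and integral_moving_frame:
      "(LINT \<xi>|lebesgue. indicator {0<..<1} (\<xi> + a) * g (\<xi> + a)) = (LINT x|lebesgue_on {0<..<1}. g x)"
  using lebesgue_integrable_real_affine_iff[of 1 "\<lambda>s. indicator {0<..<1} s * g s" a]
     lebesgue_integral_real_affine[of 1 "\<lambda>s. indicator {0<..<1} s * g s" a]
  by (simp_all add: integrable_restrict_space integral_restrict_space add.commute)

section \<open>Weak solutions along characteristics\<close>

text \<open>A weak solution \<open>\<rho>\<close> of the closed loop together with one choice of the outflux \<open>y\<close>.\<close>

locale weak_transport =
  fixes c k d :: real and \<rho>0 :: "real \<Rightarrow> real" and \<rho> :: "real \<Rightarrow> real \<Rightarrow> real" and y :: "real \<Rightarrow> real"
  assumes c_pos: "c > 0" and rho0: "\<rho>0 \<in> L2_space {0<..<1}" and rho: "\<rho> \<in> C0_L2" and y: "y \<in> L2_loc"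
    and weak: "\<And>\<tau> \<phi> \<phi>t \<phi>x. \<tau> > 0 \<Longrightarrow> C1_rect \<tau> \<phi> \<phi>t \<phi>x \<Longrightarrow> \<forall>x\<in>{0..1}. \<phi> \<tau> x = 0 \<Longrightarrow>
        - (LINT t|lebesgue_on {0..\<tau>}. LINT x|lebesgue_on {0<..<1}. \<rho> t x * (\<phi>t t x + c * \<phi>x t x))
        - (LINT x|lebesgue_on {0<..<1}. \<rho>0 x * \<phi> 0 x)
        + (LINT t|lebesgue_on {0..\<tau>}.
             y t * \<phi> t 1 - (k * y t + (k - 1) * d * c * total_mass \<rho> t) * \<phi> t 0) = 0"
begin

abbreviation W :: "real \<Rightarrow> real" where "W \<equiv> total_mass \<rho>"

definition influx :: "real \<Rightarrow> real" where "influx t = k * y t + (k - 1) * d * c * W t"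

lemma rho_L2: "t \<ge> 0 \<Longrightarrow> \<rho> t \<in> L2_space {0<..<1}"
  using rho by (auto simp: C0_L2_def)

lemma rho_integrable: "t \<ge> 0 \<Longrightarrow> integrable (lebesgue_on {0<..<1}) (\<rho> t)"
  by (rule L2_space_integrable[OF rho_L2]) auto

lemma y_L2: "y \<in> L2_space {a..b}" if "0 \<le> a"
proof -
  have "y \<in> L2_space {0..max b 1}"
    using y by (auto simp: L2_loc_def)
  then show ?thesis
    by (rule L2_space_subinterval) (use that in auto)
qed

lemma y_integrable: "0 \<le> a \<Longrightarrow> integrable (lebesgue_on {a..b}) y"
  by (rule L2_space_integrable[OF y_L2]) auto

lemma continuous_on_W: "continuous_on {0..} W"
  using continuous_on_moving_moment[OF rho, of "\<lambda>_. 1" 1 c] by (simp add: total_mass_def)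

lemma continuous_on_W': "0 \<le> a \<Longrightarrow> continuous_on {a..b} W"
  by (rule continuous_on_subset[OF continuous_on_W]) auto

lemma influx_L2: "influx \<in> L2_space {a..b}" if "0 \<le> a"
  using L2_space_linear[OF y_L2[OF that] continuous_imp_L2[OF continuous_on_W'[OF that]], of k "(k - 1) * d * c" b]
  by (simp add: influx_def[abs_def])

lemma influx_integrable: "0 \<le> a \<Longrightarrow> integrable (lebesgue_on {a..b}) influx"
  by (rule L2_space_integrable[OF influx_L2]) auto

text \<open>For the test function \<open>f(x - c t) g(t)\<close> the factor \<open>f(x - c t)\<close> is constant along the characteristics, so
\<open>\<phi>\<^sub>t + c \<phi>\<^sub>x = f(x - c t) g'(t)\<close>.  The moment \<open>h(t)\<close> of \<open>\<rho>(t)\<close> against \<open>f(x - c t)\<close> thus has the fluxes through the two ends as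
its distributional derivative and the moment of the datum as its initial value.\<close>

lemma moment_identity:
  assumes f': "\<And>x. (f has_real_derivative f' x) (at x)" and cf': "continuous_on UNIV f'"
    and B: "\<And>x. \<bar>f x\<bar> \<le> B" and t: "t \<ge> 0"
  shows "(LINT x|lebesgue_on {0<..<1}. \<rho> t x * f (x - c * t))
     = (LINT x|lebesgue_on {0<..<1}. \<rho>0 x * f x)
       + (LINT s|lebesgue_on {0..t}. influx s * f (- c * s) - y s * f (1 - c * s))"
proof -
  have cf: "continuous_on UNIV f"
    using f' DERIV_continuous_on by (metis UNIV_I has_field_derivative_at_within)
  define h where "h s = (LINT x|lebesgue_on {0<..<1}. \<rho> s x * f (x - c * s))" for s
  define h0 where "h0 = (LINT x|lebesgue_on {0<..<1}. \<rho>0 x * f x)"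
  define w where "w s = influx s * f (- c * s) - y s * f (1 - c * s)" for s
  \<comment> \<open>any horizon beyond \<open>t\<close> will do; it must be positive even for \<open>t = 0\<close>\<close>
  define \<tau> where "\<tau> = t + 1"
  have tau: "\<tau> > 0" "t \<in> {0..\<tau>}" using t by (auto simp: \<tau>_def)
  have w: "integrable (lebesgue_on {0..\<tau>}) w"
  proof -
    have "continuous_on {0..\<tau>} (\<lambda>s. f (- c * s))" "continuous_on {0..\<tau>} (\<lambda>s. f (1 - c * s))"
      by (auto intro!: continuous_on_compose2[OF cf] continuous_intros)
    from integrable_continuous_mult[OF this(1) influx_integrable[OF order_refl]]
      integrable_continuous_mult[OF this(2) y_integrable[OF order_refl]]
    show ?thesis unfolding w_def by (simp add: mult.commute)
  qed
  have ch: "continuous_on {0..\<tau>} h"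
    unfolding h_def by (rule continuous_on_subset[OF continuous_on_moving_moment[OF rho cf B]]) auto
  have "h t = h0 + (LINT s|lebesgue_on {0..t}. w s)"
  proof (rule du_Bois_Reymond_initial_value[OF tau(1) ch w _ tau(2)])
    fix g g' :: "real \<Rightarrow> real"
    assume g': "\<And>s. s \<in> {0..\<tau>} \<Longrightarrow> (g has_real_derivative g' s) (at s within {0..\<tau>})"
      and cg': "continuous_on {0..\<tau>} g'" and gt: "g \<tau> = 0"
    have cg: "continuous_on {0..\<tau>} g"
      using DERIV_continuous_on g' by blast
    let ?R = "{0..\<tau>} \<times> {0..1::real}"
    have fst_comp: "continuous_on ?R (\<lambda>p. e (fst p))" if "continuous_on {0..\<tau>} e" for e :: "real \<Rightarrow> real"
      by (rule continuous_on_compose2[OF that]) (auto intro!: continuous_intros)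
    have char_comp: "continuous_on ?R (\<lambda>p. e (snd p - c * fst p))" if "continuous_on UNIV e" for e :: "real \<Rightarrow> real"
      by (rule continuous_on_compose2[OF that]) (auto intro!: continuous_intros)
    \<comment> \<open>a profile transported with the flow, modulated in time\<close>
    let ?\<phi> = "\<lambda>s x. f (x - c * s) * g s"
    let ?\<phi>t = "\<lambda>s x. - c * f' (x - c * s) * g s + f (x - c * s) * g' s"
    let ?\<phi>x = "\<lambda>s x. f' (x - c * s) * g s"
    have "C1_rect \<tau> ?\<phi> ?\<phi>t ?\<phi>x"
      unfolding C1_rect_def case_prod_beta
    proof (intro conjI ballI)
      fix s x :: real assume s: "s \<in> {0..\<tau>}"
      show "((\<lambda>s. ?\<phi> s x) has_real_derivative ?\<phi>t s x) (at s within {0..\<tau>})"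
        by (auto intro!: derivative_eq_intros DERIV_chain2[OF f'] g'[OF s])
      show "((\<lambda>x. ?\<phi> s x) has_real_derivative ?\<phi>x s x) (at x within {0..1})"
        by (auto intro!: derivative_eq_intros DERIV_chain2[OF f'])
    qed (intro continuous_intros fst_comp char_comp cf cf' cg cg')+
    from weak[OF tau(1) this]
    have "- (LINT s|lebesgue_on {0..\<tau>}. LINT x|lebesgue_on {0<..<1}. \<rho> s x * (?\<phi>t s x + c * ?\<phi>x s x))
        - (LINT x|lebesgue_on {0<..<1}. \<rho>0 x * ?\<phi> 0 x)
        + (LINT s|lebesgue_on {0..\<tau>}. y s * ?\<phi> s 1 - influx s * ?\<phi> s 0) = 0"
      by (simp add: gt influx_def)
    moreover have "(LINT s|lebesgue_on {0..\<tau>}. LINT x|lebesgue_on {0<..<1}. \<rho> s x * (?\<phi>t s x + c * ?\<phi>x s x))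
        = (LINT s|lebesgue_on {0..\<tau>}. h s * g' s)"
    proof -
      have "\<rho> s x * (?\<phi>t s x + c * ?\<phi>x s x) = \<rho> s x * f (x - c * s) * g' s" for s x
        by (simp add: algebra_simps)
      then show ?thesis by (simp only: h_def integral_mult_left_zero)
    qed
    moreover have "(LINT x|lebesgue_on {0<..<1}. \<rho>0 x * ?\<phi> 0 x) = h0 * g 0"
      by (simp add: h0_def flip: mult.assoc)
    moreover have "(LINT s|lebesgue_on {0..\<tau>}. y s * ?\<phi> s 1 - influx s * ?\<phi> s 0) = - (LINT s|lebesgue_on {0..\<tau>}. w s * g s)"
      by (subst Bochner_Integration.integral_minus[symmetric])
         (intro Bochner_Integration.integral_cong refl, simp add: w_def algebra_simps)
    ultimately show "(LINT s|lebesgue_on {0..\<tau>}. h s * g' s) + h0 * g 0 + (LINT s|lebesgue_on {0..\<tau>}. w s * g s) = 0"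
      by simp
  qed
  then show ?thesis by (simp add: h_def h0_def w_def)
qed

text \<open>At \<open>t = 0\<close> the moment identity says that \<open>\<rho>(0)\<close> and \<open>\<rho>\<^sub>0\<close> have the same moments.\<close>

lemma AE_initial: "AE x in lebesgue_on {0<..<1}. \<rho> 0 x = \<rho>0 x"
proof -
  let ?D = "\<lambda>x. \<rho> 0 x - \<rho>0 x"
  have D: "?D \<in> L2_space {0<..<1}"
    by (rule L2_space_diff[OF rho_L2 rho0]) simp
  have Di: "integrable lebesgue (\<lambda>x. indicator {0<..<1} x * ?D x)"
    using L2_space_integrable[OF D] by (simp add: integrable_restrict_space)
  have "AE x in lebesgue. indicator {0<..<1} x * ?D x = 0"
  proof (rule AE_zero_if_orthogonal_to_bounded_C1[OF Di])
    fix f f' :: "real \<Rightarrow> real" and B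
    assume f: "\<And>x. (f has_real_derivative f' x) (at x)" "continuous_on UNIV f'" "\<And>x. \<bar>f x\<bar> \<le> B"
    have fm: "f \<in> borel_measurable (lebesgue_on {0<..<1})"
      by (rule continuous_imp_measurable_on_sets_lebesgue)
         (auto intro!: DERIV_continuous_on f(1)[THEN has_field_derivative_at_within])
    have i: "integrable (lebesgue_on {0<..<1}) (\<lambda>x. \<rho> 0 x * f x)" "integrable (lebesgue_on {0<..<1}) (\<lambda>x. \<rho>0 x * f x)"
      by (rule L2_space_integrable[OF L2_space_bounded_mult(1)[OF _ fm f(3)]], auto intro: rho_L2 rho0)+
    have "(LINT x|lebesgue. (indicator {0<..<1} x * ?D x) * f x) = (LINT x|lebesgue_on {0<..<1}. \<rho> 0 x * f x - \<rho>0 x * f x)"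
      by (simp add: integral_restrict_space algebra_simps)
    also have "\<dots> = (LINT s|lebesgue_on {0..0}. influx s * f (- c * s) - y s * f (1 - c * s))"
      using moment_identity[OF f order_refl] i by simp
    also have "\<dots> = 0"
      using has_bochner_integral_null[of "{0::real}" "\<lambda>s. influx s * f (- c * s) - y s * f (1 - c * s)"]
      by (simp add: has_bochner_integral_iff)
    finally show "(LINT x|lebesgue. (indicator {0<..<1} x * ?D x) * f x) = 0" .
  qed
  then show ?thesis
    by (simp add: AE_restrict_space_iff) (auto elim!: eventually_mono)
qed

lemma moment_increment:
  assumes f: "\<And>x. (f has_real_derivative f' x) (at x)" "continuous_on UNIV f'" "\<And>x. \<bar>f x\<bar> \<le> B"
    and t: "0 \<le> t0" "t0 \<le> t1"
  shows "(LINT x|lebesgue_on {0<..<1}. \<rho> t1 x * f (x - c * t1)) - (LINT x|lebesgue_on {0<..<1}. \<rho> t0 x * f (x - c * t0))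
    = (LINT s|lebesgue_on {t0..t1}. influx s * f (- c * s)) - (LINT s|lebesgue_on {t0..t1}. y s * f (1 - c * s))"
proof -
  have cf: "continuous_on UNIV f"
    using f(1) DERIV_continuous_on by (metis UNIV_I has_field_derivative_at_within)
  have cc: "continuous_on S (\<lambda>s. f (- c * s))" "continuous_on S (\<lambda>s. f (1 - c * s))" for S
    by (auto intro!: continuous_on_compose2[OF cf] continuous_intros)
  have i: "integrable (lebesgue_on {a..b}) (\<lambda>s. influx s * f (- c * s))"
     "integrable (lebesgue_on {a..b}) (\<lambda>s. y s * f (1 - c * s))" if "0 \<le> a" for a b
    using integrable_continuous_mult[OF cc(1) influx_integrable[OF that]]
      integrable_continuous_mult[OF cc(2) y_integrable[OF that]] by (simp_all add: mult.commute)
  have "(LINT s|lebesgue_on {0..t1}. influx s * f (- c * s) - y s * f (1 - c * s))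
     = (LINT s|lebesgue_on {0..t0}. influx s * f (- c * s) - y s * f (1 - c * s))
     + (LINT s|lebesgue_on {t0..t1}. influx s * f (- c * s) - y s * f (1 - c * s))"
    by (rule integral_combine) (use i t in auto)
  with moment_identity[OF f t(1)] moment_identity[OF f order_trans[OF t]] i[OF t(1)]
  show ?thesis by simp
qed

text \<open>In the variable \<open>\<xi> = x - c t\<close>, which labels characteristics, the profiles at times \<open>t0\<close> and \<open>t1\<close> differ by what
has left through \<open>x = 1\<close> and what has entered through \<open>x = 0\<close> in between.  The characteristic \<open>\<xi>\<close> leaves at time
\<open>(1 - \<xi>) / c\<close> and enters at time \<open>- \<xi> / c\<close>.  Both sides have the same moments against every bounded \<open>C\<^sup>1\<close> function.\<close>

lemma AE_trajectory_identity:
  assumes t: "0 \<le> t0" "t0 \<le> t1"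
  shows "AE \<xi> in lebesgue.
      indicator {0<..<1} (\<xi> + c * t1) * \<rho> t1 (\<xi> + c * t1) + indicator {t0..t1} ((1 - \<xi>) / c) * (y ((1 - \<xi>) / c) / c)
    = indicator {0<..<1} (\<xi> + c * t0) * \<rho> t0 (\<xi> + c * t0) + indicator {t0..t1} ((0 - \<xi>) / c) * (influx ((0 - \<xi>) / c) / c)"
proof -
  let ?R = "\<lambda>t \<xi>. indicator {0<..<1} (\<xi> + c * t) * \<rho> t (\<xi> + c * t)"
  let ?Y = "\<lambda>\<xi>. indicator {t0..t1} ((1 - \<xi>) / c) * (y ((1 - \<xi>) / c) / c)"
  let ?U = "\<lambda>\<xi>. indicator {t0..t1} ((0 - \<xi>) / c) * (influx ((0 - \<xi>) / c) / c)"
  let ?F = "\<lambda>\<xi>. (?R t1 \<xi> + ?Y \<xi>) - (?R t0 \<xi> + ?U \<xi>)"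
  have t1: "0 \<le> t1" using t by simp
  have iF: "integrable lebesgue ?F"
    using rho_integrable[OF t(1)] rho_integrable[OF t1] y_integrable[OF t(1)] influx_integrable[OF t(1)]
    by (intro Bochner_Integration.integrable_diff Bochner_Integration.integrable_add)
       (simp_all only: integrable_moving_frame integrable_along_characteristics[OF c_pos, where p = "\<lambda>s. y s / c"]
         integrable_along_characteristics[OF c_pos, where p = "\<lambda>s. influx s / c"] integrable_divide)
  have "AE \<xi> in lebesgue. ?F \<xi> = 0"
  proof (rule AE_zero_if_orthogonal_to_bounded_C1[OF iF])
    fix f f' :: "real \<Rightarrow> real" and B
    assume f: "\<And>x. (f has_real_derivative f' x) (at x)" "continuous_on UNIV f'" "\<And>x. \<bar>f x\<bar> \<le> B"
    have cf: "continuous_on UNIV f"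
      using f(1) DERIV_continuous_on by (metis UNIV_I has_field_derivative_at_within)
    have cc: "continuous_on S (\<lambda>s. f (a - c * s))" for S a
      by (auto intro!: continuous_on_compose2[OF cf] continuous_intros)
    have fm: "(\<lambda>x. f (x - a)) \<in> borel_measurable (lebesgue_on {0<..<1})" for a
      by (rule continuous_imp_measurable_on_sets_lebesgue)
         (auto intro!: continuous_on_compose2[OF cf] continuous_intros)
    have Rf: "integrable lebesgue (\<lambda>\<xi>. ?R t \<xi> * f \<xi>)
        \<and> (LINT \<xi>|lebesgue. ?R t \<xi> * f \<xi>) = (LINT x|lebesgue_on {0<..<1}. \<rho> t x * f (x - c * t))" if "t \<ge> 0" for t
    proof -
      have e: "?R t \<xi> * f \<xi> = indicator {0<..<1} (\<xi> + c * t) * (\<lambda>x. \<rho> t x * f (x - c * t)) (\<xi> + c * t)" for \<xi>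
        by simp
      show ?thesis
        unfolding e
        using L2_space_integrable[OF L2_space_bounded_mult(1)[OF rho_L2[OF that] fm f(3)], of "c * t"]
          integrable_moving_frame[of "c * t" "\<lambda>x. \<rho> t x * f (x - c * t)"]
          integral_moving_frame[of "c * t" "\<lambda>x. \<rho> t x * f (x - c * t)"] by simp
    qed
    have If: "integrable lebesgue (\<lambda>\<xi>. (indicator {t0..t1} ((a - \<xi>) / c) * (z ((a - \<xi>) / c) / c)) * f \<xi>)
        \<and> (LINT \<xi>|lebesgue. (indicator {t0..t1} ((a - \<xi>) / c) * (z ((a - \<xi>) / c) / c)) * f \<xi>)
          = (LINT s|lebesgue_on {t0..t1}. z s * f (a - c * s))" if z: "integrable (lebesgue_on {t0..t1}) z" for a z
    proof -
      have e: "(indicator {t0..t1} ((a - \<xi>) / c) * (z ((a - \<xi>) / c) / c)) * f \<xi>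
          = indicator {t0..t1} ((a - \<xi>) / c) * (\<lambda>s. z s * f (a - c * s) / c) ((a - \<xi>) / c)" for \<xi>
        using c_pos by simp
      show ?thesis
        unfolding e
        using c_pos integrable_continuous_mult[OF cc z, of a]
          integrable_along_characteristics[OF c_pos, of t0 t1 a "\<lambda>s. z s * f (a - c * s) / c"]
          integral_along_characteristics[OF c_pos, of t0 t1 a "\<lambda>s. z s * f (a - c * s) / c"]
        by (simp add: mult.commute)
    qed
    note R0 = Rf[OF t(1)] and R1 = Rf[OF t1] and IY = If[OF y_integrable[OF t(1)], of 1]
      and IU = If[OF influx_integrable[OF t(1)], of 0]
    have "(LINT \<xi>|lebesgue. ?F \<xi> * f \<xi>) = (LINT \<xi>|lebesgue. (?R t1 \<xi> * f \<xi> + ?Y \<xi> * f \<xi>) - (?R t0 \<xi> * f \<xi> + ?U \<xi> * f \<xi>))"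
      by (simp only: left_diff_distrib distrib_right)
    also have "\<dots> = ((LINT \<xi>|lebesgue. ?R t1 \<xi> * f \<xi>) + (LINT \<xi>|lebesgue. ?Y \<xi> * f \<xi>))
        - ((LINT \<xi>|lebesgue. ?R t0 \<xi> * f \<xi>) + (LINT \<xi>|lebesgue. ?U \<xi> * f \<xi>))"
      using R0 R1 IY IU
      by (simp only: Bochner_Integration.integral_diff Bochner_Integration.integral_add Bochner_Integration.integrable_add)
    also have "\<dots> = 0"
      using R0 R1 IY IU moment_increment[OF f t] by simp
    finally show "(LINT \<xi>|lebesgue. ?F \<xi> * f \<xi>) = 0" .
  qed
  then show ?thesis by eventually_elim simp
qed

definition sq_norm :: "real \<Rightarrow> real" where "sq_norm t = (LINT x|lebesgue_on {0<..<1}. (\<rho> t x)\<^sup>2)"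

text \<open>On each side of the trajectory identity a characteristic contributes to only one of the two summands: at time
\<open>t1\<close> it has either left or not, and at time \<open>t0\<close> it has either entered or not.  So the cross terms disappear when
the identity is squared.\<close>

lemma norm_balance:
  assumes t: "0 \<le> t0" "t0 \<le> t1"
  shows "sq_norm t1 + (LINT s|lebesgue_on {t0..t1}. (y s)\<^sup>2) / c = sq_norm t0 + (LINT s|lebesgue_on {t0..t1}. (influx s)\<^sup>2) / c"
proof -
  let ?R = "\<lambda>t \<xi>. indicator {0<..<1} (\<xi> + c * t) * \<rho> t (\<xi> + c * t)"
  let ?I = "\<lambda>z a \<xi>. indicator {t0..t1} ((a - \<xi>) / c) * (z ((a - \<xi>) / c) / c)"
  have t1: "0 \<le> t1" using t by simp
  have R: "integrable lebesgue (\<lambda>\<xi>. (?R t \<xi>)\<^sup>2)" "(LINT \<xi>|lebesgue. (?R t \<xi>)\<^sup>2) = sq_norm t" if "t \<ge> 0" for t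
    using L2_spaceD(2)[OF rho_L2[OF that]]
      integrable_moving_frame[of "c * t" "\<lambda>x. (\<rho> t x)\<^sup>2"] integral_moving_frame[of "c * t" "\<lambda>x. (\<rho> t x)\<^sup>2"]
    by (simp_all add: indicator_square sq_norm_def)
  have I: "integrable lebesgue (\<lambda>\<xi>. (?I z a \<xi>)\<^sup>2)"
    "(LINT \<xi>|lebesgue. (?I z a \<xi>)\<^sup>2) = (LINT s|lebesgue_on {t0..t1}. (z s)\<^sup>2) / c" if "z \<in> L2_space {t0..t1}" for z a
  proof -
    have i: "integrable (lebesgue_on {t0..t1}) (\<lambda>s. (z s / c)\<^sup>2)"
      using L2_spaceD(2)[OF that] by (simp add: power_divide)
    show "integrable lebesgue (\<lambda>\<xi>. (?I z a \<xi>)\<^sup>2)"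
      unfolding indicator_square using integrable_along_characteristics[OF c_pos, of t0 t1 a "\<lambda>s. (z s / c)\<^sup>2"] i by simp
    show "(LINT \<xi>|lebesgue. (?I z a \<xi>)\<^sup>2) = (LINT s|lebesgue_on {t0..t1}. (z s)\<^sup>2) / c"
      unfolding indicator_square using integral_along_characteristics[OF c_pos, of t0 t1 a "\<lambda>s. (z s / c)\<^sup>2"] c_pos
      by (simp add: power_divide) (simp add: power2_eq_square)
  qed
  have "(LINT \<xi>|lebesgue. (?R t1 \<xi>)\<^sup>2 + (?I y 1 \<xi>)\<^sup>2) = (LINT \<xi>|lebesgue. (?R t0 \<xi>)\<^sup>2 + (?I influx 0 \<xi>)\<^sup>2)"
  proof (rule integral_cong_AE)
    \<comment> \<open>characteristics that have left by \<open>t1\<close> do not appear in the profile at \<open>t1\<close>\<close>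
    have d1: "?R t1 \<xi> * ?I y 1 \<xi> = 0" for \<xi>
    proof -
      have "(1 - \<xi>) / c \<le> t1 \<longrightarrow> 1 \<le> \<xi> + c * t1"
        using c_pos by (auto simp: field_simps)
      then show ?thesis by (auto simp: indicator_def)
    qed
    \<comment> \<open>characteristics that enter after \<open>t0\<close> do not appear in the profile at \<open>t0\<close>\<close>
    have d0: "?R t0 \<xi> * ?I influx 0 \<xi> = 0" for \<xi>
    proof -
      have "t0 \<le> (0 - \<xi>) / c \<longrightarrow> \<xi> + c * t0 \<le> 0"
        using c_pos by (auto simp: field_simps)
      then show ?thesis by (auto simp: indicator_def)
    qed
    have sq: "a\<^sup>2 + b\<^sup>2 = e\<^sup>2 + g\<^sup>2" if "a + b = e + g" "a * b = 0" "e * g = 0" for a b e g :: real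
    proof -
      have "(a + b)\<^sup>2 = (e + g)\<^sup>2" using that(1) by simp
      then show ?thesis using that(2,3) by (auto simp: power2_sum)
    qed
    show "AE \<xi> in lebesgue. (?R t1 \<xi>)\<^sup>2 + (?I y 1 \<xi>)\<^sup>2 = (?R t0 \<xi>)\<^sup>2 + (?I influx 0 \<xi>)\<^sup>2"
      using AE_trajectory_identity[OF t] by eventually_elim (rule sq[OF _ d1 d0])
  qed (intro borel_measurable_integrable Bochner_Integration.integrable_add R I y_L2 influx_L2 t t1)+
  then show ?thesis
    by (simp only: Bochner_Integration.integral_add[OF R(1)[OF t1] I(1)[OF y_L2[OF t(1)]]]
        Bochner_Integration.integral_add[OF R(1)[OF t(1)] I(1)[OF influx_L2[OF t(1)]]]
        R(2)[OF t1] R(2)[OF t(1)] I(2)[OF y_L2[OF t(1)]] I(2)[OF influx_L2[OF t(1)]])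
qed

text \<open>The moment equation for the weight \<open>1\<close>.\<close>

lemma mass_balance:
  assumes t: "0 \<le> t0" "t0 \<le> t1"
  shows "W t1 = W t0 + (LINT s|lebesgue_on {t0..t1}. influx s - y s)"
proof -
  have "(LINT x|lebesgue_on {0<..<1}. \<rho> t1 x * 1) - (LINT x|lebesgue_on {0<..<1}. \<rho> t0 x * 1)
    = (LINT s|lebesgue_on {t0..t1}. influx s * 1) - (LINT s|lebesgue_on {t0..t1}. y s * 1)"
    by (rule moment_increment[where f' = "\<lambda>_. 0" and B = 1]) (use t in auto)
  then show ?thesis
    by (simp add: total_mass_def Bochner_Integration.integral_diff[OF influx_integrable[OF t(1)] y_integrable[OF t(1)]])
qed

text \<open>After one crossing time \<open>1 / c\<close> every characteristic that carried the profile at time \<open>t0\<close> has left, so the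
profile and the outflux during that time are the same function up to an affine change of variable.\<close>

lemma profile_from_outflux:
  assumes t: "0 \<le> t0"
  shows "sq_norm t0 = (LINT s|lebesgue_on {t0..t0 + 1 / c}. (y s)\<^sup>2) / c"
    and "W t0 = (LINT s|lebesgue_on {t0..t0 + 1 / c}. y s)"
proof -
  let ?t1 = "t0 + 1 / c"
  let ?R = "\<lambda>t \<xi>. indicator {0<..<1} (\<xi> + c * t) * \<rho> t (\<xi> + c * t)"
  let ?I = "\<lambda>z a \<xi>. indicator {t0..?t1} ((a - \<xi>) / c) * (z ((a - \<xi>) / c) / c)"
  have le: "t0 \<le> ?t1" using c_pos by simp
  have key: "?R t0 \<xi> = ?I y 1 \<xi>"
    if id: "?R ?t1 \<xi> + ?I y 1 \<xi> = ?R t0 \<xi> + ?I influx 0 \<xi>" and ne: "\<xi> \<noteq> - c * t0" "\<xi> \<noteq> 1 - c * t0" for \<xi>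
  proof (cases "- c * t0 < \<xi> \<and> \<xi> < 1 - c * t0")
    case True
    have 1: "\<not> \<xi> + c * ?t1 < 1" using True c_pos by (simp add: algebra_simps)
    have 2: "\<not> t0 \<le> (0 - \<xi>) / c" using True c_pos by (simp add: field_simps)
    have "?R ?t1 \<xi> = 0" "?I influx 0 \<xi> = 0" using 1 2 by (auto simp: indicator_def)
    then show ?thesis using id by linarith
  next
    case False
    have 1: "\<not> (0 < \<xi> + c * t0 \<and> \<xi> + c * t0 < 1)" using False by auto
    have 2: "\<not> (t0 \<le> (1 - \<xi>) / c \<and> (1 - \<xi>) / c \<le> ?t1)"
    proof
      assume "t0 \<le> (1 - \<xi>) / c \<and> (1 - \<xi>) / c \<le> ?t1"
      then have "c * t0 \<le> c * ((1 - \<xi>) / c)" "c * ((1 - \<xi>) / c) \<le> c * ?t1"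
        using c_pos by (simp_all only: mult_le_cancel_left_pos)
      then have "c * t0 \<le> 1 - \<xi>" "1 - \<xi> \<le> c * t0 + 1"
        using c_pos by (simp_all add: distrib_left)
      then show False using False ne by simp
    qed
    show ?thesis using 1 2 by (auto simp: indicator_def)
  qed
  have "AE \<xi> in lebesgue. \<xi> \<noteq> - c * t0" "AE \<xi> in lebesgue. \<xi> \<noteq> 1 - c * t0"
    by (rule AE_I'[of "{- c * t0}"], auto)[1] (rule AE_I'[of "{1 - c * t0}"], auto)
  then have ae: "AE \<xi> in lebesgue. ?R t0 \<xi> = ?I y 1 \<xi>"
    using AE_trajectory_identity[OF t le] by eventually_elim (rule key)
  have yL: "y \<in> L2_space {t0..?t1}" by (rule y_L2[OF t])
  have mY: "(\<lambda>\<xi>. ?I y 1 \<xi>) \<in> borel_measurable lebesgue"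
    using integrable_along_characteristics[OF c_pos, of t0 ?t1 1 "\<lambda>s. y s / c"] y_integrable[OF t]
    by (intro borel_measurable_integrable) simp
  have mR: "(\<lambda>\<xi>. ?R t0 \<xi>) \<in> borel_measurable lebesgue"
    using integrable_moving_frame[of "c * t0" "\<rho> t0"] rho_integrable[OF t]
    by (intro borel_measurable_integrable) simp
  have "W t0 = (LINT \<xi>|lebesgue. ?R t0 \<xi>)"
    by (simp add: integral_moving_frame total_mass_def)
  also have "\<dots> = (LINT \<xi>|lebesgue. ?I y 1 \<xi>)"
    by (rule integral_cong_AE[OF mR mY ae])
  also have "\<dots> = (LINT s|lebesgue_on {t0..?t1}. y s)"
    using integral_along_characteristics[OF c_pos, of t0 ?t1 1 "\<lambda>s. y s / c"] c_pos by simp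
  finally show "W t0 = (LINT s|lebesgue_on {t0..?t1}. y s)" .
  have "sq_norm t0 = (LINT \<xi>|lebesgue. (?R t0 \<xi>)\<^sup>2)"
    using integral_moving_frame[of "c * t0" "\<lambda>x. (\<rho> t0 x)\<^sup>2"] by (simp add: sq_norm_def indicator_square)
  also have "\<dots> = (LINT \<xi>|lebesgue. (?I y 1 \<xi>)\<^sup>2)"
    by (rule integral_cong_AE) (use mR mY ae in \<open>auto simp del: power_mult_distrib power_divide elim!: eventually_mono\<close>)
  also have "\<dots> = (LINT s|lebesgue_on {t0..?t1}. (y s)\<^sup>2) / c"
    unfolding indicator_square using integral_along_characteristics[OF c_pos, of t0 ?t1 1 "\<lambda>s. (y s / c)\<^sup>2"] c_pos
    by (simp add: power_divide) (simp add: power2_eq_square)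
  finally show "sq_norm t0 = (LINT s|lebesgue_on {t0..?t1}. (y s)\<^sup>2) / c" .
qed

lemma initial_values:
  "W 0 = (LINT x|lebesgue_on {0<..<1}. \<rho>0 x)" "sq_norm 0 = (LINT x|lebesgue_on {0<..<1}. (\<rho>0 x)\<^sup>2)"
  unfolding total_mass_def sq_norm_def
  by (rule integral_cong_AE; use AE_initial rho_L2[of 0] rho0 in \<open>auto simp: L2_space_def elim!: eventually_mono\<close>)+

section \<open>The energy identity\<close>

text \<open>The outgoing trace plus \<open>d W\<close>.  The feedback makes the incoming trace plus \<open>d W\<close> equal to \<open>k q\<close>: for traces
shifted by \<open>d W\<close> it is plain multiplication by \<open>k\<close>.\<close>

definition q :: "real \<Rightarrow> real" where "q t = y t / c + d * W t"

definition energy :: "real \<Rightarrow> real" where "energy t = sq_norm t + d * (W t)\<^sup>2"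

lemma q_L2: "q \<in> L2_space {a..b}" if "0 \<le> a"
  using L2_space_linear[OF y_L2[OF that] continuous_imp_L2[OF continuous_on_W'[OF that]], of "1/c" d b]
  by (simp add: q_def[abs_def])

lemma q_integrable: "0 \<le> a \<Longrightarrow> integrable (lebesgue_on {a..b}) q"
  by (rule L2_space_integrable[OF q_L2]) auto

lemma y_eq: "y t = c * (q t - d * W t)" and influx_eq: "influx t = c * (k * q t - d * W t)"
  using c_pos by (simp_all add: q_def influx_def field_simps)

lemma W_eq: 
  assumes "0 \<le> t0" "t0 \<le> t1"
  shows "W t1 = W t0 + (LINT s|lebesgue_on {t0..t1}. - ((1 - k) * c) * q s)"
proof -
  have "influx s - y s = - ((1 - k) * c) * q s" for s
    by (simp add: y_eq influx_eq algebra_simps)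
  then show ?thesis using mass_balance[OF assms] by presburger
qed

text \<open>With \<open>y = c (q - d W)\<close> and influx \<open>c (k q - d W)\<close>, the norm balance has the density
\<open>- c (1 - k\<^sup>2) q\<^sup>2 + 2 c (1 - k) d q W\<close>.  The product rule applied to \<open>W \<sqdot> W\<close>, with
\<open>W' = - (1 - k) c q\<close>, shows that the last term is the density of \<open>- d W\<^sup>2\<close>.\<close>

lemma energy_identity:
  assumes t: "0 \<le> t0" "t0 \<le> t1"
  shows "energy t1 = energy t0 - c * (1 - k\<^sup>2) * (LINT s|lebesgue_on {t0..t1}. (q s)\<^sup>2)"
proof -
  let ?M = "lebesgue_on {t0..t1}"
  let ?g = "\<lambda>s. - ((1 - k) * c) * q s"
  have gi: "integrable ?M ?g" using q_integrable[OF t(1)] by simp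
  have q2: "integrable ?M (\<lambda>s. (q s)\<^sup>2)" by (rule L2_spaceD(2)[OF q_L2[OF t(1)]])
  have qW: "integrable ?M (\<lambda>s. W s * q s)"
    by (rule integrable_continuous_mult[OF continuous_on_W'[OF t(1)] q_integrable[OF t(1)]])
  have "W t1 * W t1 - W t0 * W t0 = (LINT s|?M. ?g s * W s + W s * ?g s)"
    by (rule product_rule_indefinite_integrals[OF t(2) gi gi]; rule W_eq[OF t(1)]; simp)
  also have "\<dots> = (LINT s|?M. - (2 * (1 - k) * c) * (W s * q s))"
    by (intro Bochner_Integration.integral_cong refl) (simp add: algebra_simps)
  also have "\<dots> = - (2 * (1 - k) * c) * (LINT s|?M. W s * q s)"
    by (rule integral_mult_right_zero)
  finally have WW: "(W t1)\<^sup>2 - (W t0)\<^sup>2 = - (2 * (1 - k) * c) * (LINT s|?M. W s * q s)"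
    by (simp add: power2_eq_square)
  have "c * (sq_norm t1 - sq_norm t0) = (LINT s|?M. (influx s)\<^sup>2) - (LINT s|?M. (y s)\<^sup>2)"
    using norm_balance[OF t] c_pos by (simp add: field_simps)
  also have "\<dots> = (LINT s|?M. (influx s)\<^sup>2 - (y s)\<^sup>2)"
    by (rule Bochner_Integration.integral_diff[symmetric]; rule L2_spaceD(2); rule influx_L2 y_L2; rule t)
  also have "\<dots> = (LINT s|?M. - c\<^sup>2 * (1 - k\<^sup>2) * (q s)\<^sup>2 + c\<^sup>2 * 2 * (1 - k) * d * (W s * q s))"
    by (intro Bochner_Integration.integral_cong refl) (simp add: y_eq influx_eq power2_eq_square algebra_simps)
  also have "\<dots> = - c\<^sup>2 * (1 - k\<^sup>2) * (LINT s|?M. (q s)\<^sup>2) + c\<^sup>2 * 2 * (1 - k) * d * (LINT s|?M. W s * q s)"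
    using q2 qW by (subst Bochner_Integration.integral_add) (simp_all only: integrable_mult_right integral_mult_right_zero)
  also have "\<dots> = c * (- c * (1 - k\<^sup>2) * (LINT s|?M. (q s)\<^sup>2) - d * ((W t1)\<^sup>2 - (W t0)\<^sup>2))"
    unfolding WW by (simp add: power2_eq_square algebra_simps)
  finally have "sq_norm t1 - sq_norm t0 = - c * (1 - k\<^sup>2) * (LINT s|?M. (q s)\<^sup>2) - d * ((W t1)\<^sup>2 - (W t0)\<^sup>2)"
    using c_pos by simp
  then show ?thesis by (simp add: energy_def algebra_simps)
qed

lemma W_square_le_sq_norm: "(W t)\<^sup>2 \<le> sq_norm t" if "t \<ge> 0"
  using L2_space_square_integral_le[OF rho_L2[OF that]] by (simp add: total_mass_def sq_norm_def)

lemma sq_norm_nonneg: "0 \<le> sq_norm t"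
  by (simp add: sq_norm_def)

lemma abs_energy_le: "\<bar>energy t\<bar> \<le> (1 + \<bar>d\<bar>) * sq_norm t" if "t \<ge> 0"
proof -
  have "\<bar>d * (W t)\<^sup>2\<bar> \<le> \<bar>d\<bar> * sq_norm t"
    using W_square_le_sq_norm[OF that] by (simp add: abs_mult mult_left_mono)
  then show ?thesis using sq_norm_nonneg[of t] by (simp add: energy_def algebra_simps)
qed

end

section \<open>Exponential decay and its obstructions\<close>

text \<open>With \<open>n = \<lfloor>c t\<rfloor>\<close> completed steps, monotonicity bounds \<open>e(t)\<close> by \<open>\<theta>\<^sup>n e(0)\<close>; the factor \<open>1 / \<theta>\<close> pays for the
incomplete step.\<close>

lemma geometric_decay_imp_exponential:
  fixes e :: "real \<Rightarrow> real"
  assumes c: "c > 0" and th: "0 < \<theta>" "\<theta> < 1"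
    and nonneg: "e 0 \<ge> 0"
    and mono: "\<And>s t. 0 \<le> s \<Longrightarrow> s \<le> t \<Longrightarrow> e t \<le> e s"
    and step: "\<And>t. 0 \<le> t \<Longrightarrow> e (t + 1 / c) \<le> \<theta> * e t"
    and t: "t \<ge> 0"
  shows "e t \<le> exp (c * ln \<theta> * t) / \<theta> * e 0"
proof -
  define n where "n = nat \<lfloor>c * t\<rfloor>"
  have n: "real n \<le> c * t" "c * t < real n + 1"
    using c t by (simp_all add: n_def)
  have it: "e (real m / c) \<le> \<theta> ^ m * e 0" for m
  proof (induction m)
    case (Suc m)
    have "e (real (Suc m) / c) = e (real m / c + 1 / c)" by (simp add: add_divide_distrib add.commute)
    also have "\<dots> \<le> \<theta> * e (real m / c)" using c by (intro step) simp
    also have "\<dots> \<le> \<theta> * (\<theta> ^ m * e 0)" using Suc th by (intro mult_left_mono) auto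
    finally show ?case by simp
  qed simp
  have "e t \<le> e (real n / c)"
    using n c by (intro mono) (auto simp: field_simps)
  also have "\<dots> \<le> \<theta> ^ n * e 0" by (rule it)
  also have "\<theta> ^ n = exp (real n * ln \<theta>)"
    using th by (simp add: exp_of_nat_mult)
  also have "exp (real n * ln \<theta>) * e 0 \<le> exp (c * ln \<theta> * t) / \<theta> * e 0"
  proof (rule mult_right_mono[OF _ nonneg])
    have "real n * ln \<theta> \<le> (c * t - 1) * ln \<theta>"
      using n th by (intro mult_right_mono_neg) auto
    then have "exp (real n * ln \<theta>) \<le> exp (c * ln \<theta> * t - ln \<theta>)"
      by (simp add: algebra_simps)
    then show "exp (real n * ln \<theta>) \<le> exp (c * ln \<theta> * t) / \<theta>"
      using th by (simp add: exp_diff)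
  qed
  finally show ?thesis .
qed

text \<open>For \<open>\<bar>k\<bar> < 1\<close> and \<open>d > -1\<close> the inner constant bounds \<open>\<bar>W\<bar>\<close> on a crossing time by the integral of \<open>\<bar>q\<bar>\<close> over it; the whole expression is the
resulting bound of the energy by the integral of \<open>q\<^sup>2\<close>.\<close>

definition observability_const :: "real \<Rightarrow> real \<Rightarrow> real \<Rightarrow> real" where
  "observability_const c k d =
     (let K = c * (1 + \<bar>d\<bar> * (1 - k)) / (1 + d) + (1 - k) * c
      in (1 + \<bar>d\<bar>) * (2 * c + 2 * d\<^sup>2 * K\<^sup>2 / c))"

lemma observability_const_pos: "0 < c \<Longrightarrow> 0 < observability_const c k d"
  unfolding observability_const_def Let_def
  by (intro mult_pos_pos add_pos_nonneg) auto

text \<open>The energy identity and observability give the factor \<open>1 - c (1 - k\<^sup>2) / K\<close>, with \<open>K\<close> the observability constant.  The maximum with \<open>1/2\<close> keeps the ratio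
positive, so that its logarithm can serve as a decay rate.\<close>

definition decay_ratio :: "real \<Rightarrow> real \<Rightarrow> real \<Rightarrow> real" where
  "decay_ratio c k d = max (1/2) (1 - c * (1 - k\<^sup>2) / observability_const c k d)"

lemma decay_ratio_bounds:
  assumes "c > 0" "\<bar>k\<bar> < 1"
  shows "0 < decay_ratio c k d" "decay_ratio c k d < 1"
proof -
  have "k\<^sup>2 < 1" using assms(2) by (simp add: abs_square_less_1)
  then have "0 < c * (1 - k\<^sup>2) / observability_const c k d"
    using assms(1) observability_const_pos by simp
  then show "0 < decay_ratio c k d" "decay_ratio c k d < 1"
    unfolding decay_ratio_def by auto
qed

context weak_transport begin

text \<open>By \<open>W' = - (1 - k) c q\<close> the mass varies on the crossing time by at most \<open>(1 - k) c \<integral> \<bar>q\<bar>\<close>.  On the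
other hand \<open>W(t\<^sub>0)\<close> is the total outflux \<open>\<integral> c (q - d W)\<close>.  Replacing \<open>W\<close> by \<open>W(t\<^sub>0)\<close> under this integral shows that \<open>(1 + d) W(t\<^sub>0)\<close> is
controlled by \<open>\<integral> \<bar>q\<bar>\<close>, and then so is \<open>W\<close>, because \<open>d > -1\<close>.  The squared norm is the integral of \<open>c (q - d W)\<^sup>2\<close>.\<close>

lemma observability:
  assumes k: "\<bar>k\<bar> < 1" and d: "d > -1" and t0: "t0 \<ge> 0"
  shows "energy t0 \<le> observability_const c k d * (LINT s|lebesgue_on {t0..t0 + 1 / c}. (q s)\<^sup>2)"
proof -
  define t1 where "t1 = t0 + 1 / c"
  let ?M = "lebesgue_on {t0..t1}"
  define Q where "Q = (LINT s|?M. \<bar>q s\<bar>)"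
  define I where "I = (LINT s|?M. (q s)\<^sup>2)"
  define K where "K = c * (1 + \<bar>d\<bar> * (1 - k)) / (1 + d) + (1 - k) * c"
  have le: "t0 \<le> t1" and len: "t1 - t0 = 1 / c" using c_pos by (simp_all add: t1_def)
  have kc: "0 < (1 - k) * c" using k c_pos by simp
  have qL: "q \<in> L2_space {t0..t1}" and qi: "integrable ?M q" and q2: "integrable ?M (\<lambda>s. (q s)\<^sup>2)"
    using q_L2[OF t0] q_integrable[OF t0] L2_spaceD(2)[OF q_L2[OF t0]] by auto
  have QI: "Q\<^sup>2 \<le> I / c"
  proof -
    have "(\<lambda>s. \<bar>q s\<bar>) \<in> L2_space {t0..t1}"
      using qL by (auto simp: L2_space_def)
    from L2_space_square_integral_le[OF this] show ?thesis
      using le len by (simp add: Q_def I_def)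
  qed
  have Wvar: "\<bar>W s - W t0\<bar> \<le> (1 - k) * c * Q" if s: "s \<in> {t0..t1}" for s
  proof -
    have "\<bar>W s - W t0\<bar> = (1 - k) * c * \<bar>LINT r|lebesgue_on {t0..s}. q r\<bar>"
    proof -
      have "W s - W t0 = - ((1 - k) * c) * (LINT r|lebesgue_on {t0..s}. q r)"
        using W_eq[OF t0, of s] s by (simp only: integral_mult_right_zero atLeastAtMost_iff)
      then show ?thesis using kc k c_pos by (simp add: abs_mult)
    qed
    also have "\<dots> \<le> (1 - k) * c * (LINT r|lebesgue_on {t0..s}. \<bar>q r\<bar>)"
      using kc integral_abs_bound[of "lebesgue_on {t0..s}" q] by (intro mult_left_mono) auto
    also have "(LINT r|lebesgue_on {t0..s}. \<bar>q r\<bar>) \<le> Q"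
    proof -
      have "Q = (LINT r|lebesgue_on {t0..s}. \<bar>q r\<bar>) + (LINT r|lebesgue_on {s..t1}. \<bar>q r\<bar>)"
        unfolding Q_def using s qi by (intro integral_combine) auto
      moreover have "0 \<le> (LINT r|lebesgue_on {s..t1}. \<bar>q r\<bar>)" by simp
      ultimately show ?thesis by simp
    qed
    then have "(1 - k) * c * (LINT r|lebesgue_on {t0..s}. \<bar>q r\<bar>) \<le> (1 - k) * c * Q"
      using kc by (intro mult_left_mono) auto
    finally show ?thesis .
  qed
  have cW: "continuous_on {t0..t1} W" by (rule continuous_on_W'[OF t0])
  have Wi: "integrable ?M W" by (rule integrable_continuous_lebesgue_on[OF cW])
  have W0: "\<bar>W t0\<bar> \<le> c * (1 + \<bar>d\<bar> * (1 - k)) / (1 + d) * Q"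
  proof -
    \<comment> \<open>replace \<open>W\<close> by its value at \<open>t0\<close> in \<open>W t0 = \<integral> c (q - d W)\<close> over an interval of length \<open>1 / c\<close>\<close>
    have "(1 + d) * W t0 = c * (LINT s|?M. q s) - c * d * (LINT s|?M. W s - W t0)"
    proof -
      have "W t0 = (LINT s|?M. c * q s - c * d * W s)"
        unfolding profile_from_outflux(2)[OF t0] t1_def
        by (intro Bochner_Integration.integral_cong refl) (simp add: y_eq algebra_simps)
      also have "\<dots> = c * (LINT s|?M. q s) - c * d * (LINT s|?M. W s)"
        using qi Wi by simp
      finally have "W t0 = c * (LINT s|?M. q s) - c * d * (LINT s|?M. W s)" .
      moreover have "(LINT s|?M. W s - W t0) = (LINT s|?M. W s) - W t0 / c"
        using Wi le len by (simp add: measure_restrict_space)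
      then have "c * d * (LINT s|?M. W s - W t0) = c * d * (LINT s|?M. W s) - d * W t0"
        using c_pos by (simp add: right_diff_distrib)
      ultimately show ?thesis unfolding distrib_right mult_1_left by linarith
    qed
    also have "\<bar>\<dots>\<bar> \<le> c * Q + c * \<bar>d\<bar> * ((1 - k) * Q)"
    proof -
      have "\<bar>LINT s|?M. q s\<bar> \<le> Q"
        unfolding Q_def by (rule integral_abs_bound)
      then have 1: "\<bar>c * (LINT s|?M. q s)\<bar> \<le> c * Q"
        using c_pos by (simp add: abs_mult)
      have "\<bar>LINT s|?M. W s - W t0\<bar> \<le> (LINT s|?M. \<bar>W s - W t0\<bar>)"
        by (rule integral_abs_bound)
      also have "\<dots> \<le> (LINT s|?M. (1 - k) * c * Q)"
        using Wi Wvar by (intro integral_mono) auto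
      also have "\<dots> = (1 - k) * Q"
        using le len c_pos by (simp add: measure_restrict_space)
      finally have 2: "\<bar>c * d * (LINT s|?M. W s - W t0)\<bar> \<le> c * \<bar>d\<bar> * ((1 - k) * Q)"
        using c_pos by (simp add: abs_mult mult_left_mono)
      show ?thesis using 1 2 by linarith
    qed
    finally have "(1 + d) * \<bar>W t0\<bar> \<le> c * (1 + \<bar>d\<bar> * (1 - k)) * Q"
      using d by (simp add: abs_mult algebra_simps)
    then show ?thesis using d by (simp add: field_simps)
  qed
  have WK: "\<bar>W s\<bar> \<le> K * Q" if "s \<in> {t0..t1}" for s
    using W0 Wvar[OF that] unfolding K_def distrib_right by linarith
  have WK2: "(W s)\<^sup>2 \<le> K\<^sup>2 * (I / c)" if "s \<in> {t0..t1}" for s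
  proof -
    have "(W s)\<^sup>2 \<le> (K * Q)\<^sup>2"
      using power_mono[OF WK[OF that] abs_ge_zero, of 2] by simp
    also have "\<dots> \<le> K\<^sup>2 * (I / c)"
      unfolding power_mult_distrib using QI by (intro mult_left_mono) auto
    finally show ?thesis .
  qed
  have "sq_norm t0 = (LINT s|?M. c * (q s - d * W s)\<^sup>2)"
    unfolding profile_from_outflux(1)[OF t0] t1_def
    using c_pos by (simp add: y_eq power_mult_distrib) (simp add: power2_eq_square)
  also have "\<dots> \<le> (LINT s|?M. c * (2 * (q s)\<^sup>2 + 2 * d\<^sup>2 * (K\<^sup>2 * (I / c))))"
  proof (rule integral_mono)
    have "(\<lambda>s. q s - d * W s) \<in> L2_space {t0..t1}"
      using L2_space_linear[OF qL continuous_imp_L2[OF cW], of 1 "- d"] by simp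
    then show "integrable ?M (\<lambda>s. c * (q s - d * W s)\<^sup>2)"
      using L2_spaceD(2) by auto
    show "integrable ?M (\<lambda>s. c * (2 * (q s)\<^sup>2 + 2 * d\<^sup>2 * (K\<^sup>2 * (I / c))))"
      using q2 by auto
    fix s assume "s \<in> space ?M"
    then have s: "s \<in> {t0..t1}" by simp
    have "(q s - d * W s)\<^sup>2 \<le> 2 * (q s)\<^sup>2 + 2 * d\<^sup>2 * (W s)\<^sup>2"
      using zero_le_power2[of "q s + d * W s"] by (simp add: power2_eq_square algebra_simps)
    also have "\<dots> \<le> 2 * (q s)\<^sup>2 + 2 * d\<^sup>2 * (K\<^sup>2 * (I / c))"
      using WK2[OF s] by (intro add_left_mono mult_left_mono) auto
    finally show "c * (q s - d * W s)\<^sup>2 \<le> c * (2 * (q s)\<^sup>2 + 2 * d\<^sup>2 * (K\<^sup>2 * (I / c)))"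
      using c_pos by (intro mult_left_mono) auto
  qed
  also have "\<dots> = (2 * c + 2 * d\<^sup>2 * K\<^sup>2 / c) * I"
    using q2 le len c_pos by (simp add: I_def measure_restrict_space) (simp add: field_simps)
  finally have VI: "sq_norm t0 \<le> (2 * c + 2 * d\<^sup>2 * K\<^sup>2 / c) * I" .
  have "energy t0 \<le> (1 + \<bar>d\<bar>) * sq_norm t0"
    using abs_energy_le[OF t0] by linarith
  also have "\<dots> \<le> (1 + \<bar>d\<bar>) * ((2 * c + 2 * d\<^sup>2 * K\<^sup>2 / c) * I)"
    using VI by (intro mult_left_mono) auto
  also have "\<dots> = observability_const c k d * I"
    by (simp add: observability_const_def K_def Let_def)
  finally show ?thesis by (simp add: I_def t1_def)
qed

lemma energy_coercive:
  assumes "d > -1" "t \<ge> 0"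
  shows "min 1 (1 + d) * sq_norm t \<le> energy t"
proof (cases "d \<ge> 0")
  case True
  then show ?thesis by (simp add: energy_def)
next
  case False
  then have "d * sq_norm t \<le> d * (W t)\<^sup>2"
    using W_square_le_sq_norm[OF assms(2)] by (intro mult_left_mono_neg) auto
  with False show ?thesis by (simp add: energy_def algebra_simps)
qed

text \<open>The energy drops by the decay ratio during each crossing time and never grows in between; it is
comparable with the squared norm on both ends, and the square root halves the rate.\<close>

lemma exponential_decay:
  assumes k: "\<bar>k\<bar> < 1" and d: "d > -1" and t: "t \<ge> 0"
  shows "L2_norm {0<..<1} (\<rho> t)
     \<le> sqrt ((1 + \<bar>d\<bar>) / (min 1 (1 + d) * decay_ratio c k d)) * exp (c * ln (decay_ratio c k d) / 2 * t) * L2_norm {0<..<1} \<rho>0"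
proof -
  define \<theta> where "\<theta> = decay_ratio c k d"
  define m where "m = min 1 (1 + d)"
  note th = decay_ratio_bounds[OF c_pos k, of d, folded \<theta>_def]
  have m: "m > 0" using d by (simp add: m_def)
  have k2: "k\<^sup>2 < 1" using k by (simp add: abs_square_less_1)
  have Q0: "0 \<le> (LINT s|lebesgue_on {a..b}. (q s)\<^sup>2)" for a b by simp
  have e0: "0 \<le> energy s" if "s \<ge> 0" for s
  proof -
    have "0 \<le> m * sq_norm s" using m sq_norm_nonneg by simp
    then show ?thesis using energy_coercive[OF d that] by (simp add: m_def)
  qed
  have "energy t \<le> exp (c * ln \<theta> * t) / \<theta> * energy 0"
  proof (rule geometric_decay_imp_exponential[where e = energy, OF c_pos th e0[OF order_refl] _ _ t])
    fix s t :: real assume s: "0 \<le> s" "s \<le> t"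
    show "energy t \<le> energy s"
      using energy_identity[OF s] Q0 k2 c_pos by simp
  next
    fix s :: real assume s: "0 \<le> s"
    let ?I = "LINT r|lebesgue_on {s..s + 1 / c}. (q r)\<^sup>2"
    let ?\<kappa> = "observability_const c k d"
    have K: "?\<kappa> > 0" by (rule observability_const_pos[OF c_pos])
    have "energy s / ?\<kappa> \<le> ?I"
      using observability[OF k d s] K by (simp add: field_simps)
    then have "c * (1 - k\<^sup>2) * (energy s / ?\<kappa>) \<le> c * (1 - k\<^sup>2) * ?I"
      using c_pos k2 by (intro mult_left_mono) auto
    then have "energy (s + 1 / c) \<le> (1 - c * (1 - k\<^sup>2) / ?\<kappa>) * energy s"
      using energy_identity[OF s, of "s + 1 / c"] c_pos by (simp add: algebra_simps)
    also have "\<dots> \<le> \<theta> * energy s"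
      using e0[OF s] by (intro mult_right_mono) (auto simp: \<theta>_def decay_ratio_def)
    finally show "energy (s + 1 / c) \<le> \<theta> * energy s" .
  qed
  also have "\<dots> \<le> exp (c * ln \<theta> * t) / \<theta> * ((1 + \<bar>d\<bar>) * sq_norm 0)"
    using abs_energy_le[of 0] th by (intro mult_left_mono) auto
  finally have "m * sq_norm t \<le> exp (c * ln \<theta> * t) / \<theta> * ((1 + \<bar>d\<bar>) * sq_norm 0)"
    using energy_coercive[OF d t] by (simp add: m_def)
  then have "sq_norm t \<le> (1 + \<bar>d\<bar>) / (m * \<theta>) * exp (c * ln \<theta> * t) * sq_norm 0"
    using m th by (simp add: field_simps)
  then have "sqrt (sq_norm t) \<le> sqrt ((1 + \<bar>d\<bar>) / (m * \<theta>) * exp (c * ln \<theta> * t) * sq_norm 0)"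
    by (rule real_sqrt_le_mono)
  also have "\<dots> = sqrt ((1 + \<bar>d\<bar>) / (m * \<theta>)) * exp (c * ln \<theta> * t / 2) * sqrt (sq_norm 0)"
  proof -
    have "sqrt (exp z) = exp (z / 2)" for z :: real
      by (rule real_sqrt_unique) (simp_all add: power2_eq_square flip: exp_add)
    then show ?thesis by (simp only: real_sqrt_mult)
  qed
  finally show ?thesis
    unfolding \<theta>_def m_def by (simp add: L2_norm_def sq_norm_def[symmetric] initial_values(2)[symmetric])
qed

text \<open>If the solution decays then so does its energy, whose monotonicity fixes the sign of the initial energy.  In the
borderline case \<open>d = -1\<close> the energy is nonnegative by the Cauchy-Schwarz inequality; starting at \<open>0\<close> and being
nonincreasing it stays \<open>0\<close>, so \<open>q\<close> vanishes and the mass is conserved.\<close>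

lemma decay_constraints:
  assumes lim: "(sq_norm \<longlongrightarrow> 0) at_top"
  shows energy_nonneg_if_decay: "k\<^sup>2 \<le> 1 \<Longrightarrow> 0 \<le> energy 0"
    and energy_nonpos_if_decay: "1 \<le> k\<^sup>2 \<Longrightarrow> energy 0 \<le> 0"
    and mass_zero_if_decay: "k\<^sup>2 < 1 \<Longrightarrow> d = -1 \<Longrightarrow> energy 0 = 0 \<Longrightarrow> W 0 = 0"
proof -
  have le: "\<forall>\<^sub>F t in at_top. (0::real) \<le> t" by (rule eventually_ge_at_top)
  have E: "(energy \<longlongrightarrow> 0) at_top"
  proof (rule Lim_null_comparison)
    show "\<forall>\<^sub>F t in at_top. norm (energy t) \<le> (1 + \<bar>d\<bar>) * sq_norm t"
      using le by eventually_elim (use abs_energy_le in auto)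
    show "((\<lambda>t. (1 + \<bar>d\<bar>) * sq_norm t) \<longlongrightarrow> 0) at_top"
      using tendsto_mult_right_zero[OF lim] by simp
  qed
  have Q0: "0 \<le> (LINT s|lebesgue_on {a..b}. (q s)\<^sup>2)" for a b by simp
  show "0 \<le> energy 0" if "k\<^sup>2 \<le> 1"
  proof (rule tendsto_upperbound[OF E])
    show "\<forall>\<^sub>F t in at_top. energy t \<le> energy 0"
      using le
    proof eventually_elim
      fix t :: real assume t: "0 \<le> t"
      have "0 \<le> c * (1 - k\<^sup>2) * (LINT s|lebesgue_on {0..t}. (q s)\<^sup>2)"
        using that c_pos by (intro mult_nonneg_nonneg Q0) auto
      then show "energy t \<le> energy 0"
        using energy_identity[OF order_refl t] by simp
    qed
  qed simp
  show "energy 0 \<le> 0" if "1 \<le> k\<^sup>2"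
  proof (rule tendsto_lowerbound[OF E])
    show "\<forall>\<^sub>F t in at_top. energy 0 \<le> energy t"
      using le
    proof eventually_elim
      fix t :: real assume t: "0 \<le> t"
      have "c * (1 - k\<^sup>2) * (LINT s|lebesgue_on {0..t}. (q s)\<^sup>2) \<le> 0"
        using that c_pos by (intro mult_nonpos_nonneg Q0 mult_nonneg_nonpos) auto
      then show "energy 0 \<le> energy t"
        using energy_identity[OF order_refl t] by simp
    qed
  qed simp
  show "W 0 = 0" if k: "k\<^sup>2 < 1" and d: "d = -1" and e0: "energy 0 = 0"
  proof -
    have W: "W t = W 0" if t: "t \<ge> 0" for t
    proof -
      let ?M = "lebesgue_on {0..t}"
      have "0 \<le> energy t"
        using W_square_le_sq_norm[OF t] by (subst energy_def) (simp add: d)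
      then have "c * (1 - k\<^sup>2) * (LINT s|?M. (q s)\<^sup>2) \<le> 0"
        using energy_identity[OF order_refl t] e0 by simp
      moreover have "0 < c * (1 - k\<^sup>2)" using c_pos k by simp
      ultimately have "(LINT s|?M. (q s)\<^sup>2) \<le> 0"
        by (metis mult_le_0_iff not_less)
      then have "(LINT s|?M. (q s)\<^sup>2) = 0" using Q0[of 0 t] by simp
      then have "(LINT s|?M. q s)\<^sup>2 \<le> 0"
        using L2_space_square_integral_le[OF q_L2[OF order_refl], of t] by simp
      then have "(LINT s|?M. q s) = 0" by simp
      then show ?thesis
        using W_eq[OF order_refl t] by (simp add: integral_mult_right_zero)
    qed
    have "((\<lambda>t::real. (W 0)\<^sup>2) \<longlongrightarrow> 0) at_top"
    proof (rule tendsto_sandwich[OF _ _ tendsto_const lim])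
      show "\<forall>\<^sub>F t in at_top. (W 0)\<^sup>2 \<le> sq_norm t"
        using le by eventually_elim (use W_square_le_sq_norm W in metis)
    qed simp
    from tendsto_unique[OF _ tendsto_const this] show ?thesis by simp
  qed
qed

end

section \<open>Continuity of translations\<close>

definition L1_translation_continuous :: "(real \<Rightarrow> real) \<Rightarrow> bool" where
  "L1_translation_continuous f \<longleftrightarrow>
     (\<forall>h. h \<longlonglongrightarrow> 0 \<longrightarrow> (\<lambda>n. LINT x|lebesgue. \<bar>f (x + h n) - f x\<bar>) \<longlonglongrightarrow> 0)"

lemma lebesgue_integral_shift:
  fixes f :: "real \<Rightarrow> real"
  shows "(LINT x|lebesgue. f (x + h)) = (LINT x|lebesgue. f x)"
    and "integrable lebesgue (\<lambda>x. f (x + h)) \<longleftrightarrow> integrable lebesgue f"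
  using lebesgue_integral_real_affine[of 1 f h] lebesgue_integrable_real_affine_iff[of 1 f h]
  by (simp_all add: add.commute)

text \<open>The translation error of \<open>f\<close> exceeds that of \<open>g\<close> by at most twice the distance of \<open>f\<close> and \<open>g\<close>, since translations are
isometries.\<close>

lemma L1_translation_continuous_approx:
  assumes f: "integrable lebesgue f"
    and approx: "\<And>e. e > 0 \<Longrightarrow> \<exists>g. integrable lebesgue g \<and> L1_translation_continuous g \<and> (LINT x|lebesgue. \<bar>f x - g x\<bar>) < e"
  shows "L1_translation_continuous f"
  unfolding L1_translation_continuous_def
proof (intro allI impI LIMSEQ_I)
  fix h :: "nat \<Rightarrow> real" and e :: real assume h: "h \<longlonglongrightarrow> 0" and e: "0 < e"
  obtain g where g: "integrable lebesgue g" "L1_translation_continuous g" "(LINT x|lebesgue. \<bar>f x - g x\<bar>) < e / 3"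
    using approx[of "e / 3"] e by auto
  obtain N where N: "\<And>n. n \<ge> N \<Longrightarrow> \<bar>LINT x|lebesgue. \<bar>g (x + h n) - g x\<bar>\<bar> < e / 3"
    using g(2) h e LIMSEQ_D[of _ 0 "e/3"] unfolding L1_translation_continuous_def by fastforce
  show "\<exists>N. \<forall>n\<ge>N. norm ((LINT x|lebesgue. \<bar>f (x + h n) - f x\<bar>) - 0) < e"
  proof (intro exI allI impI)
    fix n assume n: "n \<ge> N"
    have fs: "integrable lebesgue (\<lambda>x. f (x + h n))" and gs: "integrable lebesgue (\<lambda>x. g (x + h n))"
      using f g(1) by (simp_all add: lebesgue_integral_shift)
    have i1: "integrable lebesgue (\<lambda>x. \<bar>f (x + h n) - g (x + h n)\<bar>)"
      and i2: "integrable lebesgue (\<lambda>x. \<bar>f x - g x\<bar>)"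
      and i3: "integrable lebesgue (\<lambda>x. \<bar>g (x + h n) - g x\<bar>)"
      using f g(1) fs gs by auto
    have "(LINT x|lebesgue. \<bar>f (x + h n) - f x\<bar>)
        \<le> (LINT x|lebesgue. \<bar>f (x + h n) - g (x + h n)\<bar> + \<bar>f x - g x\<bar> + \<bar>g (x + h n) - g x\<bar>)"
      using f fs i1 i2 i3 by (intro integral_mono) auto
    also have "\<dots> = (LINT x|lebesgue. \<bar>f (x + h n) - g (x + h n)\<bar>) + (LINT x|lebesgue. \<bar>f x - g x\<bar>)
        + (LINT x|lebesgue. \<bar>g (x + h n) - g x\<bar>)"
      using i1 i2 i3 by simp
    also have "(LINT x|lebesgue. \<bar>f (x + h n) - g (x + h n)\<bar>) = (LINT x|lebesgue. \<bar>f x - g x\<bar>)"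
      using lebesgue_integral_shift(1)[of "\<lambda>x. \<bar>f x - g x\<bar>" "h n"] .
    finally have "(LINT x|lebesgue. \<bar>f (x + h n) - f x\<bar>) < e"
      using g(3) N[OF n] by linarith
    then show "norm ((LINT x|lebesgue. \<bar>f (x + h n) - f x\<bar>) - 0) < e"
      by simp
  qed
qed

text \<open>Openness makes the product of the indicators of \<open>U\<close> and of its translate converge pointwise to the indicator of
\<open>U\<close>.  The absolute difference of two indicators is their sum minus twice their product, and all three have
convergent integrals.\<close>

lemma L1_translation_continuous_open_indicator:
  assumes U: "open U" "U \<in> lmeasurable"
  shows "L1_translation_continuous (indicator U)"
  unfolding L1_translation_continuous_def
proof (intro allI impI)
  fix h :: "nat \<Rightarrow> real" assume h: "h \<longlonglongrightarrow> 0"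
  have iU: "integrable lebesgue (indicator U :: real \<Rightarrow> real)"
    using fmeasurableD[OF U(2)] fmeasurableD2[OF U(2)] by (intro integrable_real_indicator) (simp_all add: less_top)
  have sU: "integrable lebesgue (\<lambda>x. indicator U (x + h n) :: real)" for n
    using iU lebesgue_integral_shift(2)[of "indicator U" "h n"] by simp
  have m: "(\<lambda>x. indicator U (x + h n) * indicator U x :: real) \<in> borel_measurable lebesgue" for n
    using iU sU by (intro borel_measurable_times borel_measurable_integrable)
  have prod: "integrable lebesgue (\<lambda>x. indicator U (x + h n) * indicator U x :: real)" for n
    by (rule Bochner_Integration.integrable_bound[OF iU m]) (auto simp: indicator_def)
  have "(\<lambda>n. LINT x|lebesgue. indicator U (x + h n) * indicator U x :: real) \<longlonglongrightarrow> (LINT x|lebesgue. indicator U x)"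
  proof (rule integral_dominated_convergence[where w = "indicator U"])
    show "AE x in lebesgue. (\<lambda>n. indicator U (x + h n) * indicator U x :: real) \<longlonglongrightarrow> indicator U x"
    proof (rule AE_I2)
      fix x :: real
      show "(\<lambda>n. indicator U (x + h n) * indicator U x :: real) \<longlonglongrightarrow> indicator U x"
      proof (cases "x \<in> U")
        case True
        have "(\<lambda>n. x + h n) \<longlonglongrightarrow> x" using tendsto_add[OF tendsto_const h, of x] by simp
        then have "\<forall>\<^sub>F n in sequentially. x + h n \<in> U"
          using True U(1) topological_tendstoD by blast
        then have "\<forall>\<^sub>F n in sequentially. indicator U (x + h n) * indicator U x = (indicator U x :: real)"
          by eventually_elim (use True in simp)
        then show ?thesis by (rule tendsto_eventually)
      qed simp
    qed
    show "AE x in lebesgue. norm (indicator U (x + h n) * indicator U x :: real) \<le> indicator U x" for n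
      by (auto simp: indicator_def)
  qed (use iU m in auto)
  then have "(\<lambda>n. 2 * (LINT x|lebesgue. indicator U x) - 2 * (LINT x|lebesgue. indicator U (x + h n) * indicator U x) :: real)
      \<longlonglongrightarrow> 2 * (LINT x|lebesgue. indicator U x) - 2 * (LINT x|lebesgue. indicator U x)"
    by (intro tendsto_intros)
  moreover have "(LINT x|lebesgue. \<bar>indicator U (x + h n) - indicator U x :: real\<bar>)
      = 2 * (LINT x|lebesgue. indicator U x) - 2 * (LINT x|lebesgue. indicator U (x + h n) * indicator U x)" for n
  proof -
    have "(LINT x|lebesgue. \<bar>indicator U (x + h n) - indicator U x :: real\<bar>)
       = (LINT x|lebesgue. indicator U (x + h n) + indicator U x - 2 * (indicator U (x + h n) * indicator U x) :: real)"
      by (intro Bochner_Integration.integral_cong) (auto simp: indicator_def)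
    also have "\<dots> = (LINT x|lebesgue. indicator U (x + h n)) + (LINT x|lebesgue. indicator U x)
        - 2 * (LINT x|lebesgue. indicator U (x + h n) * indicator U x)"
      using iU sU prod by (subst Bochner_Integration.integral_diff) auto
    finally show ?thesis
      using lebesgue_integral_shift(1)[of "indicator U" "h n"] by simp
  qed
  ultimately show "(\<lambda>n. LINT x|lebesgue. \<bar>indicator U (x + h n) - indicator U x :: real\<bar>) \<longlonglongrightarrow> 0"
    by simp
qed

lemma L1_translation_continuous_add:
  assumes "integrable lebesgue f" "L1_translation_continuous f" "integrable lebesgue g" "L1_translation_continuous g"
  shows "L1_translation_continuous (\<lambda>x. f x + g x)"
  unfolding L1_translation_continuous_def
proof (intro allI impI)
  fix h :: "nat \<Rightarrow> real" assume h: "h \<longlonglongrightarrow> 0"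
  have i: "integrable lebesgue (\<lambda>x. \<bar>f (x + h n) - f x\<bar>)" "integrable lebesgue (\<lambda>x. \<bar>g (x + h n) - g x\<bar>)"
    "integrable lebesgue (\<lambda>x. \<bar>f (x + h n) + g (x + h n) - (f x + g x)\<bar>)" for n
    using assms lebesgue_integral_shift(2)[of f "h n"] lebesgue_integral_shift(2)[of g "h n"] by auto
  show "(\<lambda>n. LINT x|lebesgue. \<bar>f (x + h n) + g (x + h n) - (f x + g x)\<bar>) \<longlonglongrightarrow> 0"
  proof (rule Lim_null_comparison[OF always_eventually])
    show "\<forall>n. norm (LINT x|lebesgue. \<bar>f (x + h n) + g (x + h n) - (f x + g x)\<bar>)
      \<le> (LINT x|lebesgue. \<bar>f (x + h n) - f x\<bar>) + (LINT x|lebesgue. \<bar>g (x + h n) - g x\<bar>)"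
    proof
      fix n
      have "(LINT x|lebesgue. \<bar>f (x + h n) + g (x + h n) - (f x + g x)\<bar>)
          \<le> (LINT x|lebesgue. \<bar>f (x + h n) - f x\<bar> + \<bar>g (x + h n) - g x\<bar>)"
        using i[of n] by (intro integral_mono) auto
      then show "norm (LINT x|lebesgue. \<bar>f (x + h n) + g (x + h n) - (f x + g x)\<bar>)
      \<le> (LINT x|lebesgue. \<bar>f (x + h n) - f x\<bar>) + (LINT x|lebesgue. \<bar>g (x + h n) - g x\<bar>)"
        using i[of n] by simp
    qed
    show "(\<lambda>n. (LINT x|lebesgue. \<bar>f (x + h n) - f x\<bar>) + (LINT x|lebesgue. \<bar>g (x + h n) - g x\<bar>)) \<longlonglongrightarrow> 0"
      using assms(2,4) h tendsto_add[of _ 0 sequentially _ 0] unfolding L1_translation_continuous_def by fastforce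
  qed
qed

lemma L1_translation_continuous_scale:
  assumes "L1_translation_continuous f"
  shows "L1_translation_continuous (\<lambda>x. f x * a)"
  unfolding L1_translation_continuous_def
proof (intro allI impI)
  fix h :: "nat \<Rightarrow> real" assume h: "h \<longlonglongrightarrow> 0"
  have "\<bar>f (x + h n) * a - f x * a\<bar> = \<bar>a\<bar> * \<bar>f (x + h n) - f x\<bar>" for x n
    by (metis abs_mult left_diff_distrib mult.commute)
  then show "(\<lambda>n. LINT x|lebesgue. \<bar>f (x + h n) * a - f x * a\<bar>) \<longlonglongrightarrow> 0"
    using tendsto_mult_right_zero[of _ sequentially "\<bar>a\<bar>"] assms h
    by (simp add: L1_translation_continuous_def)
qed

text \<open>Sets of finite measure are approximated from outside by open sets; sums and limits are handled by the closure
properties above.\<close>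

lemma integrable_imp_L1_translation_continuous:
  fixes f :: "real \<Rightarrow> real"
  assumes "integrable lebesgue f"
  shows "L1_translation_continuous f"
  using assms
proof (induction rule: integrable_induct)
  case (base A a)
  have A: "A \<in> lmeasurable" using base by (simp add: fmeasurable_def)
  have iA: "integrable lebesgue (indicator A :: real \<Rightarrow> real)"
    using base by (intro integrable_real_indicator)
  have "L1_translation_continuous (indicator A)"
  proof (rule L1_translation_continuous_approx[OF iA])
    fix e :: real assume e: "e > 0"
    obtain U where U: "open U" "A \<subseteq> U" "U - A \<in> lmeasurable" "emeasure lebesgue (U - A) < ennreal e"
      using sets_lebesgue_outer_open[OF base(1) e] .
    have Um: "U \<in> lmeasurable"
      using fmeasurable.Un[OF U(3) A] U(2) by (simp add: Un_absorb2)
    have "(LINT x|lebesgue. \<bar>indicator A x - indicator U x\<bar> :: real) = (LINT x|lebesgue. indicator (U - A) x)"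
      using U(2) by (intro Bochner_Integration.integral_cong) (auto simp: indicator_def)
    also have "\<dots> = measure lebesgue (U - A)" by simp
    also have "\<dots> < e"
      using U(3,4) by (simp add: emeasure_eq_measure2 ennreal_less_iff)
    finally have "(LINT x|lebesgue. \<bar>indicator A x - indicator U x\<bar> :: real) < e" .
    moreover have "integrable lebesgue (indicator U :: real \<Rightarrow> real)"
      using fmeasurableD[OF Um] fmeasurableD2[OF Um] by (intro integrable_real_indicator) (simp_all add: less_top)
    ultimately show "\<exists>g. integrable lebesgue g \<and> L1_translation_continuous g \<and> (LINT x|lebesgue. \<bar>indicator A x - g x\<bar>) < e"
      using L1_translation_continuous_open_indicator[OF U(1) Um] by blast
  qed
  then show ?case using L1_translation_continuous_scale[of "indicator A" a] by simp
next
  case (add f g)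
  then show ?case by (intro L1_translation_continuous_add)
next
  case (lim f s)
  show ?case
  proof (rule L1_translation_continuous_approx[OF lim.hyps(4)])
    fix e :: real assume e: "e > 0"
    have "(\<lambda>i. LINT x|lebesgue. \<bar>f x - s i x\<bar>) \<longlonglongrightarrow> (LINT x|(lebesgue :: real measure). 0 :: real)"
    proof (rule integral_dominated_convergence[where w = "\<lambda>x. 3 * \<bar>f x\<bar>"])
      show "AE x in lebesgue. (\<lambda>i. \<bar>f x - s i x\<bar>) \<longlonglongrightarrow> 0"
      proof (rule AE_I2)
        fix x :: real assume "x \<in> space lebesgue"
        from tendsto_rabs[OF tendsto_diff[OF tendsto_const lim.hyps(2)[OF this]], of "f x"]
        show "(\<lambda>i. \<bar>f x - s i x\<bar>) \<longlonglongrightarrow> 0" by simp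
      qed
      show "AE x in lebesgue. norm \<bar>f x - s i x\<bar> \<le> 3 * \<bar>f x\<bar>" for i
      proof (rule AE_I2)
        fix x :: real assume "x \<in> space lebesgue"
        from lim.hyps(3)[OF this, of i] show "norm \<bar>f x - s i x\<bar> \<le> 3 * \<bar>f x\<bar>" by simp
      qed
    qed (use lim.hyps(1,4) in auto)
    then obtain i where "\<bar>LINT x|lebesgue. \<bar>f x - s i x\<bar>\<bar> < e"
      using LIMSEQ_D[of _ 0 e] e by fastforce
    then show "\<exists>g. integrable lebesgue g \<and> L1_translation_continuous g \<and> (LINT x|lebesgue. \<bar>f x - g x\<bar>) < e"
      using lim.hyps(1) lim.IH by (intro exI[of _ "s i"]) auto
  qed
qed

text \<open>This reduces translations in \<open>L\<^sup>2\<close> to translations in \<open>L\<^sup>1\<close>: if \<open>f\<close> is square integrable then \<open>f \<bar>f\<bar>\<close> is integrable.\<close>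

lemma square_diff_le_signed_squares:
  fixes a b :: real
  shows "(a - b)\<^sup>2 \<le> 2 * \<bar>a * \<bar>a\<bar> - b * \<bar>b\<bar>\<bar>"
proof -
  consider "a \<ge> 0" "b \<ge> 0" | "a \<le> 0" "b \<le> 0" | "a \<ge> 0" "b \<le> 0" | "a \<le> 0" "b \<ge> 0" by linarith
  then show ?thesis
  proof cases
    case 1
    have "\<bar>a - b\<bar> * \<bar>a - b\<bar> \<le> \<bar>a - b\<bar> * \<bar>a + b\<bar>" using 1 by (intro mult_left_mono) auto
    also have "\<dots> = \<bar>a * a - b * b\<bar>" by (simp add: algebra_simps flip: abs_mult)
    finally have "(a - b)\<^sup>2 \<le> \<bar>a * a - b * b\<bar>" by (simp add: power2_eq_square flip: abs_mult)
    from order_trans[OF this, of "2 * \<bar>a * a - b * b\<bar>"] 1 show ?thesis by simp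
  next
    case 2
    have "\<bar>a - b\<bar> * \<bar>a - b\<bar> \<le> \<bar>a - b\<bar> * \<bar>a + b\<bar>" using 2 by (intro mult_left_mono) auto
    also have "\<dots> = \<bar>a * a - b * b\<bar>" by (simp add: algebra_simps flip: abs_mult)
    finally have "(a - b)\<^sup>2 \<le> \<bar>a * a - b * b\<bar>" by (simp add: power2_eq_square flip: abs_mult)
    from order_trans[OF this, of "2 * \<bar>a * a - b * b\<bar>"] 2 show ?thesis by (simp add: abs_minus_commute)
  next
    case 3
    then show ?thesis using zero_le_power2[of "a + b"]
      by (simp add: power2_eq_square algebra_simps)
  next
    case 4
    then show ?thesis using zero_le_power2[of "a + b"]
      by (simp add: power2_eq_square algebra_simps)
  qed
qed

lemma L2_translation_continuous:
  fixes f :: "real \<Rightarrow> real"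
  assumes fm: "f \<in> borel_measurable lebesgue" and f2: "integrable lebesgue (\<lambda>x. (f x)\<^sup>2)" and h: "h \<longlonglongrightarrow> 0"
  shows "(\<lambda>n. LINT x|lebesgue. (f (x + h n) - f x)\<^sup>2) \<longlonglongrightarrow> 0"
    and "integrable lebesgue (\<lambda>x. (f (x + a) - f x)\<^sup>2)"
proof -
  \<comment> \<open>the signed square of \<open>f\<close>, which is integrable\<close>
  define g where "g x = f x * \<bar>f x\<bar>" for x
  have gi: "integrable lebesgue g"
  proof (rule Bochner_Integration.integrable_bound[OF f2])
    show "g \<in> borel_measurable lebesgue" unfolding g_def using fm by measurable
  qed (simp add: g_def abs_mult power2_eq_square)
  have gs: "integrable lebesgue (\<lambda>x. g (x + a))" for a
    using gi by (simp add: lebesgue_integral_shift)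
  have fsm: "(\<lambda>x. f (x + a)) \<in> borel_measurable lebesgue" for a
    using borel_measurable_affine[OF fm, of 1 a] by (simp add: add.commute)
  have gd: "integrable lebesgue (\<lambda>x. 2 * \<bar>g (x + a) - g x\<bar>)" for a
    using gi gs by simp
  show i: "integrable lebesgue (\<lambda>x. (f (x + a) - f x)\<^sup>2)" for a
    by (rule Bochner_Integration.integrable_bound[OF gd[of a]])
       (use fsm fm square_diff_le_signed_squares in \<open>auto simp: g_def\<close>)
  show "(\<lambda>n. LINT x|lebesgue. (f (x + h n) - f x)\<^sup>2) \<longlonglongrightarrow> 0"
  proof (rule Lim_null_comparison[OF always_eventually])
    show "\<forall>n. norm (LINT x|lebesgue. (f (x + h n) - f x)\<^sup>2) \<le> 2 * (LINT x|lebesgue. \<bar>g (x + h n) - g x\<bar>)"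
    proof
      fix n
      have "(LINT x|lebesgue. (f (x + h n) - f x)\<^sup>2) \<le> (LINT x|lebesgue. 2 * \<bar>g (x + h n) - g x\<bar>)"
        by (rule integral_mono[OF i gd]) (simp add: g_def square_diff_le_signed_squares)
      then show "norm (LINT x|lebesgue. (f (x + h n) - f x)\<^sup>2) \<le> 2 * (LINT x|lebesgue. \<bar>g (x + h n) - g x\<bar>)"
        by simp
    qed
    show "(\<lambda>n. 2 * (LINT x|lebesgue. \<bar>g (x + h n) - g x\<bar>)) \<longlonglongrightarrow> 0"
      using integrable_imp_L1_translation_continuous[OF gi] h tendsto_mult_right_zero
      unfolding L1_translation_continuous_def by blast
  qed
qed

section \<open>The delay equation for the inflow trace\<close>

text \<open>Variation of constants for \<open>w' = a w + b r\<close> with integrable forcing \<open>r\<close>.\<close>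

lemma linear_integral_equation_solution:
  fixes r :: "real \<Rightarrow> real"
  assumes r: "integrable (lebesgue_on {0..1}) r"
  shows "\<exists>w. continuous_on {0..1} w \<and>
     (\<forall>\<sigma>\<in>{0..1}. w \<sigma> = m + (LINT s|lebesgue_on {0..\<sigma>}. a * w s + b * r s))"
proof -
  let ?v = "\<lambda>s. (b * exp (- a * s)) * r s"
  define P where "P \<sigma> = m + (LINT s|lebesgue_on {0..\<sigma>}. ?v s)" for \<sigma>
  have vi: "integrable (lebesgue_on {0..1}) ?v"
    by (rule integrable_continuous_mult[OF _ r]) (intro continuous_intros)
  have cP: "continuous_on {0..1} P"
    unfolding P_def by (rule continuous_on_indefinite[OF vi])
  define w where "w \<sigma> = exp (a * \<sigma>) * P \<sigma>" for \<sigma>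
  have cw: "continuous_on {0..1} w"
    unfolding w_def by (intro continuous_intros cP)
  have ce: "continuous_on S (\<lambda>s. a * exp (a * s))" for S
    by (intro continuous_intros)
  have expL: "exp (a * s) = 1 + (LINT r|lebesgue_on {0..s}. a * exp (a * r))" if "s \<in> {0..1}" for s
  proof -
    have "((\<lambda>r. a * exp (a * r)) has_integral (exp (a * s) - exp (a * 0))) {0..s}"
      using that by (intro fundamental_theorem_of_calculus)
        (auto intro!: derivative_eq_intros simp: has_real_derivative_iff_has_vector_derivative[symmetric])
    from integral_unique[OF this] have "integral {0..s} (\<lambda>r. a * exp (a * r)) = exp (a * s) - 1"
      by (simp only: mult_zero_right exp_zero)
    then show ?thesis
      using lebesgue_integral_eq_integral[OF integrable_continuous_lebesgue_on[OF ce], of 0 s] by simp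
  qed
  have "w \<sigma> = m + (LINT s|lebesgue_on {0..\<sigma>}. a * w s + b * r s)" if s: "\<sigma> \<in> {0..1}" for \<sigma>
  proof -
    have vi': "integrable (lebesgue_on {0..\<sigma>}) ?v"
      by (rule integrable_subinterval[OF vi]) (use s in auto)
    have "exp (a * \<sigma>) * P \<sigma> - 1 * m = (LINT s|lebesgue_on {0..\<sigma>}. (a * exp (a * s)) * P s + exp (a * s) * ?v s)"
    proof (rule product_rule_indefinite_integrals[OF _ integrable_continuous_lebesgue_on[OF ce] vi'])
      show "exp (a * x) = 1 + (LINT r|lebesgue_on {0..x}. a * exp (a * r))" if "x \<in> {0..\<sigma>}" for x
        by (rule expL) (use that s in auto)
    qed (use s in \<open>auto simp: P_def\<close>)
    also have "\<dots> = (LINT s|lebesgue_on {0..\<sigma>}. a * w s + b * r s)"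
      by (intro Bochner_Integration.integral_cong refl) (simp add: w_def exp_minus)
    finally show ?thesis by (simp add: w_def)
  qed
  with cw show ?thesis by blast
qed

lemma lebesgue_on_Icc_spike_right:
  fixes f g :: "real \<Rightarrow> real"
  assumes f: "integrable (lebesgue_on {a..b}) f" and eq: "\<And>x. x \<in> {a..<b} \<Longrightarrow> g x = f x"
  shows "integrable (lebesgue_on {a..b}) g" "(LINT x|lebesgue_on {a..b}. g x) = (LINT x|lebesgue_on {a..b}. f x)"
proof -
  have "f absolutely_integrable_on {a..b}"
    using f by (simp add: set_integrable_def integrable_restrict_space)
  then have "g absolutely_integrable_on {a..b}"
    by (rule absolutely_integrable_spike[of _ _ "{b}"]) (use eq in auto)
  then show g: "integrable (lebesgue_on {a..b}) g"
    by (simp add: set_integrable_def integrable_restrict_space)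
  have "integral {a..b} g = integral {a..b} f"
    by (rule integral_spike[of "{b}"]) (use eq in auto)
  then show "(LINT x|lebesgue_on {a..b}. g x) = (LINT x|lebesgue_on {a..b}. f x)"
    using f g by (simp add: lebesgue_integral_eq_integral)
qed

lemma
  fixes f :: "real \<Rightarrow> real"
  assumes m: "m \<noteq> 0" and ab: "\<And>x. p + m * x \<in> {a'..b'} \<longleftrightarrow> x \<in> {a..b}"
  shows integrable_lebesgue_on_Icc_affine:
      "integrable (lebesgue_on {a..b}) (\<lambda>x. f (p + m * x)) \<longleftrightarrow> integrable (lebesgue_on {a'..b'}) f"
    and integral_lebesgue_on_Icc_affine:
      "(LINT x|lebesgue_on {a'..b'}. f x) = \<bar>m\<bar> * (LINT x|lebesgue_on {a..b}. f (p + m * x))"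
proof -
  have e: "indicator {a'..b'} (p + m * x) = (indicator {a..b} x :: real)" for x
    using ab[of x] by (simp only: indicator_def)
  show "integrable (lebesgue_on {a..b}) (\<lambda>x. f (p + m * x)) \<longleftrightarrow> integrable (lebesgue_on {a'..b'}) f"
    using lebesgue_integrable_real_affine_iff[OF m, of "\<lambda>x. indicator {a'..b'} x * f x" p]
    unfolding e integrable_lebesgue_on_Icc_iff .
  show "(LINT x|lebesgue_on {a'..b'}. f x) = \<bar>m\<bar> * (LINT x|lebesgue_on {a..b}. f (p + m * x))"
    using lebesgue_integral_real_affine[OF m, of "\<lambda>x. indicator {a'..b'} x * f x" p]
    unfolding e integral_lebesgue_on_Icc by simp
qed

lemma lebesgue_on_Icc_shift:
  fixes f :: "real \<Rightarrow> real"
  shows "integrable (lebesgue_on {a + h..b + h}) (\<lambda>x. f (x - h)) \<longleftrightarrow> integrable (lebesgue_on {a..b}) f"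
    and "(LINT x|lebesgue_on {a + h..b + h}. f (x - h)) = (LINT x|lebesgue_on {a..b}. f x)"
  using integrable_lebesgue_on_Icc_affine[of 1 "- h" a b "a + h" "b + h" f]
    integral_lebesgue_on_Icc_affine[of 1 "- h" a b "a + h" "b + h" f]
  by (simp_all add: algebra_simps)

lemma L2_space_iff:
  assumes "S \<in> lmeasurable"
  shows "f \<in> L2_space S \<longleftrightarrow> integrable (lebesgue_on S) f \<and> integrable (lebesgue_on S) (\<lambda>x. (f x)\<^sup>2)"
proof
  assume f: "f \<in> L2_space S"
  show "integrable (lebesgue_on S) f \<and> integrable (lebesgue_on S) (\<lambda>x. (f x)\<^sup>2)"
    using L2_space_integrable[OF f assms] L2_spaceD(2)[OF f] by (rule conjI)
next
  assume "integrable (lebesgue_on S) f \<and> integrable (lebesgue_on S) (\<lambda>x. (f x)\<^sup>2)"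
  then show "f \<in> L2_space S"
    unfolding L2_space_def using borel_measurable_integrable by blast
qed

lemmas L2_space_Icc_iff = L2_space_iff[OF lmeasurable_Icc]

text \<open>Given the trace \<open>r\<close> on one unit interval, let \<open>w(\<sigma>)\<close> be the mass in the window that ends at distance \<open>\<sigma>\<close> into the
next interval.  There the new trace is \<open>k r + (k - 1) d w\<close>, so \<open>w\<close> has the derivative
\<open>(k - 1) d w + (k - 1) r\<close> and starts at \<open>\<integral> r\<close>.  Solving this linear equation produces the next piece of the trace, and \<open>G\<close> is obtained by concatenating the pieces.\<close>

lemma delay_equation_solution:
  fixes k d :: real
  assumes r0: "r0 \<in> L2_space {-1..0}"
  obtains G where "\<And>b. G \<in> L2_space {-1..b}"
    and "\<And>\<tau>. \<tau> \<in> {-1..<0} \<Longrightarrow> G \<tau> = r0 \<tau>"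
    and "\<And>\<tau>. 0 \<le> \<tau> \<Longrightarrow> G \<tau> = k * G (\<tau> - 1) + (k - 1) * d * (LINT s|lebesgue_on {\<tau> - 1..\<tau>}. G s)"
proof -
  have "\<forall>r\<in>L2_space {0..1}. \<exists>w. continuous_on {0..1} w \<and>
     (\<forall>\<sigma>\<in>{0..1}. w \<sigma> = (LINT s|lebesgue_on {0..1}. r s) + (LINT s|lebesgue_on {0..\<sigma>}. (k - 1) * d * w s + (k - 1) * r s))"
    by (intro ballI linear_integral_equation_solution) (simp add: L2_space_Icc_iff)
  from bchoice[OF this] obtain mass where mass: "\<forall>r\<in>L2_space {0..1}. continuous_on {0..1} (mass r) \<and>
     (\<forall>\<sigma>\<in>{0..1}. mass r \<sigma> = (LINT s|lebesgue_on {0..1}. r s)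
        + (LINT s|lebesgue_on {0..\<sigma>}. (k - 1) * d * mass r s + (k - 1) * r s))"
    by (rule exE)
  note mass_cont = mass[rule_format, THEN conjunct1]
    and mass_eq = mass[rule_format, THEN conjunct2, rule_format]
  \<comment> \<open>\<open>R n\<close> is the trace on \<open>[n - 1, n)\<close>, moved to \<open>[0, 1)\<close>\<close>
  define R where "R = rec_nat (\<lambda>\<sigma>. r0 (\<sigma> - 1)) (\<lambda>_ r \<sigma>. k * r \<sigma> + (k - 1) * d * mass r \<sigma>)"
  have R0: "R 0 = (\<lambda>\<sigma>. r0 (\<sigma> - 1))" and RS: "R (Suc n) = (\<lambda>\<sigma>. k * R n \<sigma> + (k - 1) * d * mass (R n) \<sigma>)" for n
    by (simp_all add: R_def)
  have RL: "R n \<in> L2_space {0..1}" for n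
  proof (induction n)
    case 0
    show ?case
      unfolding R0 L2_space_Icc_iff
      using r0 lebesgue_on_Icc_shift(1)[of "-1" 1 0 r0] lebesgue_on_Icc_shift(1)[of "-1" 1 0 "\<lambda>x. (r0 x)\<^sup>2"]
      by (simp add: L2_space_Icc_iff)
  next
    case (Suc n)
    show ?case unfolding RS by (rule L2_space_linear[OF Suc continuous_imp_L2[OF mass_cont[OF Suc]]])
  qed
  have Ri: "integrable (lebesgue_on {a..b}) (R n)" if "{a..b} \<subseteq> {0..1}" for n a b
    using L2_space_subinterval[OF RL that] by (simp add: L2_space_Icc_iff)
  define G where "G \<tau> = R (nat (\<lfloor>\<tau>\<rfloor> + 1)) (frac \<tau>)" for \<tau>
  have G: "G \<tau> = R n (\<tau> - (real n - 1))" if "real n - 1 \<le> \<tau>" "\<tau> < real n" for n \<tau>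
  proof -
    have fl: "\<lfloor>\<tau>\<rfloor> = int n - 1" using that by linarith
    show ?thesis unfolding G_def frac_def fl by simp
  qed
  have piece: "integrable (lebesgue_on {a..b}) (\<lambda>x. H (G x)) \<and>
      (LINT x|lebesgue_on {a..b}. H (G x)) = (LINT x|lebesgue_on {a - (real n - 1)..b - (real n - 1)}. H (R n x))"
    if "real n - 1 \<le> a" "b \<le> real n"
      "integrable (lebesgue_on {a - (real n - 1)..b - (real n - 1)}) (\<lambda>x. H (R n x))"
    for n a b and H :: "real \<Rightarrow> real"
  proof -
    have i: "integrable (lebesgue_on {a..b}) (\<lambda>x. H (R n (x - (real n - 1))))"
      using that(3) lebesgue_on_Icc_shift(1)[of "a - (real n - 1)" "real n - 1" "b - (real n - 1)" "\<lambda>x. H (R n x)"] by simp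
    have e: "H (G x) = H (R n (x - (real n - 1)))" if "x \<in> {a..<b}" for x
      using G[of n x] that \<open>real n - 1 \<le> a\<close> \<open>b \<le> real n\<close> by auto
    show ?thesis
      using lebesgue_on_Icc_spike_right[OF i, of "\<lambda>x. H (G x)"] e
        lebesgue_on_Icc_shift(2)[of "a - (real n - 1)" "real n - 1" "b - (real n - 1)" "\<lambda>x. H (R n x)"] by simp
  qed
  have Gunit: "integrable (lebesgue_on {real n - 1..real n}) G \<and> integrable (lebesgue_on {real n - 1..real n}) (\<lambda>x. (G x)\<^sup>2)" for n
    using piece[of n "real n - 1" "real n" "\<lambda>x. x"] piece[of n "real n - 1" "real n" "\<lambda>x. x\<^sup>2"] RL[of n]
    by (simp add: L2_space_Icc_iff)
  have Gn: "G \<in> L2_space {-1..real n}" for n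
    unfolding L2_space_Icc_iff
  proof (induction n)
    case 0
    then show ?case using Gunit[of 0] by simp
  next
    case (Suc n)
    have "real (Suc n) - 1 = real n" by simp
    then show ?case
      using Suc Gunit[of "Suc n"] integrable_combine[of "-1" "real n" _ "real (Suc n)"] by auto
  qed
  have GL: "G \<in> L2_space {-1..b}" for b
  proof -
    obtain n where "b \<le> real n" using real_arch_simple by blast
    then show ?thesis by (intro L2_space_subinterval[OF Gn[of n]]) auto
  qed
  have Ginit: "G \<tau> = r0 \<tau>" if "\<tau> \<in> {-1..<0}" for \<tau>
    using G[of 0 \<tau>] that by (simp add: R0)
  have Geq: "G \<tau> = k * G (\<tau> - 1) + (k - 1) * d * (LINT s|lebesgue_on {\<tau> - 1..\<tau>}. G s)" if t: "0 \<le> \<tau>" for \<tau>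
  proof -
    define n where "n = nat \<lfloor>\<tau>\<rfloor>"
    define \<sigma> where "\<sigma> = \<tau> - real n"
    have n: "real n \<le> \<tau>" "\<tau> < real n + 1" using t by (auto simp: n_def)
    have s: "0 \<le> \<sigma>" "\<sigma> < 1" using n by (auto simp: \<sigma>_def)
    let ?w = "mass (R n)"
    have wi: "integrable (lebesgue_on {0..\<sigma>}) ?w"
      using continuous_on_subset[OF mass_cont[OF RL]] s by (intro integrable_continuous_lebesgue_on) auto
    have sig: "{0..\<sigma>} \<subseteq> {0..1}" "{\<sigma>..1} \<subseteq> {0..1}" using s by auto
    have "(LINT x|lebesgue_on {\<tau> - 1..\<tau>}. G x)
        = (LINT x|lebesgue_on {\<tau> - 1..real n}. G x) + (LINT x|lebesgue_on {real n..\<tau>}. G x)"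
    proof (rule integral_combine)
      have "G \<in> L2_space {\<tau> - 1..\<tau>}" by (rule L2_space_subinterval[OF GL[of \<tau>]]) (use t in auto)
      then show "integrable (lebesgue_on {\<tau> - 1..\<tau>}) G" by (simp add: L2_space_Icc_iff)
    qed (use n in auto)
    also have "(LINT x|lebesgue_on {\<tau> - 1..real n}. G x) = (LINT x|lebesgue_on {\<sigma>..1}. R n x)"
    proof -
      have e: "\<tau> - 1 - (real n - 1) = \<sigma>" "real n - (real n - 1) = 1" by (simp_all add: \<sigma>_def)
      show ?thesis
        using piece[of n "\<tau> - 1" "real n" "\<lambda>x. x"] n Ri[OF sig(2), of n] unfolding e by simp
    qed
    also have "(LINT x|lebesgue_on {real n..\<tau>}. G x) = (LINT x|lebesgue_on {0..\<sigma>}. R (Suc n) x)"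
    proof -
      have e: "real n - (real (Suc n) - 1) = 0" "\<tau> - (real (Suc n) - 1) = \<sigma>" by (simp_all add: \<sigma>_def)
      show ?thesis
        using piece[of "Suc n" "real n" \<tau> "\<lambda>x. x"] n Ri[OF sig(1), of "Suc n"] unfolding e by simp
    qed
    also have "(LINT x|lebesgue_on {0..\<sigma>}. R (Suc n) x)
       = k * (LINT x|lebesgue_on {0..\<sigma>}. R n x) + (k - 1) * d * (LINT x|lebesgue_on {0..\<sigma>}. ?w x)"
      unfolding RS using wi Ri[OF sig(1), of n] by (subst Bochner_Integration.integral_add) auto
    also have "(LINT x|lebesgue_on {\<sigma>..1}. R n x) = (LINT x|lebesgue_on {0..1}. R n x) - (LINT x|lebesgue_on {0..\<sigma>}. R n x)"
      using integral_combine[of 0 1 "R n" \<sigma>] Ri[of 0 1 n] s by simp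
    finally have "(LINT x|lebesgue_on {\<tau> - 1..\<tau>}. G x) = (LINT x|lebesgue_on {0..1}. R n x)
       + ((k - 1) * d * (LINT x|lebesgue_on {0..\<sigma>}. ?w x) + (k - 1) * (LINT x|lebesgue_on {0..\<sigma>}. R n x))"
      by (simp add: algebra_simps)
    also have "\<dots> = ?w \<sigma>"
      using mass_eq[OF RL, of \<sigma> n] s wi Ri[OF sig(1), of n] by (simp add: Bochner_Integration.integral_add)
    finally have M: "(LINT x|lebesgue_on {\<tau> - 1..\<tau>}. G x) = ?w \<sigma>" .
    have "G \<tau> = R (Suc n) \<sigma>"
      using G[of "Suc n" \<tau>] n by (simp add: \<sigma>_def)
    moreover have "G (\<tau> - 1) = R n \<sigma>"
      using G[of n "\<tau> - 1"] n by (simp add: \<sigma>_def)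
    ultimately show ?thesis unfolding M by (simp add: RS)
  qed
  show thesis by (rule that[OF GL Ginit Geq])
qed

section \<open>Transported traces are weak solutions\<close>

lemma lebesgue_on_Ioo_iff_Icc:
  fixes f :: "real \<Rightarrow> real"
  shows "integrable (lebesgue_on {a<..<b}) f \<longleftrightarrow> integrable (lebesgue_on {a..b}) f"
    and "(LINT x|lebesgue_on {a<..<b}. f x) = (LINT x|lebesgue_on {a..b}. f x)"
proof -
  have conv: "integrable (lebesgue_on S) f \<longleftrightarrow> f absolutely_integrable_on S" if "S \<in> sets lebesgue" for S
    using that by (simp add: set_integrable_def integrable_restrict_space)
  show *: "integrable (lebesgue_on {a<..<b}) f \<longleftrightarrow> integrable (lebesgue_on {a..b}) f"
    using absolutely_integrable_on_Icc_iff_Ioo[where f = f and a = a and b = b] by (simp add: conv)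
  show "(LINT x|lebesgue_on {a<..<b}. f x) = (LINT x|lebesgue_on {a..b}. f x)"
  proof (cases "integrable (lebesgue_on {a..b}) f")
    case True
    then show ?thesis
      using lebesgue_integral_eq_integral[of "{a<..<b}" f] lebesgue_integral_eq_integral[of "{a..b}" f] *
      by (simp add: integral_open_interval_real)
  next
    case False
    then show ?thesis using * by (simp add: not_integrable_integral_eq)
  qed
qed

lemma L2_space_Ioo_eq_Icc: "L2_space {a<..<b} = L2_space {a..b}"
  by (auto simp: L2_space_iff lebesgue_on_Ioo_iff_Icc)

text \<open>One-sided partial derivatives that are jointly continuous on the rectangle give a total derivative within the
rectangle, to which the chain rule applies.\<close>

lemma C1_rect_derivative_along_characteristic:
  assumes C1: "C1_rect \<tau> \<phi> \<phi>t \<phi>x" and sub: "\<And>t. t \<in> {a..b} \<Longrightarrow> t \<in> {0..\<tau>} \<and> c * t - z \<in> {0..1}" and t: "t \<in> {a..b}"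
  shows "((\<lambda>t. \<phi> t (c * t - z)) has_real_derivative (\<phi>t t (c * t - z) + c * \<phi>x t (c * t - z))) (at t within {a..b})"
proof -
  let ?R = "{0..\<tau>} \<times> {0..1::real}"
  have part: "((\<lambda>(s, x). \<phi> s x) has_derivative (\<lambda>(ds, dx). \<phi>t s x * ds + blinfun_apply (blinfun_mult_right (\<phi>x s x)) dx)) (at (s, x) within ?R)"
    if s: "s \<in> {0..\<tau>}" and x: "x \<in> {0..1}" for s x
  proof (rule has_derivative_partialsI[where fy = "\<lambda>s x. blinfun_mult_right (\<phi>x s x)"])
    show "((\<lambda>s. \<phi> s x) has_derivative (*) (\<phi>t s x)) (at s within {0..\<tau>})"
      using C1 s x by (auto simp: C1_rect_def has_field_derivative_def)
    show "((\<lambda>x. \<phi> s x) has_derivative blinfun_apply (blinfun_mult_right (\<phi>x s x))) (at x within {0..1})"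
      if "s \<in> {0..\<tau>}" "x \<in> {0..1}" for s x
      using C1 that by (auto simp: C1_rect_def has_field_derivative_def)
    have "continuous_on ?R (\<lambda>p. blinfun_mult_right (\<phi>x (fst p) (snd p)))"
      by (rule bounded_linear.continuous_on[OF bounded_linear_blinfun_mult_right])
         (use C1 in \<open>simp add: C1_rect_def case_prod_beta\<close>)
    then show "continuous (at (s, x) within ?R) (\<lambda>(s, x). blinfun_mult_right (\<phi>x s x))"
      using s x by (simp add: continuous_on_eq_continuous_within case_prod_unfold)
  qed (use x in auto)
  have "((\<lambda>t. (case (t, c * t - z) of (s, x) \<Rightarrow> \<phi> s x)) has_derivative
      (\<lambda>h. (case (h, c * h) of (ds, dx) \<Rightarrow> \<phi>t t (c * t - z) * ds + blinfun_apply (blinfun_mult_right (\<phi>x t (c * t - z))) dx))) (at t within {a..b})"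
  proof (rule has_derivative_in_compose[of "\<lambda>t. (t, c * t - z)" "\<lambda>h. (h, c * h)" t "{a..b}" "\<lambda>(s, x). \<phi> s x"])
    show "((\<lambda>t. (t, c * t - z)) has_derivative (\<lambda>h. (h, c * h))) (at t within {a..b})"
      by (auto intro!: derivative_eq_intros)
    show "((\<lambda>(s, x). \<phi> s x) has_derivative
       (\<lambda>(ds, dx). \<phi>t t (c * t - z) * ds + blinfun_apply (blinfun_mult_right (\<phi>x t (c * t - z))) dx))
       (at (t, c * t - z) within (\<lambda>t. (t, c * t - z)) ` {a..b})"
      by (rule has_derivative_subset[OF part]) (use sub t in auto)
  qed
  moreover have "(\<lambda>h. (case (h, c * h) of (ds, dx) \<Rightarrow> \<phi>t t (c * t - z) * ds + blinfun_apply (blinfun_mult_right (\<phi>x t (c * t - z))) dx))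
      = (*) (\<phi>t t (c * t - z) + c * \<phi>x t (c * t - z))"
    by (auto simp: algebra_simps)
  ultimately show ?thesis
    by (simp only: has_field_derivative_def prod.case)
qed

text \<open>In the variables \<open>t\<close> and \<open>z = c t - x\<close> the integrand is \<open>G(z)\<close> times the derivative of \<open>\<phi>\<close> along the
characteristic labelled \<open>z\<close>.  By Fubini's theorem the time integral comes first, and the fundamental theorem of calculus leaves
the values of \<open>\<phi>\<close> where the characteristic leaves the rectangle (\<open>x = 1\<close>, or \<open>t = \<tau>\<close> where \<open>\<phi> = 0\<close>) and where it
enters (\<open>x = 0\<close> or \<open>t = 0\<close>).\<close>

lemma transport_weak_identity:
  fixes G :: "real \<Rightarrow> real"
  assumes c: "c > 0" and tau: "\<tau> > 0" and G: "integrable (lebesgue_on {-1..c * \<tau>}) G"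
    and C1: "C1_rect \<tau> \<phi> \<phi>t \<phi>x" and final: "\<And>x. x \<in> {0..1} \<Longrightarrow> \<phi> \<tau> x = 0"
  shows "(LINT t|lebesgue_on {0..\<tau>}. LINT x|lebesgue_on {0<..<1}. G (c * t - x) * (\<phi>t t x + c * \<phi>x t x))
    = c * (LINT t|lebesgue_on {0..\<tau>}. G (c * t - 1) * \<phi> t 1) - c * (LINT t|lebesgue_on {0..\<tau>}. G (c * t) * \<phi> t 0)
      - (LINT x|lebesgue_on {0<..<1}. G (- x) * \<phi> 0 x)"
proof -
  interpret L: pair_sigma_finite "lebesgue :: real measure" "lebesgue :: real measure"
    by (rule pair_sigma_finite_lebesgue)
  let ?R = "{0..\<tau>} \<times> {0..1::real}"
  define D where "D p = \<phi>t (fst p) (snd p) + c * \<phi>x (fst p) (snd p)" for p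
  have cphi: "continuous_on ?R (\<lambda>p. \<phi> (fst p) (snd p))" and cD: "continuous_on ?R D"
    using C1 unfolding D_def C1_rect_def case_prod_beta by (auto intro!: continuous_intros)
  define H where "H p = indicator ?R p *\<^sub>R D p" for p
  have Hm[measurable]: "H \<in> borel_measurable borel"
    unfolding H_def by (rule borel_measurable_continuous_on_indicator[OF _ cD]) (intro borel_closed closed_Times closed_atLeastAtMost)
  obtain B where B: "\<And>p. p \<in> ?R \<Longrightarrow> \<bar>D p\<bar> \<le> B"
  proof -
    have "compact (D ` ?R)" by (intro compact_continuous_image cD compact_Times) auto
    from compact_imp_bounded[OF this] obtain B where "\<forall>y\<in>D ` ?R. norm y \<le> B"
      unfolding bounded_iff by (rule exE)
    then have "\<bar>D p\<bar> \<le> B" if "p \<in> ?R" for p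
      using that by (metis image_eqI real_norm_def)
    then show ?thesis by (rule that)
  qed
  define g where "g z = indicator {-1..c * \<tau>} z * G z" for z
  have g: "integrable lebesgue g"
    using G unfolding g_def integrable_lebesgue_on_Icc_iff .
  define K where "K t z = g z * H (t, c * t - z)" for t z
  have K_int: "integrable (lebesgue \<Otimes>\<^sub>M lebesgue) (\<lambda>(t, z). K t z)"
  proof (rule Bochner_Integration.integrable_bound)
    have i1: "integrable lebesgue (indicator {0..\<tau>} :: real \<Rightarrow> real)"
      using fmeasurableD[OF lmeasurable_Icc[of 0 \<tau>]] fmeasurableD2[OF lmeasurable_Icc[of 0 \<tau>]]
      by (intro integrable_real_indicator) (simp_all only: less_top infinity_ennreal_def)
    show "integrable (lebesgue \<Otimes>\<^sub>M lebesgue) (\<lambda>(t, z). indicator {0..\<tau>} t * (B * g z))"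
      by (rule L.Fubini_integrable) (use g i1 in \<open>auto simp: abs_mult\<close>)
    have [measurable]: "(\<lambda>x::real. x) \<in> lebesgue \<rightarrow>\<^sub>M borel" "g \<in> borel_measurable lebesgue"
      using g by (simp_all add: measurable_completion)
    have "(\<lambda>p. H (fst p, c * fst p - snd p)) \<in> borel_measurable (lebesgue \<Otimes>\<^sub>M lebesgue)"
    proof (rule measurable_compose[OF _ Hm])
      show "(\<lambda>p. (fst p, c * fst p - snd p)) \<in> lebesgue \<Otimes>\<^sub>M lebesgue \<rightarrow>\<^sub>M borel"
        unfolding borel_prod[symmetric] by measurable
    qed
    then show "(\<lambda>(t, z). K t z) \<in> borel_measurable (lebesgue \<Otimes>\<^sub>M lebesgue)"
      unfolding K_def case_prod_beta by measurable
    have "\<bar>K t z\<bar> \<le> \<bar>indicator {0..\<tau>} t * (B * g z)\<bar>" for t z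
    proof (cases "(t, c * t - z) \<in> ?R")
      case True
      then have "\<bar>D (t, c * t - z)\<bar> * \<bar>g z\<bar> \<le> \<bar>B\<bar> * \<bar>g z\<bar>"
        using B[OF True] by (intro mult_right_mono) auto
      then show ?thesis using True by (simp add: K_def H_def abs_mult mult.commute)
    qed (simp add: K_def H_def)
    then show "AE p in lebesgue \<Otimes>\<^sub>M lebesgue. norm (case p of (t, z) \<Rightarrow> K t z) \<le> norm (case p of (t, z) \<Rightarrow> indicator {0..\<tau>} t * (B * g z))"
      by (auto simp: case_prod_beta)
  qed
  have inner: "indicator {0..\<tau>} t * (LINT x|lebesgue_on {0<..<1}. G (c * t - x) * (\<phi>t t x + c * \<phi>x t x)) = (LINT z|lebesgue. K t z)" for t
  proof (cases "t \<in> {0..\<tau>}")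
    case True
    have "(LINT z|lebesgue. K t z) = (LINT x|lebesgue. K t (c * t + (-1) * x))"
      using lebesgue_integral_real_affine[of "-1" "K t" "c * t"] by simp
    also have "\<dots> = (LINT x|lebesgue. indicator {0..1} x * (G (c * t - x) * (\<phi>t t x + c * \<phi>x t x)))"
    proof (intro Bochner_Integration.integral_cong refl)
      fix x :: real
      have "0 \<le> c * t" "c * t \<le> c * \<tau>" using True c by auto
      then show "K t (c * t + (-1) * x) = indicator {0..1} x * (G (c * t - x) * (\<phi>t t x + c * \<phi>x t x))"
        using True by (auto simp: K_def H_def g_def D_def indicator_def)
    qed
    finally show ?thesis
      using True by (simp add: lebesgue_on_Ioo_iff_Icc integral_lebesgue_on_Icc)
  next
    case False
    then have "K t z = 0" for z by (auto simp: K_def H_def)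
    then show ?thesis using False by simp
  qed
  \<comment> \<open>the values of \<open>\<phi>\<close> at exit and entry; for \<open>z > c \<tau> - 1\<close> the exit is at \<open>t = \<tau>\<close>, where \<open>\<phi>\<close> vanishes\<close>
  define top where "top z = indicator {-1..c * \<tau> - 1} z * \<phi> ((z + 1) / c) 1" for z
  define bot where "bot z = indicator {0..c * \<tau>} z * \<phi> (z / c) 0 + indicator {-1..0} z * \<phi> 0 (- z)" for z
  have outer: "(LINT t|lebesgue. K t z) = g z * (top z - bot z)" if z0: "z \<noteq> 0" for z
  proof (cases "z \<in> {-1..c * \<tau>}")
    case False
    then show ?thesis by (simp add: K_def g_def)
  next
    case True
    \<comment> \<open>the characteristic \<open>z\<close> is inside the rectangle exactly during \<open>[a, b]\<close>\<close>
    define a where "a = max 0 (z / c)"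
    define b where "b = min \<tau> ((z + 1) / c)"
    have ab: "a \<le> b"
      using True c tau by (auto simp: a_def b_def field_simps)
    have sub: "t \<in> {0..\<tau>} \<and> c * t - z \<in> {0..1} \<longleftrightarrow> t \<in> {a..b}" for t
      using c by (auto simp: a_def b_def field_simps)
    have der: "((\<lambda>t. \<phi> t (c * t - z)) has_real_derivative D (t, c * t - z)) (at t within {a..b})" if "t \<in> {a..b}" for t
      unfolding D_def fst_conv snd_conv using sub that by (intro C1_rect_derivative_along_characteristic[OF C1]) auto
    have cont: "continuous_on {a..b} (\<lambda>t. D (t, c * t - z))"
    proof (rule continuous_on_compose2[OF cD])
      show "(\<lambda>t. (t, c * t - z)) ` {a..b} \<subseteq> ?R"
        using sub by (auto simp del: atLeastAtMost_iff)
    qed (intro continuous_intros)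
    have "(LINT t|lebesgue. H (t, c * t - z)) = (LINT t|lebesgue_on {a..b}. D (t, c * t - z))"
      unfolding integral_lebesgue_on_Icc
    proof (intro Bochner_Integration.integral_cong refl)
      fix t
      show "H (t, c * t - z) = indicator {a..b} t * D (t, c * t - z)"
        using sub[of t] by (simp add: H_def indicator_def del: atLeastAtMost_iff)
    qed
    also have "\<dots> = integral {a..b} (\<lambda>t. D (t, c * t - z))"
      by (rule lebesgue_integral_eq_integral[OF integrable_continuous_lebesgue_on[OF cont]]) simp
    also have "\<dots> = \<phi> b (c * b - z) - \<phi> a (c * a - z)"
      by (rule integral_unique, rule fundamental_theorem_of_calculus[OF ab])
         (use der in \<open>simp add: has_real_derivative_iff_has_vector_derivative\<close>)
    also have "\<phi> b (c * b - z) = top z"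
    proof (cases "z \<le> c * \<tau> - 1")
      case le: True
      have "b = (z + 1) / c" using le c by (simp add: b_def field_simps min_def)
      then show ?thesis using le True c by (simp add: top_def)
    next
      case False
      have "b = \<tau>" using False c by (simp add: b_def field_simps min_def)
      moreover have "\<phi> \<tau> (c * \<tau> - z) = 0" using False True by (intro final) auto
      ultimately show ?thesis using False by (simp add: top_def)
    qed
    also have "\<phi> a (c * a - z) = bot z"
    proof (cases "z \<ge> 0")
      case le: True
      have "a = z / c" using le c by (simp add: a_def)
      then show ?thesis using le z0 True c by (simp add: bot_def)
    next
      case False
      have "a = 0" using False c by (simp add: a_def max_def divide_nonneg_pos field_simps)
      then show ?thesis using False True by (simp add: bot_def)
    qed
    finally show ?thesis by (simp add: K_def)
  qed
  have sub1: "{-1..c * \<tau> - 1} \<subseteq> {-1..c * \<tau>}" and sub2: "{0..c * \<tau>} \<subseteq> {-1..c * \<tau>}" and sub3: "{-1..0} \<subseteq> {-1..c * \<tau>}"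
    using c tau by auto
  have i1: "integrable (lebesgue_on {-1..c * \<tau> - 1}) (\<lambda>z. \<phi> ((z + 1) / c) 1 * G z)"
    by (rule integrable_continuous_mult[OF _ integrable_subinterval[OF G sub1]],
        rule continuous_on_compose2[OF cphi, of _ "\<lambda>z. ((z + 1) / c, 1)", simplified])
       (use c in \<open>auto intro!: continuous_intros simp: field_simps\<close>)
  have i2: "integrable (lebesgue_on {0..c * \<tau>}) (\<lambda>z. \<phi> (z / c) 0 * G z)"
    by (rule integrable_continuous_mult[OF _ integrable_subinterval[OF G sub2]],
        rule continuous_on_compose2[OF cphi, of _ "\<lambda>z. (z / c, 0)", simplified])
       (use c in \<open>auto intro!: continuous_intros simp: field_simps\<close>)
  have i3: "integrable (lebesgue_on {-1..0}) (\<lambda>z. \<phi> 0 (- z) * G z)"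
    by (rule integrable_continuous_mult[OF _ integrable_subinterval[OF G sub3]],
        rule continuous_on_compose2[OF cphi, of _ "\<lambda>z. (0, - z)", simplified])
       (use tau in \<open>auto intro!: continuous_intros\<close>)
  have "(LINT t|lebesgue_on {0..\<tau>}. LINT x|lebesgue_on {0<..<1}. G (c * t - x) * (\<phi>t t x + c * \<phi>x t x))
      = (LINT t|lebesgue. LINT z|lebesgue. K t z)"
    unfolding integral_lebesgue_on_Icc inner ..
  also have "\<dots> = (LINT z|lebesgue. LINT t|lebesgue. K t z)"
    using L.Fubini_integral[of K] K_int by simp
  also have "\<dots> = (LINT z|lebesgue. (indicator {-1..c * \<tau> - 1} z * (\<phi> ((z + 1) / c) 1 * G z)
       - indicator {0..c * \<tau>} z * (\<phi> (z / c) 0 * G z)) - indicator {-1..0} z * (\<phi> 0 (- z) * G z))"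
  proof (rule integral_cong_AE)
    show "(\<lambda>z. LINT t|lebesgue. K t z) \<in> borel_measurable lebesgue"
      using L.integrable_snd[OF K_int] by (intro borel_measurable_integrable) simp
    show "(\<lambda>z. (indicator {-1..c * \<tau> - 1} z * (\<phi> ((z + 1) / c) 1 * G z)
       - indicator {0..c * \<tau>} z * (\<phi> (z / c) 0 * G z)) - indicator {-1..0} z * (\<phi> 0 (- z) * G z)) \<in> borel_measurable lebesgue"
      using i1 i2 i3 unfolding integrable_lebesgue_on_Icc_iff
      by (intro borel_measurable_diff borel_measurable_integrable)
    have "(LINT t|lebesgue. K t z) = (indicator {-1..c * \<tau> - 1} z * (\<phi> ((z + 1) / c) 1 * G z)
       - indicator {0..c * \<tau>} z * (\<phi> (z / c) 0 * G z)) - indicator {-1..0} z * (\<phi> 0 (- z) * G z)" if "z \<noteq> 0" for z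
      unfolding outer[OF that] using sub1 sub2 sub3
      by (auto simp: g_def top_def bot_def indicator_def algebra_simps split: if_splits)
    then show "AE z in lebesgue. (LINT t|lebesgue. K t z) = (indicator {-1..c * \<tau> - 1} z * (\<phi> ((z + 1) / c) 1 * G z)
       - indicator {0..c * \<tau>} z * (\<phi> (z / c) 0 * G z)) - indicator {-1..0} z * (\<phi> 0 (- z) * G z)"
      by (intro AE_I'[of "{0}"]) auto
  qed
  also have "\<dots> = (LINT z|lebesgue_on {-1..c * \<tau> - 1}. \<phi> ((z + 1) / c) 1 * G z)
       - (LINT z|lebesgue_on {0..c * \<tau>}. \<phi> (z / c) 0 * G z) - (LINT z|lebesgue_on {-1..0}. \<phi> 0 (- z) * G z)"
    using i1 i2 i3 unfolding integrable_lebesgue_on_Icc_iff integral_lebesgue_on_Icc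
    by (simp only: Bochner_Integration.integral_diff Bochner_Integration.integrable_diff)
  also have "(LINT z|lebesgue_on {-1..c * \<tau> - 1}. \<phi> ((z + 1) / c) 1 * G z) = c * (LINT t|lebesgue_on {0..\<tau>}. G (c * t - 1) * \<phi> t 1)"
    using integral_lebesgue_on_Icc_affine[of c "-1" "-1" "c * \<tau> - 1" 0 \<tau> "\<lambda>z. \<phi> ((z + 1) / c) 1 * G z"] c
    by (simp add: mult.commute zero_le_mult_iff)
  also have "(LINT z|lebesgue_on {0..c * \<tau>}. \<phi> (z / c) 0 * G z) = c * (LINT t|lebesgue_on {0..\<tau>}. G (c * t) * \<phi> t 0)"
    using integral_lebesgue_on_Icc_affine[of c 0 0 "c * \<tau>" 0 \<tau> "\<lambda>z. \<phi> (z / c) 0 * G z"] c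
    by (simp add: mult.commute zero_le_mult_iff)
  also have "(LINT z|lebesgue_on {-1..0}. \<phi> 0 (- z) * G z) = (LINT x|lebesgue_on {0<..<1}. G (- x) * \<phi> 0 x)"
    using integral_lebesgue_on_Icc_affine[of "-1" 0 "-1" 0 0 1 "\<lambda>z. \<phi> 0 (- z) * G z"]
    by (simp add: mult.commute lebesgue_on_Ioo_iff_Icc conj_commute)
  finally show ?thesis .
qed

section \<open>Existence and the stability criterion\<close>

text \<open>Two profiles are translates of one another, so their distance is at most the translation error of \<open>G\<close> cut off to
a bounded interval.\<close>

lemma transported_profile_C0_L2:
  assumes c: "c > 0" and G: "\<And>b. G \<in> L2_space {-1..b}"
  shows "(\<lambda>t x. G (c * t - x)) \<in> C0_L2"
  unfolding C0_L2_def mem_Collect_eq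
proof (intro conjI allI impI)
  have prof: "(\<lambda>x. G (c * t - x)) \<in> L2_space {0<..<1}" if t: "0 \<le> t" for t
  proof -
    have "G \<in> L2_space {c * t - 1..c * t}"
      by (rule L2_space_subinterval[OF G[of "c * t"]]) (use c t in auto)
    then show ?thesis
      using integrable_lebesgue_on_Icc_affine[of "-1" "c * t" "c * t - 1" "c * t" 0 1 G]
        integrable_lebesgue_on_Icc_affine[of "-1" "c * t" "c * t - 1" "c * t" 0 1 "\<lambda>z. (G z)\<^sup>2"]
      by (auto simp: L2_space_Ioo_eq_Icc L2_space_Icc_iff)
  qed
  then show "(\<lambda>x. G (c * t - x)) \<in> L2_space {0<..<1}" if "0 \<le> t" for t using that .
  fix t :: real assume t: "0 \<le> t"
  \<comment> \<open>for times up to \<open>t + 1\<close> the profiles only see \<open>G\<close> on this interval\<close>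
  define g where "g z = indicator {-1..c * (t + 1)} z * G z" for z
  have gm: "g \<in> borel_measurable lebesgue" and g2: "integrable lebesgue (\<lambda>z. (g z)\<^sup>2)"
  proof -
    have "integrable (lebesgue_on {-1..c * (t + 1)}) G" "integrable (lebesgue_on {-1..c * (t + 1)}) (\<lambda>z. (G z)\<^sup>2)"
      using G[of "c * (t + 1)"] by (simp_all add: L2_space_Icc_iff)
    then have "integrable lebesgue g" "integrable lebesgue (\<lambda>z. (g z)\<^sup>2)"
      unfolding g_def integrable_lebesgue_on_Icc_iff by (simp_all only: indicator_square)
    then show "g \<in> borel_measurable lebesgue" "integrable lebesgue (\<lambda>z. (g z)\<^sup>2)" by auto
  qed
  show "((\<lambda>s. L2_norm {0<..<1} (\<lambda>x. G (c * s - x) - G (c * t - x))) \<longlongrightarrow> 0) (at t within {0..})"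
    unfolding tendsto_at_iff_sequentially
  proof (intro allI impI)
    fix s :: "nat \<Rightarrow> real"
    assume s: "\<forall>n. s n \<in> {0..} - {t}" and st: "s \<longlonglongrightarrow> t"
    have h: "(\<lambda>n. c * (s n - t)) \<longlonglongrightarrow> 0"
      using tendsto_mult_right_zero[OF LIM_zero[OF st]] by simp
    note tr = L2_translation_continuous[OF gm g2 h]
    have "(\<lambda>n. LINT x|lebesgue_on {0<..<1}. (G (c * s n - x) - G (c * t - x))\<^sup>2) \<longlonglongrightarrow> 0"
    proof (rule Lim_null_comparison[OF _ tr(1)])
      have "\<forall>\<^sub>F n in sequentially. s n < t + 1"
        using order_tendstoD(2)[OF st] by simp
      then show "\<forall>\<^sub>F n in sequentially. norm (LINT x|lebesgue_on {0<..<1}. (G (c * s n - x) - G (c * t - x))\<^sup>2)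
          \<le> (LINT z|lebesgue. (g (z + c * (s n - t)) - g z)\<^sup>2)"
      proof eventually_elim
        fix n assume n: "s n < t + 1"
        let ?f = "\<lambda>z. (g (z + c * (s n - t)) - g z)\<^sup>2"
        have sn: "0 \<le> s n" using s by auto
        have e: "c * t - x + c * (s n - t) = c * s n - x" "c * t + -1 * x = c * t - x" for x
          by (simp_all add: algebra_simps)
        have i: "integrable lebesgue (\<lambda>x. (g (c * s n - x) - g (c * t - x))\<^sup>2)"
          using tr(2)[of "c * (s n - t)"] lebesgue_integrable_real_affine_iff[of "-1" ?f "c * t"]
          unfolding e by simp
        have "(LINT z|lebesgue. ?f z) = (LINT x|lebesgue. (g (c * s n - x) - g (c * t - x))\<^sup>2)"
          using lebesgue_integral_real_affine[of "-1" ?f "c * t"] unfolding e by simp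
        moreover have "(LINT x|lebesgue_on {0<..<1}. (G (c * s n - x) - G (c * t - x))\<^sup>2)
            \<le> (LINT x|lebesgue. (g (c * s n - x) - g (c * t - x))\<^sup>2)"
        proof -
          have gG: "g (c * r - x) = G (c * r - x)" if "x \<in> {0<..<1}" "r \<in> {0..t + 1}" for r x
          proof -
            have "0 \<le> c * r" "c * r \<le> c * (t + 1)" using c that(2) by auto
            then show ?thesis using that(1) unfolding g_def indicator_def by auto
          qed
          have "(LINT x|lebesgue_on {0<..<1}. (G (c * s n - x) - G (c * t - x))\<^sup>2)
             = (LINT x|lebesgue_on {0<..<1}. (g (c * s n - x) - g (c * t - x))\<^sup>2)"
            using n sn t by (intro Bochner_Integration.integral_cong refl) (simp add: gG)
          also have "\<dots> = (LINT x|lebesgue. indicator {0<..<1} x * (g (c * s n - x) - g (c * t - x))\<^sup>2)"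
            by (simp add: integral_restrict_space)
          also have "\<dots> \<le> (LINT x|lebesgue. (g (c * s n - x) - g (c * t - x))\<^sup>2)"
            using integrable_mult_indicator[OF _ i, of "{0<..<1}"]
            by (intro integral_mono i) (auto simp: indicator_def)
          finally show ?thesis .
        qed
        ultimately show "norm (LINT x|lebesgue_on {0<..<1}. (G (c * s n - x) - G (c * t - x))\<^sup>2) \<le> (LINT z|lebesgue. ?f z)"
          by simp
      qed
    qed
    from tendsto_real_sqrt[OF this]
    show "((\<lambda>s. L2_norm {0<..<1} (\<lambda>x. G (c * s - x) - G (c * t - x))) \<circ> s) \<longlonglongrightarrow> 0"
      by (simp add: L2_norm_def o_def)
  qed
qed

text \<open>For \<open>\<rho>(t,x) = G(c t - x)\<close> the mass is the integral of \<open>G\<close> over \<open>[c t - 1, c t]\<close> and \<open>y(t) = c G(c t - 1)\<close>, so the delay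
equation says precisely that \<open>c G(c t)\<close> is the influx prescribed by the feedback.\<close>

lemma weak_solution_exists:
  assumes c: "c > 0" and rho0: "\<rho>0 \<in> L2_space {0<..<1}"
  shows "\<exists>\<rho>. weak_solution c k d \<rho>0 \<rho>"
proof -
  have "(\<lambda>z. \<rho>0 (- z)) \<in> L2_space {-1..0}"
    using rho0 integrable_lebesgue_on_Icc_affine[of "-1" 0 0 1 "-1" 0 \<rho>0]
      integrable_lebesgue_on_Icc_affine[of "-1" 0 0 1 "-1" 0 "\<lambda>z. (\<rho>0 z)\<^sup>2"]
    by (simp add: L2_space_Ioo_eq_Icc L2_space_Icc_iff conj_commute)
  from delay_equation_solution[OF this, of k d] obtain G
    where G: "\<And>b. G \<in> L2_space {-1..b}"
      and init: "\<And>z. z \<in> {-1..<0} \<Longrightarrow> G z = \<rho>0 (- z)"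
      and delay: "\<And>z. 0 \<le> z \<Longrightarrow> G z = k * G (z - 1) + (k - 1) * d * (LINT s|lebesgue_on {z - 1..z}. G s)"
    by blast
  define \<rho> where "\<rho> t x = G (c * t - x)" for t x
  define y where "y t = c * G (c * t - 1)" for t
  have "\<rho> \<in> C0_L2"
    using transported_profile_C0_L2[OF c G] by (simp add: \<rho>_def[abs_def])
  moreover have "y \<in> L2_loc"
    unfolding L2_loc_def mem_Collect_eq
  proof (intro allI impI)
    fix T :: real assume "T > 0"
    have "(\<lambda>t. G (-1 + c * t)) \<in> L2_space {0..T}"
      using G[of "c * T - 1"] c integrable_lebesgue_on_Icc_affine[of c "-1" "-1" "c * T - 1" 0 T G]
        integrable_lebesgue_on_Icc_affine[of c "-1" "-1" "c * T - 1" 0 T "\<lambda>z. (G z)\<^sup>2"]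
      by (simp add: L2_space_Icc_iff zero_le_mult_iff)
    from L2_space_linear[OF this this, of c 0] show "y \<in> L2_space {0..T}"
      by (simp add: y_def[abs_def])
  qed
  moreover have "- (LINT t|lebesgue_on {0..\<tau>}. LINT x|lebesgue_on {0<..<1}. \<rho> t x * (\<phi>t t x + c * \<phi>x t x))
        - (LINT x|lebesgue_on {0<..<1}. \<rho>0 x * \<phi> 0 x)
        + (LINT t|lebesgue_on {0..\<tau>}.
             y t * \<phi> t 1 - (k * y t + (k - 1) * d * c * total_mass \<rho> t) * \<phi> t 0) = 0"
    if tau: "\<tau> > 0" and C1: "C1_rect \<tau> \<phi> \<phi>t \<phi>x" and final: "\<forall>x\<in>{0..1}. \<phi> \<tau> x = 0" for \<tau> \<phi> \<phi>t \<phi>x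
  proof -
    have mass: "total_mass \<rho> t = (LINT s|lebesgue_on {c * t - 1..c * t}. G s)" for t
      using integral_lebesgue_on_Icc_affine[of "-1" "c * t" "c * t - 1" "c * t" 0 1 G]
      by (simp add: total_mass_def \<rho>_def lebesgue_on_Ioo_iff_Icc conj_commute)
    have influx: "k * y t + (k - 1) * d * c * total_mass \<rho> t = c * G (c * t)" if "0 \<le> t" for t
    proof -
      have "c * G (c * t) = c * (k * G (c * t - 1) + (k - 1) * d * total_mass \<rho> t)"
        using delay[of "c * t"] c that by (simp add: mass)
      then show ?thesis by (simp add: y_def algebra_simps)
    qed
    have Gi: "integrable (lebesgue_on {-1..c * \<tau>}) G"
      using G by (simp add: L2_space_Icc_iff)
    have cphi: "continuous_on ({0..\<tau>} \<times> {0..1}) (\<lambda>p. \<phi> (fst p) (snd p))"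
      using C1 by (simp add: C1_rect_def case_prod_beta)
    have cphi': "continuous_on {0..\<tau>} (\<lambda>t. \<phi> t x)" if "x \<in> {0..1}" for x
      by (rule continuous_on_compose2[OF cphi, of _ "\<lambda>t. (t, x)", simplified])
         (use that in \<open>auto intro!: continuous_intros\<close>)
    have G1: "integrable (lebesgue_on {0..\<tau>}) (\<lambda>t. G (c * t - 1))"
      using G[of "c * \<tau> - 1"] c integrable_lebesgue_on_Icc_affine[of c "-1" "-1" "c * \<tau> - 1" 0 \<tau> G]
      by (simp add: L2_space_Icc_iff zero_le_mult_iff)
    have G0: "integrable (lebesgue_on {0..\<tau>}) (\<lambda>t. G (c * t))"
    proof -
      have "integrable (lebesgue_on {0..c * \<tau>}) G"
        by (rule integrable_subinterval[OF Gi]) auto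
      then show ?thesis
        using c integrable_lebesgue_on_Icc_affine[of c 0 0 "c * \<tau>" 0 \<tau> G] by (simp add: zero_le_mult_iff)
    qed
    have i1: "integrable (lebesgue_on {0..\<tau>}) (\<lambda>t. c * (G (c * t - 1) * \<phi> t 1))"
      and i0: "integrable (lebesgue_on {0..\<tau>}) (\<lambda>t. c * (G (c * t) * \<phi> t 0))"
      using integrable_continuous_mult[OF cphi'[of 1] G1] integrable_continuous_mult[OF cphi'[of 0] G0]
      by (simp_all add: mult.commute)
    have "(LINT t|lebesgue_on {0..\<tau>}. y t * \<phi> t 1 - (k * y t + (k - 1) * d * c * total_mass \<rho> t) * \<phi> t 0)
       = (LINT t|lebesgue_on {0..\<tau>}. c * (G (c * t - 1) * \<phi> t 1) - c * (G (c * t) * \<phi> t 0))"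
      by (intro Bochner_Integration.integral_cong refl) (simp add: influx[unfolded y_def] y_def)
    also have "\<dots> = c * (LINT t|lebesgue_on {0..\<tau>}. G (c * t - 1) * \<phi> t 1) - c * (LINT t|lebesgue_on {0..\<tau>}. G (c * t) * \<phi> t 0)"
      using Bochner_Integration.integral_diff[OF i1 i0] by simp
    moreover have "(LINT x|lebesgue_on {0<..<1}. \<rho>0 x * \<phi> 0 x) = (LINT x|lebesgue_on {0<..<1}. G (- x) * \<phi> 0 x)"
      by (intro Bochner_Integration.integral_cong refl) (simp add: init)
    ultimately show ?thesis
      using transport_weak_identity[OF c tau Gi C1] final by (simp add: \<rho>_def)
  qed
  ultimately show ?thesis
    unfolding weak_solution_def by blast
qed

lemma weak_solution_iff_transport:
  assumes "c > 0" "\<rho>0 \<in> L2_space {0<..<1}"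
  shows "weak_solution c k d \<rho>0 \<rho> \<longleftrightarrow> (\<exists>y. weak_transport c k d \<rho>0 \<rho> y)"
  unfolding weak_solution_def weak_transport_def using assms by blast

lemma stable_imp_solution_decays:
  assumes "c > 0" and "exponentially_stable c k d" and "\<rho>0 \<in> L2_space {0<..<1}"
  obtains \<rho> y where "weak_transport c k d \<rho>0 \<rho> y" "(weak_transport.sq_norm \<rho> \<longlongrightarrow> 0) at_top"
proof -
  from assms(2) obtain C \<alpha> where C: "C > 0" "\<alpha> > 0"
    and st: "\<And>\<rho>0. \<rho>0 \<in> L2_space {0<..<1} \<Longrightarrow> (\<exists>\<rho>. weak_solution c k d \<rho>0 \<rho>) \<and>
        (\<forall>\<rho>. weak_solution c k d \<rho>0 \<rho> \<longrightarrow>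
           (\<forall>t\<ge>0. L2_norm {0<..<1} (\<rho> t) \<le> C * exp (- \<alpha> * t) * L2_norm {0<..<1} \<rho>0))"
    unfolding exponentially_stable_def by blast
  from st[OF assms(3)] obtain \<rho> where ws: "weak_solution c k d \<rho>0 \<rho>"
    and dec: "\<And>t. t \<ge> 0 \<Longrightarrow> L2_norm {0<..<1} (\<rho> t) \<le> C * exp (- \<alpha> * t) * L2_norm {0<..<1} \<rho>0"
    by blast
  from ws obtain y where wt: "weak_transport c k d \<rho>0 \<rho> y"
    using weak_solution_iff_transport[OF assms(1,3)] by blast
  then interpret weak_transport c k d \<rho>0 \<rho> y .
  have "((\<lambda>t. exp (- \<alpha> * t)) \<longlongrightarrow> 0) at_top"
    using C by (intro filterlim_compose[OF exp_at_bot] filterlim_tendsto_neg_mult_at_bot[OF tendsto_const _ filterlim_ident]) simp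
  from tendsto_mult_right_zero[OF this, of "C * L2_norm {0<..<1} \<rho>0"]
  have lim0: "((\<lambda>t. C * exp (- \<alpha> * t) * L2_norm {0<..<1} \<rho>0) \<longlongrightarrow> 0) at_top"
    by (simp add: mult_ac)
  have "((\<lambda>t. L2_norm {0<..<1} (\<rho> t)) \<longlongrightarrow> 0) at_top"
  proof (rule tendsto_sandwich[OF _ _ tendsto_const lim0])
    show "\<forall>\<^sub>F t in at_top. L2_norm {0<..<1} (\<rho> t) \<le> C * exp (- \<alpha> * t) * L2_norm {0<..<1} \<rho>0"
      using eventually_ge_at_top[of 0] by eventually_elim (rule dec)
  qed (simp add: L2_norm_def)
  from tendsto_power[OF this, of 2] have "(sq_norm \<longlongrightarrow> 0) at_top"
    by (simp add: L2_norm_def sq_norm_def[abs_def])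
  with wt show thesis by (rule that)
qed

text \<open>The test data for necessity are \<open>x - 1/2\<close>, with zero mass and positive norm, for \<open>\<bar>k\<bar> < 1\<close>; and the constant \<open>1\<close>, with
energy \<open>1 + d\<close>, for \<open>d > -1\<close>.\<close>

lemma exponentially_stable_iff:
  assumes c: "c > 0"
  shows "exponentially_stable c k d \<longleftrightarrow> d > -1 \<and> \<bar>k\<bar> < 1"
proof
  assume cond: "d > -1 \<and> \<bar>k\<bar> < 1"
  define C where "C = sqrt ((1 + \<bar>d\<bar>) / (min 1 (1 + d) * decay_ratio c k d))"
  define \<alpha> where "\<alpha> = - (c * ln (decay_ratio c k d)) / 2"
  note th = decay_ratio_bounds[OF c, of k d]
  have C: "C > 0" "\<alpha> > 0"
    using cond th c by (auto simp: C_def \<alpha>_def min_def intro!: mult_pos_neg ln_less_zero divide_pos_pos mult_pos_pos)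
  show "exponentially_stable c k d"
    unfolding exponentially_stable_def
  proof (rule exI[of _ C], rule conjI[OF C(1)], rule exI[of _ \<alpha>], rule conjI[OF C(2)], intro ballI conjI allI impI)
    fix \<rho>0 assume r0: "\<rho>0 \<in> L2_space {0<..<1}"
    show "\<exists>\<rho>. weak_solution c k d \<rho>0 \<rho>"
      by (rule weak_solution_exists[OF c r0])
    fix \<rho> t assume "weak_solution c k d \<rho>0 \<rho>" and t: "0 \<le> (t::real)"
    then obtain y where "weak_transport c k d \<rho>0 \<rho> y"
      using weak_solution_iff_transport[OF c r0] by blast
    from weak_transport.exponential_decay[OF this _ _ t] cond
    show "L2_norm {0<..<1} (\<rho> t) \<le> C * exp (- \<alpha> * t) * L2_norm {0<..<1} \<rho>0"
      by (simp add: C_def \<alpha>_def)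
  qed
next
  assume st: "exponentially_stable c k d"
  have contL2: "f \<in> L2_space {0<..<1}" if "continuous_on {0..1} f" for f :: "real \<Rightarrow> real"
    unfolding L2_space_Ioo_eq_Icc by (rule continuous_imp_L2[OF that])
  have poly: "(LINT x|lebesgue_on {0<..<1}. x - 1/2 :: real) = 0" "(LINT x|lebesgue_on {0<..<1}. (x - 1/2 :: real)\<^sup>2) = 1/12"
  proof -
    have "((\<lambda>x::real. x - 1/2) has_integral (1\<^sup>2 / 2 - 1 / 2 - (0\<^sup>2 / 2 - 0 / 2))) {0..1}"
      by (rule fundamental_theorem_of_calculus)
         (auto intro!: derivative_eq_intros simp: has_real_derivative_iff_has_vector_derivative[symmetric])
    then show "(LINT x|lebesgue_on {0<..<1}. x - 1/2 :: real) = 0"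
      by (subst lebesgue_on_Ioo_iff_Icc(2), subst lebesgue_integral_eq_integral)
         (auto intro!: integrable_continuous_lebesgue_on continuous_intros integral_unique)
    have "((\<lambda>x::real. (x - 1/2)\<^sup>2) has_integral ((1 - 1/2) ^ 3 / 3 - (0 - 1/2) ^ 3 / 3)) {0..1}"
      by (rule fundamental_theorem_of_calculus)
         (auto intro!: derivative_eq_intros simp: has_real_derivative_iff_has_vector_derivative[symmetric])
    then have "((\<lambda>x::real. (x - 1/2)\<^sup>2) has_integral 1/12) {0..1}"
      by (simp add: power3_eq_cube)
    from integral_unique[OF this] show "(LINT x|lebesgue_on {0<..<1}. (x - 1/2 :: real)\<^sup>2) = 1/12"
      by (subst lebesgue_on_Ioo_iff_Icc(2), subst lebesgue_integral_eq_integral)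
         (auto intro!: integrable_continuous_lebesgue_on continuous_intros)
  qed
  have k: "\<bar>k\<bar> < 1"
  proof (rule ccontr)
    assume "\<not> \<bar>k\<bar> < 1"
    then have k1: "1 \<le> k\<^sup>2" by (simp add: abs_square_less_1 flip: not_less)
    have "(\<lambda>x. x - 1/2) \<in> L2_space {0<..<1}"
      by (rule contL2) (intro continuous_intros)
    from stable_imp_solution_decays[OF c st this]
    obtain \<rho> y where w: "weak_transport c k d (\<lambda>x. x - 1/2) \<rho> y" and lim: "(weak_transport.sq_norm \<rho> \<longlongrightarrow> 0) at_top" .
    interpret weak_transport c k d "\<lambda>x. x - 1/2" \<rho> y by (rule w)
    show False
      using energy_nonpos_if_decay[OF lim k1] initial_values by (simp add: energy_def poly)
  qed
  then have k2: "k\<^sup>2 < 1" by (simp add: abs_square_less_1)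
  have "(\<lambda>x. 1) \<in> L2_space {0<..<1}"
    by (rule contL2) (intro continuous_intros)
  from stable_imp_solution_decays[OF c st this]
  obtain \<rho> y where w: "weak_transport c k d (\<lambda>x. 1) \<rho> y" and lim: "(weak_transport.sq_norm \<rho> \<longlongrightarrow> 0) at_top" .
  interpret weak_transport c k d "\<lambda>x. 1" \<rho> y by (rule w)
  have e0: "energy 0 = 1 + d" and W0: "W 0 = 1"
    using initial_values by (simp_all add: energy_def measure_restrict_space)
  have "d \<noteq> -1"
    using mass_zero_if_decay[OF lim k2] e0 W0 by auto
  moreover have "d \<ge> -1"
    using energy_nonneg_if_decay[OF lim] e0 k2 by simp
  ultimately show "d > -1 \<and> \<bar>k\<bar> < 1" using k by simp
qed

theorem theorem3p1:
  fixes lam :: "real \<Rightarrow> real" and rhobar k d :: real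
  assumes lam_C1: "lam C1_differentiable_on UNIV"
    and lam_pos: "\<And>r. 0 < lam r"
    and d_eq: "d = rhobar * deriv lam rhobar / lam rhobar"
  shows "exponentially_stable (lam rhobar) k d \<longleftrightarrow> d > -1 \<and> \<bar>k\<bar> < 1"
  by (rule exponentially_stable_iff[OF lam_pos])

end
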